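(* Let $X$ be a Gromov manifold of real dimension $2n$, let $\Omega\subset X$ be a compact domain, and assume that $u$ is a $C^2$ Lagrangian plurisubharmonic function on $\overline\Omega$ which satisfies the equation $$\mathrm M_{\mathrm{Lag}}(\mathrm{Hess}\,u)=f>0$$ on $\overline\Omega$. Then the linearization of $\mathrm M_{\mathrm{Lag}}$ at this solution is uniformly elliptic.
   Context: A Gromov manifold is a triple $(X,\omega,J)$ where $(X,\omega)$ is a symplectic manifold of real dimension $2n$ and $J$ is an almost complex structure with $\omega(v,w)=\omega(Jv,Jw)$ and $\omega(Jv,v)>0$ for all non-zero tangent vectors. It carries the riemannian metric $\langle v,w\rangle=\omega(Jv,w)$, with Levi-Civita connection $\nabla$ and riemannian Hessian $(\mathrm{Hess}\,f)(v,w)=vwf-(\nabla_vw)f$, regarded via the metric as a symmetric endomorphism of $TX$. A $C^2$ function $u$ is Lagrangian plurisubharmonic if $\mathrm{tr}(\mathrm{Hess}_xu|_W)\ge0$ for all $x$ and all Lagrangian $n$-planes $W\subset T_xX$ (i.e. $\omega|_W=0$). For a symmetric endomorphism $A$ of $T_xX$ let $\mu=\frac12\mathrm{tr}A$ and let $\pm\lambda_1,\dots,\pm\lambda_n$ ($\lambda_j\ge0$) be the eigenvalues of $A^{\mathrm{skew}}=\frac12(A+JAJ)$. The Lagrangian Monge-Ampère operator is $\mathrm M_{\mathrm{Lag}}(A)=\prod_\pm(\mu\pm\lambda_1\pm\cdots\pm\lambda_n)$ over all $2^n$ sign choices; it is a polynomial in $A$. "Compact domain" means that $\overline\Omega$ is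 compact. The linearization at $u$ is the linear operator $v\mapsto(d\,\mathrm M_{\mathrm{Lag}})_{\mathrm{Hess}\,u}(\mathrm{Hess}\,v)$; it is uniformly elliptic on $\overline\Omega$ if there is $c>0$ such that $(d\,\mathrm M_{\mathrm{Lag}})_{\mathrm{Hess}_xu}(P)\ge c\,\mathrm{tr}P$ for all $x\in\overline\Omega$ and all symmetric $P\ge0$ on $T_xX$. *)

theory Defs
  imports "HOL-Analysis.Analysis"
begin

text \<open>
  The manifold is a type \<^typ>\<open>'a\<close> (of class \<open>{second_countable_topology, t2_space}\<close> in the main
  statement) with an atlas modelled on \<open>real ^ ('n + 'n)\<close>; thus \<open>n = CARD('n)\<close> and the real
  dimension is \<open>2n\<close>.
\<close>

section \<open>Smooth maps between Euclidean spaces\<close>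

text \<open>Only meant for open \<^term>\<open>S\<close>.\<close>

primrec Ck_on :: "nat \<Rightarrow> 'e::euclidean_space set \<Rightarrow> ('e \<Rightarrow> 'f::real_normed_vector) \<Rightarrow> bool" where
  "Ck_on 0 S f \<longleftrightarrow> continuous_on S f"
| "Ck_on (Suc k) S f \<longleftrightarrow>
     (\<forall>x\<in>S. f differentiable (at x)) \<and> (\<forall>v. Ck_on k S (\<lambda>x. frechet_derivative f (at x) v))"

definition Cinf_on :: "'e::euclidean_space set \<Rightarrow> ('e \<Rightarrow> 'f::real_normed_vector) \<Rightarrow> bool" where
  "Cinf_on S f \<longleftrightarrow> (\<forall>k. Ck_on k S f)"


section \<open>Smooth manifolds of dimension \<open>2n\<close>\<close>

type_synonym 'n model = "real ^ ('n + 'n)"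
type_synonym 'n endo = "real ^ ('n + 'n) ^ ('n + 'n)"
type_synonym ('a, 'n) chart = "'a set \<times> ('a \<Rightarrow> 'n model)"

abbreviation dom_of :: "('a, 'n::finite) chart \<Rightarrow> 'a set" where "dom_of c \<equiv> fst c"
abbreviation coord :: "('a, 'n::finite) chart \<Rightarrow> 'a \<Rightarrow> 'n model" where "coord c \<equiv> snd c"

definition param :: "('a, 'n::finite) chart \<Rightarrow> 'n model \<Rightarrow> 'a" where
  "param c = inv_into (dom_of c) (coord c)"

definition is_chart :: "('a::topological_space, 'n::finite) chart \<Rightarrow> bool" where
  "is_chart c \<longleftrightarrow> open (dom_of c) \<and> open (coord c ` dom_of c) \<and>
     homeomorphism (dom_of c) (coord c ` dom_of c) (coord c) (param c)"

definition smooth_atlas :: "('a::topological_space, 'n::finite) chart set \<Rightarrow> bool" where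
  "smooth_atlas \<A> \<longleftrightarrow>
     (\<forall>c\<in>\<A>. is_chart c) \<and> (\<Union>c\<in>\<A>. dom_of c) = UNIV \<and>
     (\<forall>c\<in>\<A>. \<forall>d\<in>\<A>. Cinf_on (coord c ` (dom_of c \<inter> dom_of d)) (coord d \<circ> param c))"

text \<open>
  A preferred chart is chosen around every point \<^term>\<open>p\<close>, and the tangent space at \<^term>\<open>p\<close> is
  identified with the model space by means of it: a vector \<^term>\<open>\<xi>\<close> of the model space stands for
  the tangent vector at \<^term>\<open>p\<close> with components \<^term>\<open>\<xi>\<close> in the preferred chart. Since the preferred
  chart varies with \<^term>\<open>p\<close> in no regular way, regularity of fields is always expressed through
  their components in a fixed chart.
\<close>

definition chart_at :: "('a, 'n::finite) chart set \<Rightarrow> 'a \<Rightarrow> ('a, 'n) chart" where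
  "chart_at \<A> p = (SOME c. c \<in> \<A> \<and> p \<in> dom_of c)"

text \<open>The vector field on the domain of \<^term>\<open>c\<close> with constant components \<^term>\<open>v\<close> in \<^term>\<open>c\<close>, and
  the components in \<^term>\<open>c\<close> of a tangent vector \<^term>\<open>\<xi>\<close> at \<^term>\<open>p\<close>.\<close>

definition coord_field ::
    "('a, 'n::finite) chart set \<Rightarrow> ('a, 'n) chart \<Rightarrow> 'n model \<Rightarrow> 'a \<Rightarrow> 'n model" where
  "coord_field \<A> c v p =
     frechet_derivative (coord (chart_at \<A> p) \<circ> param c) (at (coord c p)) v"

definition components ::
    "('a, 'n::finite) chart set \<Rightarrow> ('a, 'n) chart \<Rightarrow> 'a \<Rightarrow> 'n model \<Rightarrow> 'n model" where
  "components \<A> c p \<xi> =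
     frechet_derivative (coord c \<circ> param (chart_at \<A> p)) (at (coord (chart_at \<A> p) p)) \<xi>"

text \<open>The derivative \<open>\<xi> f\<close> of a function in the direction of a tangent vector \<open>\<xi>\<close> at \<open>p\<close>.\<close>

definition dir_deriv ::
    "('a, 'n::finite) chart set \<Rightarrow> ('a \<Rightarrow> real) \<Rightarrow> 'a \<Rightarrow> 'n model \<Rightarrow> real" where
  "dir_deriv \<A> f p \<xi> =
     frechet_derivative (f \<circ> param (chart_at \<A> p)) (at (coord (chart_at \<A> p) p)) \<xi>"

definition Ck_fun_on ::
    "('a, 'n::finite) chart set \<Rightarrow> nat \<Rightarrow> 'a set \<Rightarrow> ('a \<Rightarrow> real) \<Rightarrow> bool" where
  "Ck_fun_on \<A> k U f \<longleftrightarrow> (\<forall>c\<in>\<A>. Ck_on k (coord c ` (dom_of c \<inter> U)) (f \<circ> param c))"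

definition smooth_fun_on :: "('a, 'n::finite) chart set \<Rightarrow> 'a set \<Rightarrow> ('a \<Rightarrow> real) \<Rightarrow> bool" where
  "smooth_fun_on \<A> U f \<longleftrightarrow> (\<forall>k. Ck_fun_on \<A> k U f)"

definition smooth_field_on ::
    "('a, 'n::finite) chart set \<Rightarrow> 'a set \<Rightarrow> ('a \<Rightarrow> 'n model) \<Rightarrow> bool" where
  "smooth_field_on \<A> U V \<longleftrightarrow>
     (\<forall>c\<in>\<A>. Cinf_on (coord c ` (dom_of c \<inter> U))
        (\<lambda>y. components \<A> c (param c y) (V (param c y))))"

definition smooth_fun_near ::
    "('a::topological_space, 'n::finite) chart set \<Rightarrow> 'a \<Rightarrow> ('a \<Rightarrow> real) \<Rightarrow> bool" where
  "smooth_fun_near \<A> p f \<longleftrightarrow> (\<exists>U. open U \<and> p \<in> U \<and> smooth_fun_on \<A> U f)"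

definition smooth_field_near ::
    "('a::topological_space, 'n::finite) chart set \<Rightarrow> 'a \<Rightarrow> ('a \<Rightarrow> 'n model) \<Rightarrow> bool" where
  "smooth_field_near \<A> p V \<longleftrightarrow> (\<exists>U. open U \<and> p \<in> U \<and> smooth_field_on \<A> U V)"


section \<open>Gromov manifolds\<close>

record ('a, 'n) gromov =
  atlas :: "('a, 'n) chart set"
  symp :: "'a \<Rightarrow> 'n model \<Rightarrow> 'n model \<Rightarrow> real"
  cplx :: "'a \<Rightarrow> 'n endo"

text \<open>Closedness is stated as \<open>d\<omega>(\<partial>u, \<partial>v, \<partial>w) = 0\<close> on coordinate fields, whose brackets vanish.\<close>

definition symplectic_form ::
    "('a::topological_space, 'n::finite) chart set \<Rightarrow> ('a \<Rightarrow> 'n model \<Rightarrow> 'n model \<Rightarrow> real) \<Rightarrow> bool" where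
  "symplectic_form \<A> \<omega> \<longleftrightarrow>
     (\<forall>p. bilinear (\<omega> p) \<and> (\<forall>v w. \<omega> p v w = - \<omega> p w v) \<and> (\<forall>v. v \<noteq> 0 \<longrightarrow> (\<exists>w. \<omega> p v w \<noteq> 0))) \<and>
     (\<forall>c\<in>\<A>. \<forall>v w. smooth_fun_on \<A> (dom_of c)
        (\<lambda>q. \<omega> q (coord_field \<A> c v q) (coord_field \<A> c w q))) \<and>
     (\<forall>c\<in>\<A>. \<forall>p\<in>dom_of c. \<forall>u v w.
        dir_deriv \<A> (\<lambda>q. \<omega> q (coord_field \<A> c v q) (coord_field \<A> c w q)) p (coord_field \<A> c u p) +
        dir_deriv \<A> (\<lambda>q. \<omega> q (coord_field \<A> c w q) (coord_field \<A> c u q)) p (coord_field \<A> c v p) +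
        dir_deriv \<A> (\<lambda>q. \<omega> q (coord_field \<A> c u q) (coord_field \<A> c v q)) p (coord_field \<A> c w p)
        = 0)"

definition almost_complex_structure ::
    "('a::topological_space, 'n::finite) chart set \<Rightarrow> ('a \<Rightarrow> 'n endo) \<Rightarrow> bool" where
  "almost_complex_structure \<A> J \<longleftrightarrow>
     (\<forall>p. J p ** J p = - mat 1) \<and>
     (\<forall>c\<in>\<A>. \<forall>v. smooth_field_on \<A> (dom_of c) (\<lambda>q. J q *v coord_field \<A> c v q))"

definition gromov_manifold :: "('a::topological_space, 'n::finite) gromov \<Rightarrow> bool" where
  "gromov_manifold X \<longleftrightarrow>
     smooth_atlas (atlas X) \<and>
     symplectic_form (atlas X) (symp X) \<and>
     almost_complex_structure (atlas X) (cplx X) \<and>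
     (\<forall>p v w. symp X p v w = symp X p (cplx X p *v v) (cplx X p *v w)) \<and>
     (\<forall>p v. v \<noteq> 0 \<longrightarrow> symp X p (cplx X p *v v) v > 0)"

definition metric :: "('a, 'n::finite) gromov \<Rightarrow> 'a \<Rightarrow> 'n model \<Rightarrow> 'n model \<Rightarrow> real" where
  "metric X p v w = symp X p (cplx X p *v v) w"


section \<open>Levi-Civita connection and Riemannian Hessian\<close>

text \<open>
  \<open>D p v W\<close> is the covariant derivative at \<open>p\<close>, in the direction of the tangent vector \<open>v\<close> at \<open>p\<close>, of
  a vector field \<open>W\<close> that is smooth near \<open>p\<close>; its values on other \<open>W\<close> are irrelevant. The functions
  \<open>f\<close> are only required to be smooth near \<open>p\<close>, so the Leibniz rule forces \<open>D p v W\<close> to depend only on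
  the germ of \<open>W\<close> at \<open>p\<close>.
\<close>

definition affine_connection ::
    "('a::topological_space, 'n::finite) chart set \<Rightarrow>
     ('a \<Rightarrow> 'n model \<Rightarrow> ('a \<Rightarrow> 'n model) \<Rightarrow> 'n model) \<Rightarrow> bool" where
  "affine_connection \<A> D \<longleftrightarrow>
     (\<forall>p W. smooth_field_near \<A> p W \<longrightarrow> linear (\<lambda>v. D p v W)) \<and>
     (\<forall>p v V W. smooth_field_near \<A> p V \<longrightarrow> smooth_field_near \<A> p W \<longrightarrow>
        D p v (\<lambda>q. V q + W q) = D p v V + D p v W) \<and>
     (\<forall>p v f W. smooth_fun_near \<A> p f \<longrightarrow> smooth_field_near \<A> p W \<longrightarrow>
        D p v (\<lambda>q. f q *\<^sub>R W q) = dir_deriv \<A> f p v *\<^sub>R W p + f p *\<^sub>R D p v W) \<and>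
     (\<forall>U V W. open U \<longrightarrow> smooth_field_on \<A> U V \<longrightarrow> smooth_field_on \<A> U W \<longrightarrow>
        smooth_field_on \<A> U (\<lambda>q. D q (V q) W))"

text \<open>\<open>\<nabla>\<^sub>V W - \<nabla>\<^sub>W V = [V, W]\<close>, both sides being applied to functions.\<close>

definition torsion_free ::
    "('a::topological_space, 'n::finite) chart set \<Rightarrow>
     ('a \<Rightarrow> 'n model \<Rightarrow> ('a \<Rightarrow> 'n model) \<Rightarrow> 'n model) \<Rightarrow> bool" where
  "torsion_free \<A> D \<longleftrightarrow>
     (\<forall>p V W f. smooth_field_near \<A> p V \<longrightarrow> smooth_field_near \<A> p W \<longrightarrow> smooth_fun_near \<A> p f \<longrightarrow>
        dir_deriv \<A> f p (D p (V p) W - D p (W p) V) =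
        dir_deriv \<A> (\<lambda>q. dir_deriv \<A> f q (W q)) p (V p) -
        dir_deriv \<A> (\<lambda>q. dir_deriv \<A> f q (V q)) p (W p))"

definition metric_connection ::
    "('a::topological_space, 'n::finite) chart set \<Rightarrow> ('a \<Rightarrow> 'n model \<Rightarrow> 'n model \<Rightarrow> real) \<Rightarrow>
     ('a \<Rightarrow> 'n model \<Rightarrow> ('a \<Rightarrow> 'n model) \<Rightarrow> 'n model) \<Rightarrow> bool" where
  "metric_connection \<A> g D \<longleftrightarrow>
     (\<forall>p v V W. smooth_field_near \<A> p V \<longrightarrow> smooth_field_near \<A> p W \<longrightarrow>
        dir_deriv \<A> (\<lambda>q. g q (V q) (W q)) p v = g p (D p v V) (W p) + g p (V p) (D p v W))"

definition levi_civita ::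
    "('a::topological_space, 'n::finite) gromov \<Rightarrow>
     ('a \<Rightarrow> 'n model \<Rightarrow> ('a \<Rightarrow> 'n model) \<Rightarrow> 'n model) \<Rightarrow> bool" where
  "levi_civita X D \<longleftrightarrow> affine_connection (atlas X) D \<and> torsion_free (atlas X) D \<and>
     metric_connection (atlas X) (metric X) D"

text \<open>
  \<open>(Hess u)(v, w) = v w u - (\<nabla>\<^sub>v w) u\<close>; the value does not depend on the vector field extending the
  tangent vector \<open>w\<close>, and the coordinate field of the preferred chart at \<open>p\<close> is used.
\<close>

definition hess_form ::
    "('a::topological_space, 'n::finite) gromov \<Rightarrow>
     ('a \<Rightarrow> 'n model \<Rightarrow> ('a \<Rightarrow> 'n model) \<Rightarrow> 'n model) \<Rightarrow>
     ('a \<Rightarrow> real) \<Rightarrow> 'a \<Rightarrow> 'n model \<Rightarrow> 'n model \<Rightarrow> real" where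
  "hess_form X D u p v w =
     (let W = coord_field (atlas X) (chart_at (atlas X) p) w
      in dir_deriv (atlas X) (\<lambda>q. dir_deriv (atlas X) u q (W q)) p v
         - dir_deriv (atlas X) u p (D p v W))"

text \<open>
  \<open>u \<in> C\<^sup>2(closure \<Omega>)\<close> for open \<open>\<Omega>\<close>, in the usual sense: \<open>u\<close> is \<open>C\<^sup>2\<close> in \<open>\<Omega>\<close>, and \<open>u\<close> and its partial
  derivatives of order one and two extend continuously to the closure.
  Functions that are \<open>C\<^sup>2\<close> on a neighbourhood of the closure are a special case.
\<close>

definition C2_on_closure ::
    "('a::topological_space, 'n::finite) chart set \<Rightarrow> 'a set \<Rightarrow> ('a \<Rightarrow> real) \<Rightarrow> bool" where
  "C2_on_closure \<A> \<Omega> u \<longleftrightarrow>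
     continuous_on (closure \<Omega>) u \<and> Ck_fun_on \<A> 2 \<Omega> u \<and>
     (\<forall>c\<in>\<A>. \<forall>x \<in> closure \<Omega> \<inter> dom_of c. \<forall>v w.
        (\<exists>l. ((\<lambda>q. dir_deriv \<A> u q (coord_field \<A> c v q)) \<longlongrightarrow> l) (at x within \<Omega>)) \<and>
        (\<exists>l. ((\<lambda>q. dir_deriv \<A> (\<lambda>r. dir_deriv \<A> u r (coord_field \<A> c w r)) q
                   (coord_field \<A> c v q)) \<longlongrightarrow> l) (at x within \<Omega>)))"

text \<open>The Hessian at all points of the closure: at boundary points it is the limit from inside,
  taken componentwise in the preferred chart at the boundary point.\<close>

definition hess_form_closure ::
    "('a::topological_space, 'n::finite) gromov \<Rightarrow>
     ('a \<Rightarrow> 'n model \<Rightarrow> ('a \<Rightarrow> 'n model) \<Rightarrow> 'n model) \<Rightarrow>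
     'a set \<Rightarrow> ('a \<Rightarrow> real) \<Rightarrow> 'a \<Rightarrow> 'n model \<Rightarrow> 'n model \<Rightarrow> real" where
  "hess_form_closure X D \<Omega> u x v w =
     (if x \<in> \<Omega> then hess_form X D u x v w
      else (let c = chart_at (atlas X) x
            in Lim (at x within \<Omega>)
                 (\<lambda>q. hess_form X D u q (coord_field (atlas X) c v q) (coord_field (atlas X) c w q))))"

definition endo_of_form ::
    "('n::finite model \<Rightarrow> 'n model \<Rightarrow> real) \<Rightarrow> ('n model \<Rightarrow> 'n model \<Rightarrow> real) \<Rightarrow> 'n endo" where
  "endo_of_form g H = (THE A. \<forall>v w. g (A *v v) w = H v w)"

definition Hess ::
    "('a::topological_space, 'n::finite) gromov \<Rightarrow>
     ('a \<Rightarrow> 'n model \<Rightarrow> ('a \<Rightarrow> 'n model) \<Rightarrow> 'n model) \<Rightarrow>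
     'a set \<Rightarrow> ('a \<Rightarrow> real) \<Rightarrow> 'a \<Rightarrow> 'n endo" where
  "Hess X D \<Omega> u x = endo_of_form (metric X x) (hess_form_closure X D \<Omega> u x)"


section \<open>Lagrangian plurisubharmonicity\<close>

definition lagrangian ::
    "('n::finite model \<Rightarrow> 'n model \<Rightarrow> real) \<Rightarrow> 'n model set \<Rightarrow> bool" where
  "lagrangian \<omega> W \<longleftrightarrow> subspace W \<and> dim W = CARD('n) \<and> (\<forall>v\<in>W. \<forall>w\<in>W. \<omega> v w = 0)"

definition orthonormal_basis ::
    "('n::finite model \<Rightarrow> 'n model \<Rightarrow> real) \<Rightarrow> 'n model set \<Rightarrow> 'n model set \<Rightarrow> bool" where
  "orthonormal_basis g W B \<longleftrightarrow> B \<subseteq> W \<and> span B = W \<and>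
     (\<forall>b\<in>B. \<forall>b'\<in>B. g b b' = (if b = b' then 1 else 0))"

text \<open>\<open>tr (A|\<^sub>W)\<close>: the trace of the quadratic form \<open>g (A v) v\<close> restricted to \<open>W\<close>; every orthonormal
  basis of \<open>W\<close> gives the same value.\<close>

definition trace_on ::
    "('n::finite model \<Rightarrow> 'n model \<Rightarrow> real) \<Rightarrow> 'n endo \<Rightarrow> 'n model set \<Rightarrow> real" where
  "trace_on g A W = (\<Sum>b \<in> (SOME B. orthonormal_basis g W B). g (A *v b) b)"

definition lagrangian_psh_on_closure ::
    "('a::topological_space, 'n::finite) gromov \<Rightarrow>
     ('a \<Rightarrow> 'n model \<Rightarrow> ('a \<Rightarrow> 'n model) \<Rightarrow> 'n model) \<Rightarrow> 'a set \<Rightarrow> ('a \<Rightarrow> real) \<Rightarrow> bool" where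
  "lagrangian_psh_on_closure X D \<Omega> u \<longleftrightarrow>
     (\<forall>x\<in>closure \<Omega>. \<forall>W. lagrangian (symp X x) W \<longrightarrow> trace_on (metric X x) (Hess X D \<Omega> u x) W \<ge> 0)"


section \<open>The Lagrangian Monge-Ampere operator\<close>

definition symmetric_endos :: "('n::finite model \<Rightarrow> 'n model \<Rightarrow> real) \<Rightarrow> 'n endo set" where
  "symmetric_endos g = {A. \<forall>v w. g (A *v v) w = g v (A *v w)}"

definition skew_part :: "'n::finite endo \<Rightarrow> 'n endo \<Rightarrow> 'n endo" where
  "skew_part J A = (1/2) *\<^sub>R (A + J ** A ** J)"

text \<open>The eigenvalues of \<open>S\<close>, with multiplicity, are \<open>\<plusminus>\<lambda>\<^sub>1, \<dots>, \<plusminus>\<lambda>\<^sub>n\<close> with \<open>\<lambda>\<^sub>j \<ge> 0\<close>.\<close>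

definition paired_eigenvalues :: "'n::finite endo \<Rightarrow> ('n \<Rightarrow> real) \<Rightarrow> bool" where
  "paired_eigenvalues S lam \<longleftrightarrow> (\<forall>j. lam j \<ge> 0) \<and>
     (\<forall>t::real. det (t *\<^sub>R mat 1 - S) = (\<Prod>j\<in>UNIV. (t - lam j) * (t + lam j)))"

text \<open>The \<open>\<lambda>\<^sub>j\<close> are unique up to order, on which the product does not depend. Only meaningful for
  symmetric \<open>A\<close>.\<close>

definition M_Lag :: "'n::finite endo \<Rightarrow> 'n endo \<Rightarrow> real" where
  "M_Lag J A =
     (let \<mu> = trace A / 2; lam = (SOME lam. paired_eigenvalues (skew_part J A) lam)
      in \<Prod>\<epsilon>\<in>(UNIV :: ('n \<Rightarrow> bool) set). \<mu> + (\<Sum>j\<in>UNIV. if \<epsilon> j then lam j else - lam j))"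

text \<open>Differential of \<^const>\<open>M_Lag\<close> at \<open>A\<close>, as a function on the space of symmetric endomorphisms;
  accordingly it is to be applied to symmetric endomorphisms only.\<close>

definition dM_Lag ::
    "('n::finite model \<Rightarrow> 'n model \<Rightarrow> real) \<Rightarrow> 'n endo \<Rightarrow> 'n endo \<Rightarrow> 'n endo \<Rightarrow> real" where
  "dM_Lag g J A = frechet_derivative (M_Lag J) (at A within symmetric_endos g)"

text \<open>The linearization at \<open>u\<close> is the operator sending \<open>v\<close> to the function
  \<open>x \<mapsto> linearization X D \<Omega> u x (Hess X D \<Omega> v x)\<close>; it is represented by its coefficients.\<close>

definition linearization ::
    "('a::topological_space, 'n::finite) gromov \<Rightarrow>
     ('a \<Rightarrow> 'n model \<Rightarrow> ('a \<Rightarrow> 'n model) \<Rightarrow> 'n model) \<Rightarrow>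
     'a set \<Rightarrow> ('a \<Rightarrow> real) \<Rightarrow> 'a \<Rightarrow> 'n endo \<Rightarrow> real" where
  "linearization X D \<Omega> u x = dM_Lag (metric X x) (cplx X x) (Hess X D \<Omega> u x)"

definition uniformly_elliptic_on ::
    "('a, 'n::finite) gromov \<Rightarrow> 'a set \<Rightarrow> ('a \<Rightarrow> 'n endo \<Rightarrow> real) \<Rightarrow> bool" where
  "uniformly_elliptic_on X K L \<longleftrightarrow>
     (\<exists>c>0. \<forall>x\<in>K. \<forall>P\<in>symmetric_endos (metric X x).
        (\<forall>v. metric X x (P *v v) v \<ge> 0) \<longrightarrow> L x P \<ge> c * trace P)"

end

theory Submission
  imports Defs
begin

text \<open>
  If \<open>M_Lag(A) > 0\<close> and \<open>A\<close> has nonnegative traces on Lagrangian planes, then \<open>\<mu> - \<Sum>\<lambda>\<^sub>j > 0\<close>: this is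
  the trace of \<open>A\<close> on a Lagrangian plane spanned by eigenvectors \<open>e\<^sub>1, \<dots>, e\<^sub>n\<close> of the skew part for
  \<open>-\<lambda>\<^sub>1, \<dots>, -\<lambda>\<^sub>n\<close>, and \<open>e\<^sub>j, J e\<^sub>j\<close> is an orthonormal basis. Hence all factors
  \<open>\<ell>\<^sub>\<epsilon> = \<mu> + \<Sum>\<epsilon>\<^sub>j \<lambda>\<^sub>j\<close> lie in \<open>(0, tr A]\<close>. The product of the factors is a polynomial in \<open>\<mu>\<close> and the even
  power sums of the \<open>\<lambda>\<^sub>j\<close>, that is, in \<open>tr A\<close> and the traces of the powers of the skew part; these traces have
  a differential that depends only on the diagonal entries of \<open>P\<close> in the basis \<open>e\<^sub>j, J e\<^sub>j\<close>. For diagonal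
  \<open>P\<close> the eigenvalues move linearly, which gives \<open>dM(P) = \<Sum>\<^sub>\<epsilon> (M / \<ell>\<^sub>\<epsilon>) tr (P|W\<^sub>\<epsilon>)\<close> with \<open>W\<^sub>\<epsilon>\<close> spanned by
  \<open>J e\<^sub>j\<close> (\<open>\<epsilon>\<^sub>j = 1\<close>) and \<open>e\<^sub>j\<close> (\<open>\<epsilon>\<^sub>j = -1\<close>). For \<open>P \<ge> 0\<close> all terms are nonnegative, and two opposite signs
  \<open>\<epsilon>\<close> already contribute \<open>(M / tr A) tr P\<close>. Finally \<open>M(Hess u) / tr (Hess u)\<close> is positive and continuous
  on the compact closure of \<open>\<Omega>\<close>, because traces can be computed in any chart and the components of the
  Hessian in a fixed chart extend continuously to the boundary.
\<close>

section \<open>Products over all signs as polynomials in even power sums\<close>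

text \<open>\<open>M_Lag\<close> multiplies expressions in eigenvalues picked by
  \<open>SOME\<close>: they come in no order, and where eigenvalues collide they need not be
  differentiable. Regularity is therefore never asked of eigenvalues, only of traces of powers. The
  polynomial behind \<open>M_Lag\<close> is not exhibited either. Instead, a property that survives
  constants, sums and products is carried from the power sums to the product. The link is a
  logarithmic derivative, used twice: with cosh it turns the even power sums of the eigenvalues into
  the moments of the 2^n signed sums, and with 1 + t (Newton) it turns these moments into the
  product. A second obstacle is that the tangent space at a point is identified with the model space
  through a chart that jumps from point to point. The matrix of the Hessian need not be continuous
  even in the interior, while traces do not notice the chart. The same traces thus serve both for
  the differential at one point and for continuity over the closure.\<close>

text \<open>The same polynomial expression is used to transport three properties \<open>Q\<close> of functions: invariance
  under the choice of the \<open>\<lambda>\<^sub>j\<close>, continuity, and differentiability along with a linear condition on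
  the differential. Only the values on \<open>Y\<close> matter.\<close>

definition fun_algebra :: "'y set \<Rightarrow> (('y \<Rightarrow> real) \<Rightarrow> bool) \<Rightarrow> bool" where
  "fun_algebra Y Q \<longleftrightarrow>
     (\<forall>c. Q (\<lambda>_. c)) \<and>
     (\<forall>\<phi> \<psi>. Q \<phi> \<longrightarrow> Q \<psi> \<longrightarrow> Q (\<lambda>y. \<phi> y + \<psi> y) \<and> Q (\<lambda>y. \<phi> y * \<psi> y)) \<and>
     (\<forall>\<phi> \<psi>. Q \<phi> \<longrightarrow> (\<forall>y\<in>Y. \<phi> y = \<psi> y) \<longrightarrow> Q \<psi>)"

lemma fun_algebraI:
  assumes "\<And>c. Q (\<lambda>_. c)"
    and "\<And>\<phi> \<psi>. Q \<phi> \<Longrightarrow> Q \<psi> \<Longrightarrow> Q (\<lambda>y. \<phi> y + \<psi> y)"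
    and "\<And>\<phi> \<psi>. Q \<phi> \<Longrightarrow> Q \<psi> \<Longrightarrow> Q (\<lambda>y. \<phi> y * \<psi> y)"
    and "\<And>\<phi> \<psi>. Q \<phi> \<Longrightarrow> (\<And>y. y \<in> Y \<Longrightarrow> \<phi> y = \<psi> y) \<Longrightarrow> Q \<psi>"
  shows "fun_algebra Y Q"
  unfolding fun_algebra_def using assms by metis

context
  fixes Y :: "'y set" and Q
  assumes alg: "fun_algebra Y Q"
begin

lemma fun_algebra_const: "Q (\<lambda>_. c)"
  and fun_algebra_add: "Q \<phi> \<Longrightarrow> Q \<psi> \<Longrightarrow> Q (\<lambda>y. \<phi> y + \<psi> y)"
  and fun_algebra_mult: "Q \<phi> \<Longrightarrow> Q \<psi> \<Longrightarrow> Q (\<lambda>y. \<phi> y * \<psi> y)"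
  using alg unfolding fun_algebra_def by auto

lemma fun_algebra_cong: "Q \<phi> \<Longrightarrow> (\<And>y. y \<in> Y \<Longrightarrow> \<phi> y = \<psi> y) \<Longrightarrow> Q \<psi>"
  using alg unfolding fun_algebra_def by metis

lemma fun_algebra_sum: "(\<And>i. i \<in> I \<Longrightarrow> Q (\<phi> i)) \<Longrightarrow> Q (\<lambda>y. \<Sum>i\<in>I. \<phi> i y)"
  by (induction I rule: infinite_finite_induct) (auto intro: fun_algebra_const fun_algebra_add)

lemma fun_algebra_power: "Q \<phi> \<Longrightarrow> Q (\<lambda>y. \<phi> y ^ k)"
  by (induction k) (auto intro: fun_algebra_const fun_algebra_mult)

text \<open>Comparing coefficients in F' = F H gives (m + 1) F_(m+1) as the sum of the F_i H_(m-i),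
  so each coefficient of F is a polynomial with rational coefficients in those of H.\<close>

lemma fun_algebra_log_deriv:
  fixes F H :: "'y \<Rightarrow> real fps"
  assumes F0: "\<And>y. y \<in> Y \<Longrightarrow> fps_nth (F y) 0 = 1"
    and F': "\<And>y. y \<in> Y \<Longrightarrow> fps_deriv (F y) = F y * H y"
    and H: "\<And>k. Q (\<lambda>y. fps_nth (H y) k)"
  shows "Q (\<lambda>y. fps_nth (F y) k)"
proof (induction k rule: less_induct)
  case (less k)
  show ?case
  proof (cases k)
    case 0
    show ?thesis
      by (rule fun_algebra_cong[OF fun_algebra_const[of 1]]) (simp add: 0 F0)
  next
    case (Suc m)
    have "Q (\<lambda>y. (1 / (real m + 1)) * (\<Sum>i=0..m. fps_nth (F y) i * fps_nth (H y) (m - i)))"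
      by (intro fun_algebra_mult fun_algebra_sum fun_algebra_const H less.IH) (use Suc in auto)
    then show ?thesis
    proof (rule fun_algebra_cong)
      fix y assume y: "y \<in> Y"
      have "fps_nth (fps_deriv (F y)) m = (\<Sum>i=0..m. fps_nth (F y) i * fps_nth (H y) (m - i))"
        unfolding F'[OF y] fps_mult_nth ..
      moreover have "fps_nth (fps_deriv (F y)) m = (real m + 1) * fps_nth (F y) (Suc m)"
        by simp
      ultimately have eq: "(\<Sum>i=0..m. fps_nth (F y) i * fps_nth (H y) (m - i))
          = (real m + 1) * fps_nth (F y) (Suc m)" by simp
      have "real m + 1 \<noteq> 0" by linarith
      then show "(1 / (real m + 1)) * (\<Sum>i=0..m. fps_nth (F y) i * fps_nth (H y) (m - i))
          = fps_nth (F y) k"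
        unfolding Suc eq by simp
    qed
  qed
qed

end

lemma fps_deriv_prod_log_deriv:
  fixes G H :: "'i \<Rightarrow> real fps"
  assumes "finite I" and "\<And>i. i \<in> I \<Longrightarrow> fps_deriv (G i) = G i * H i"
  shows "fps_deriv (\<Prod>i\<in>I. G i) = (\<Prod>i\<in>I. G i) * (\<Sum>i\<in>I. H i)"
  using assms by (induction I rule: finite_induct) (auto simp: algebra_simps)

text \<open>\<open>T\<close> is the logarithmic derivative of \<open>G\<close>, and that of t -> G(z
  t) is z T(z t). Its k-th coefficient is a constant times z^(k+1), which is why several factors
  together produce power sums.\<close>

lemma fps_deriv_linear_compose:
  fixes G :: "real fps"
  assumes "fps_nth G 0 \<noteq> 0"
  defines "T \<equiv> fps_deriv G * inverse G"
  shows "fps_deriv (G oo (fps_const z * fps_X)) =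
    (G oo (fps_const z * fps_X)) * Abs_fps (\<lambda>k. fps_nth T k * z ^ Suc k)"
proof -
  have "fps_deriv G = G * T"
    using assms by (simp add: T_def mult.left_commute inverse_mult_eq_1')
  moreover have "fps_deriv (G oo (fps_const z * fps_X)) =
      (fps_deriv G oo (fps_const z * fps_X)) * fps_const z"
    by (subst fps_compose_deriv) simp_all
  ultimately have "fps_deriv (G oo (fps_const z * fps_X)) =
      (G oo (fps_const z * fps_X)) * ((T oo (fps_const z * fps_X)) * fps_const z)"
    by (simp add: fps_compose_mult_distrib mult.assoc)
  also have "(T oo (fps_const z * fps_X)) * fps_const z = Abs_fps (\<lambda>k. fps_nth T k * z ^ Suc k)"
    unfolding fps_compose_linear by (simp add: fps_eq_iff)
  finally show ?thesis .
qed

lemma fps_prod_nth_0: "fps_nth (\<Prod>i\<in>I. G i :: real fps) 0 = (\<Prod>i\<in>I. fps_nth (G i) 0)"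
  by (induction I rule: infinite_finite_induct) auto

text \<open>The vanishing above degree \<open>card I\<close> is there for the induction: a new
  factor turns the coefficient at k + 1 into F_(k+1) + z F_k, whose first term has to drop out at
  the top.\<close>

lemma fps_nth_prod_linear:
  fixes z :: "'i \<Rightarrow> real"
  assumes "finite I"
  shows "fps_nth (\<Prod>i\<in>I. 1 + fps_const (z i) * fps_X) (card I) = (\<Prod>i\<in>I. z i)
    \<and> (\<forall>k>card I. fps_nth (\<Prod>i\<in>I. 1 + fps_const (z i) * fps_X) k = 0)"
  using assms
proof (induction I rule: finite_induct)
  case empty
  then show ?case by simp
next
  case (insert i I)
  have *: "fps_nth ((1 + fps_const (z i) * fps_X) * (F::real fps)) (Suc k)
      = fps_nth F (Suc k) + z i * fps_nth F k" for F k
    by (simp add: distrib_right mult.assoc)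
  show ?case
  proof (intro conjI allI impI)
    show "fps_nth (\<Prod>i\<in>insert i I. 1 + fps_const (z i) * fps_X) (card (insert i I))
        = (\<Prod>i\<in>insert i I. z i)"
      using insert by (simp add: *)
    fix k assume "k > card (insert i I)"
    then obtain m where "k = Suc m" "m > card I"
      using insert by (metis card_insert_disjoint Suc_lessE)
    then show "fps_nth (\<Prod>i\<in>insert i I. 1 + fps_const (z i) * fps_X) k = 0"
      using insert by (simp add: *)
  qed
qed

text \<open>Newton's identities, in the form of the logarithmic derivative of \<open>\<Prod>\<^sub>i (1 + z\<^sub>i t)\<close>.\<close>

lemma fun_algebra_prod_of_power_sums:
  fixes z :: "'y \<Rightarrow> 'i \<Rightarrow> real"
  assumes alg: "fun_algebra Y Q" and I: "finite I"
    and pow: "\<And>k. Q (\<lambda>y. \<Sum>i\<in>I. z y i ^ k)"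
  shows "Q (\<lambda>y. \<Prod>i\<in>I. z y i)"
proof -
  define G :: "real fps" where "G = 1 + fps_X"
  define T where "T = fps_deriv G * inverse G"
  define H where "H = (\<lambda>y. \<Sum>i\<in>I. Abs_fps (\<lambda>k. fps_nth T k * z y i ^ Suc k))"
  have G: "1 + fps_const (a::real) * fps_X = G oo (fps_const a * fps_X)" for a
    by (simp add: G_def fps_compose_add_distrib)
  have "Q (\<lambda>y. fps_nth (\<Prod>i\<in>I. 1 + fps_const (z y i) * fps_X) (card I))"
  proof (rule fun_algebra_log_deriv[OF alg, where H = H])
    fix y k
    show "fps_nth (\<Prod>i\<in>I. 1 + fps_const (z y i) * fps_X) 0 = 1"
      by (simp add: fps_prod_nth_0)
    show "fps_deriv (\<Prod>i\<in>I. 1 + fps_const (z y i) * fps_X)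
        = (\<Prod>i\<in>I. 1 + fps_const (z y i) * fps_X) * H y"
      unfolding H_def T_def G
      by (intro fps_deriv_prod_log_deriv I fps_deriv_linear_compose) (simp add: G_def)
    have "fps_nth (H y) k = fps_nth T k * (\<Sum>i\<in>I. z y i ^ Suc k)" for y
      by (simp add: H_def fps_sum_nth sum_distrib_left)
    then show "Q (\<lambda>y. fps_nth (H y) k)"
      by (simp only:) (intro fun_algebra_mult[OF alg] fun_algebra_const[OF alg] pow)
  qed
  then show ?thesis
    using fps_nth_prod_linear[OF I] by simp
qed

abbreviation signed_sum :: "('n::finite \<Rightarrow> real) \<Rightarrow> ('n \<Rightarrow> bool) \<Rightarrow> real" where
  "signed_sum l \<epsilon> \<equiv> \<Sum>j\<in>UNIV. if \<epsilon> j then l j else - l j"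

lemma fps_exp_sum:
  "finite I \<Longrightarrow> fps_exp (\<Sum>i\<in>I. x i :: real) = (\<Prod>i\<in>I. fps_exp (x i))"
  by (induction I rule: finite_induct) (auto simp: fps_exp_add_mult)

lemma sum_fps_exp_signed_sum:
  fixes l :: "'n::finite \<Rightarrow> real"
  shows "(\<Sum>\<epsilon>\<in>UNIV. fps_exp (signed_sum l \<epsilon>)) = (\<Prod>j\<in>UNIV. fps_exp (l j) + fps_exp (- l j))"
proof -
  have "(\<Prod>j\<in>UNIV. fps_exp (l j) + fps_exp (- l j))
      = (\<Prod>j\<in>UNIV. \<Sum>b\<in>UNIV. fps_exp (if b then l j else - l j))"
    by (simp add: UNIV_bool add.commute)
  also have "\<dots> = (\<Sum>\<epsilon>\<in>PiE UNIV (\<lambda>_. UNIV). \<Prod>j\<in>UNIV. fps_exp (if \<epsilon> j then l j else - l j))"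
    by (rule prod_sum_PiE) auto
  also have "\<dots> = (\<Sum>\<epsilon>\<in>UNIV. fps_exp (signed_sum l \<epsilon>))"
    by (simp add: fps_exp_sum PiE_UNIV_domain)
  finally show ?thesis ..
qed

text \<open>The exponential generating function of the moments of \<open>\<plusminus>l\<^sub>1 \<plusminus> \<dots> \<plusminus> l\<^sub>n\<close> is \<open>2\<^sup>n\<Prod>\<^sub>j cosh (l\<^sub>j t)\<close>,
  and its logarithmic derivative involves the \<open>l\<^sub>j\<close> only through their even power sums.\<close>

lemma fun_algebra_prod_signed_sums:
  fixes l :: "'y \<Rightarrow> 'n::finite \<Rightarrow> real" and m :: "'y \<Rightarrow> real"
  assumes alg: "fun_algebra Y Q" and m: "Q m"
    and pow: "\<And>k. Q (\<lambda>y. \<Sum>j\<in>UNIV. l y j ^ k + (- l y j) ^ k)"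
  shows "Q (\<lambda>y. \<Prod>\<epsilon>\<in>UNIV. m y + signed_sum (l y) \<epsilon>)"
proof (rule fun_algebra_prod_of_power_sums[OF alg])
  note alg_intros = fun_algebra_add[OF alg] fun_algebra_mult[OF alg] fun_algebra_const[OF alg]
    fun_algebra_sum[OF alg] fun_algebra_power[OF alg]
  \<comment> \<open>\<open>G\<close> is cosh t, with constant coefficient 1 as
    \<open>fun_algebra_log_deriv\<close> demands.\<close>
  define G :: "real fps" where "G = fps_const (1/2) * (fps_exp 1 + fps_exp (- 1))"
  define T where "T = fps_deriv G * inverse G"
  have G_lin: "G oo (fps_const a * fps_X) = fps_const (1/2) * (fps_exp a + fps_exp (- a))" for a
    by (simp add: G_def fps_compose_mult_distrib fps_compose_add_distrib)
  have G_even: "G oo (fps_const (- a) * fps_X) = G oo (fps_const a * fps_X)" for a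
    unfolding G_lin by (simp add: add.commute)
  define Ta where "Ta = (\<lambda>a. Abs_fps (\<lambda>k. fps_nth T k * a ^ Suc k))"
  define H where "H = (\<lambda>y. \<Sum>j\<in>UNIV. fps_const (1/2) * (Ta (l y j) + Ta (- l y j)))"
  define C where "C = (\<lambda>y. \<Prod>j\<in>UNIV. G oo (fps_const (l y j) * fps_X))"
  have G': "fps_deriv (G oo (fps_const a * fps_X)) = (G oo (fps_const a * fps_X)) * Ta a" for a
    unfolding Ta_def T_def by (rule fps_deriv_linear_compose) (simp add: G_def)
  \<comment> \<open>Since cosh is even, \<open>Ta a\<close> and \<open>Ta (- a)\<close> are both
    logarithmic derivatives of cosh(a t). Their average has coefficients proportional to a^k + (-
    a)^k, the sums controlled by the hypothesis \<open>pow\<close>.\<close>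
  have G'': "fps_deriv (G oo (fps_const a * fps_X)) =
      (G oo (fps_const a * fps_X)) * (fps_const (1/2) * (Ta a + Ta (- a)))" for a
  proof -
    let ?G = "G oo (fps_const a * fps_X)"
    have e: "fps_deriv ?G = ?G * Ta a" "fps_deriv ?G = ?G * Ta (- a)"
      using G'[of a] G'[of "- a"] unfolding G_even by auto
    have "fps_deriv ?G = fps_const (1/2) * fps_deriv ?G + fps_const (1/2) * fps_deriv ?G"
      unfolding distrib_right[symmetric] by simp
    also have "\<dots> = fps_const (1/2) * (?G * Ta a) + fps_const (1/2) * (?G * Ta (- a))"
      using e by metis
    finally show ?thesis
      by (simp add: algebra_simps)
  qed
  have C: "Q (\<lambda>y. fps_nth (C y) k)" for k
  proof (rule fun_algebra_log_deriv[OF alg, where H = H])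
    fix y k
    show "fps_nth (C y) 0 = 1"
      by (simp add: C_def fps_prod_nth_0 G_lin)
    show "fps_deriv (C y) = C y * H y"
      unfolding C_def H_def by (intro fps_deriv_prod_log_deriv G'') simp
    have "fps_nth (H y) k = (1/2 * fps_nth T k) * (\<Sum>j\<in>UNIV. l y j ^ Suc k + (- l y j) ^ Suc k)"
      for y
      by (simp add: H_def Ta_def fps_sum_nth sum_distrib_left algebra_simps)
    then show "Q (\<lambda>y. fps_nth (H y) k)"
      by (simp only:) (intro alg_intros pow)
  qed
  fix k
  \<comment> \<open>The k-th moment of the factors is k! times the coefficient of t^k in the sum of
    exp((m + s) t) over all signed sums s, and that series is 2^n exp(m t)
    \<open>C y\<close>.\<close>
  have "(\<Sum>\<epsilon>\<in>UNIV. (m y + signed_sum (l y) \<epsilon>) ^ k) =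
      fact k * 2 ^ CARD('n) * (\<Sum>i=0..k. m y ^ i * (1 / fact i) * fps_nth (C y) (k - i))" for y
  proof -
    have "(\<Prod>j\<in>UNIV. fps_exp (l y j) + fps_exp (- l y j)) = fps_const (2 ^ CARD('n)) * C y"
    proof -
      have "C y = (\<Prod>j\<in>(UNIV :: 'n set). fps_const (1/2)) * (\<Prod>j\<in>UNIV. fps_exp (l y j) + fps_exp (- l y j))"
        unfolding C_def G_lin prod.distrib ..
      then show ?thesis
        by (simp add: fps_const_power power_one_over mult.assoc[symmetric] fps_const_mult)
    qed
    then have "(\<Sum>\<epsilon>\<in>UNIV. fps_exp (m y + signed_sum (l y) \<epsilon>)) =
        fps_const (2 ^ CARD('n)) * (fps_exp (m y) * C y)"
      by (simp add: fps_exp_add_mult sum_distrib_left[symmetric] sum_fps_exp_signed_sum mult_ac)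
    then have "(\<Sum>\<epsilon>\<in>UNIV. fps_nth (fps_exp (m y + signed_sum (l y) \<epsilon>)) k) =
        2 ^ CARD('n) * fps_nth (fps_exp (m y) * C y) k"
      unfolding fps_sum_nth[symmetric] by simp
    then have "(\<Sum>\<epsilon>\<in>UNIV. fps_nth (fps_exp (m y + signed_sum (l y) \<epsilon>)) k) =
        2 ^ CARD('n) * (\<Sum>i=0..k. m y ^ i / fact i * fps_nth (C y) (k - i))"
      by (simp add: fps_mult_nth)
    then show ?thesis
      by (simp add: sum_divide_distrib[symmetric] field_simps)
  qed
  then show "Q (\<lambda>y. \<Sum>\<epsilon>\<in>UNIV. (m y + signed_sum (l y) \<epsilon>) ^ k)"
    by (simp only:) (intro alg_intros m C)
qed simp

section \<open>Hermitian linear algebra\<close>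

lemma matrix_vector_mult_uminus_left: "(- A) *v x = - (A *v (x :: real ^ 'm))"
  by (simp add: matrix_vector_mult_def vec_eq_iff sum_negf)

lemma matrix_vector_mult_uminus_right: "A *v (- x) = - (A *v (x :: real ^ 'm))"
  by (simp add: matrix_vector_mult_def vec_eq_iff sum_negf)

text \<open>The linear algebra of one tangent space. The symplectic form is no parameter; it is
  recovered as \<open>g v (J *v w)\<close>.\<close>

locale hermitian_space =
  fixes g :: "'n::finite model \<Rightarrow> 'n model \<Rightarrow> real" and J :: "'n endo"
  assumes bilinear_g: "bilinear g" and g_sym: "g v w = g w v" and g_pos: "v \<noteq> 0 \<Longrightarrow> g v v > 0"
    and g_J_J: "g (J *v v) (J *v w) = g v w" and J_J: "J ** J = - mat 1"
begin

lemmas g_simps =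
  bilinear_ladd[OF bilinear_g] bilinear_radd[OF bilinear_g] bilinear_lmul[OF bilinear_g]
  bilinear_rmul[OF bilinear_g] bilinear_lneg[OF bilinear_g] bilinear_rneg[OF bilinear_g]
  bilinear_lzero[OF bilinear_g] bilinear_rzero[OF bilinear_g]
  bilinear_lsub[OF bilinear_g] bilinear_rsub[OF bilinear_g]

lemma linear_g_left: "linear (\<lambda>v. g v w)" and linear_g_right: "linear (\<lambda>w. g v w)"
  using bilinear_g by (auto simp: bilinear_def)

lemma g_sum_left: "g (\<Sum>i\<in>I. f i) w = (\<Sum>i\<in>I. g (f i) w)"
  using linear_sum[OF linear_g_left] .

lemma g_sum_right: "g v (\<Sum>i\<in>I. f i) = (\<Sum>i\<in>I. g v (f i))"
  using linear_sum[OF linear_g_right] .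

lemma g_eq_0_iff: "g v v = 0 \<longleftrightarrow> v = 0"
  using g_pos[of v] g_simps by fastforce

lemma g_nonneg: "g v v \<ge> 0"
  using g_pos[of v] g_simps by (cases "v = 0") auto

lemma J_J_vec [simp]: "J *v (J *v v) = - v"
  by (simp add: matrix_vector_mul_assoc J_J matrix_vector_mult_uminus_left)

lemma g_J_left: "g (J *v v) w = - g v (J *v w)"
  using g_J_J[of "J *v v" w] by (simp add: g_simps)

lemma g_J_right: "g v (J *v w) = - g (J *v v) w"
  by (simp add: g_J_left)

lemma g_J_self: "g v (J *v v) = 0" "g (J *v v) v = 0"
  using g_J_left[of v v] g_sym[of "J *v v" v] by auto

lemma bounded_bilinear_g: "bounded_bilinear g"
  using bilinear_g by (simp add: bilinear_conv_bounded_bilinear)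

lemma continuous_g: "continuous_on K (\<lambda>v. g (f v) (h v))"
  if "continuous_on K f" "continuous_on K h"
  using bounded_bilinear.continuous_on[OF bounded_bilinear_g that] .

text \<open>A minimiser of the Rayleigh quotient on the \<open>g\<close>-unit sphere of
  \<open>V\<close> is an eigenvector. Minimality is recorded as well, because the sign of the
  eigenvalue will be read off from it.\<close>

lemma ex_min_eigenvector:
  assumes V: "subspace V" "\<exists>v\<in>V. v \<noteq> 0" "\<And>v. v \<in> V \<Longrightarrow> S *v v \<in> V"
    and S: "\<And>v w. g (S *v v) w = g v (S *v w)"
  shows "\<exists>e\<in>V. \<exists>m. g e e = 1 \<and> S *v e = m *\<^sub>R e \<and> (\<forall>w\<in>V. g (S *v w) w \<ge> m * g w w)"
proof -
  define q where "q v = g (S *v v) v" for v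
  have q_scale: "q (c *\<^sub>R v) = c\<^sup>2 * q v" and g_scale: "g (c *\<^sub>R v) (c *\<^sub>R v) = c\<^sup>2 * g v v" for c v
    by (simp_all add: q_def g_simps matrix_vector_mult_scaleR power2_eq_square)
  have cont_q: "continuous_on K q" for K
    unfolding q_def by (intro continuous_g continuous_intros matrix_vector_mult_linear_continuous_on)
  have cont_g: "continuous_on K (\<lambda>v. g v v)" for K
    by (intro continuous_g continuous_intros)
  define K where "K = {v\<in>V. g v v = 1}"
  obtain v0 where v0: "v0 \<in> V" "v0 \<noteq> 0" using V(2) by blast
  define s where "s = 1 / sqrt (g v0 v0)"
  have "s\<^sup>2 * g v0 v0 = 1"
    using g_pos[OF v0(2)] by (simp add: s_def power_divide)
  then have "s *\<^sub>R v0 \<in> K"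
    using V(1) v0 by (simp add: K_def g_scale subspace_scale)
  then have K_ne: "K \<noteq> {}" by auto
  have K_closed: "closed K"
  proof -
    have "K = V \<inter> (\<lambda>v. g v v) -` {1}" by (auto simp: K_def)
    moreover have "closed ((\<lambda>v. g v v) -` {1} :: 'n model set)"
      by (intro continuous_closed_vimage) (use cont_g[of UNIV] in \<open>auto simp: continuous_on_eq_continuous_at\<close>)
    ultimately show ?thesis using closed_subspace[OF V(1)] by auto
  qed
  \<comment> \<open>\<open>g\<close> is not the inner product of the model space. Its minimum on the
    Euclidean unit sphere compares the two norms and makes \<open>K\<close> bounded.\<close>
  obtain \<kappa> where \<kappa>: "\<kappa> > 0" "\<And>v. g v v \<ge> \<kappa> * (norm v)\<^sup>2"
  proof -
    have "compact (sphere 0 1 :: 'n model set)" "sphere 0 1 \<noteq> ({} :: 'n model set)" by auto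
    from continuous_attains_inf[OF this cont_g]
    obtain z where z: "norm z = 1" "\<And>v. norm v = 1 \<Longrightarrow> g z z \<le> g v v" by auto
    show thesis
    proof (rule that[of "g z z"])
      show "g z z > 0" using z(1) by (intro g_pos) auto
      fix v show "g v v \<ge> g z z * (norm v)\<^sup>2"
      proof (cases "v = 0")
        case False
        then have "g z z \<le> g ((1 / norm v) *\<^sub>R v) ((1 / norm v) *\<^sub>R v)" by (intro z(2)) simp
        then show ?thesis using False by (simp add: g_scale power_divide field_simps)
      qed (simp add: g_simps)
    qed
  qed
  have "bounded K"
  proof (rule boundedI)
    fix v assume "v \<in> K"
    then have "(norm v)\<^sup>2 \<le> 1 / \<kappa>" using \<kappa>(2)[of v] \<kappa>(1) by (simp add: K_def field_simps)
    then show "norm v \<le> sqrt (1 / \<kappa>)" by (rule real_le_rsqrt)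
  qed
  then have "compact K" using K_closed by (simp add: compact_eq_bounded_closed)
  from continuous_attains_inf[OF this K_ne cont_q]
  obtain e where e: "e \<in> K" and e_min: "\<And>v. v \<in> K \<Longrightarrow> q e \<le> q v" by blast
  define m where "m = q e"
  have eV: "e \<in> V" and ge: "g e e = 1" using e by (auto simp: K_def)
  have min: "q w \<ge> m * g w w" if "w \<in> V" for w
  proof (cases "w = 0")
    case False
    define s where "s = 1 / sqrt (g w w)"
    have s: "s\<^sup>2 * g w w = 1" "s \<noteq> 0"
      using g_pos[OF False] by (auto simp: s_def power_divide)
    have "s *\<^sub>R w \<in> K" using V(1) that s by (simp add: K_def g_scale subspace_scale)
    then have "m \<le> s\<^sup>2 * q w" using e_min by (simp add: m_def q_scale[symmetric])
    then have "m * g w w \<le> s\<^sup>2 * q w * g w w"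
      using g_nonneg by (intro mult_right_mono)
    also have "\<dots> = (s\<^sup>2 * g w w) * q w" by (simp add: mult_ac)
    finally show ?thesis using s(1) by simp
  qed (simp add: q_def g_simps)
  \<comment> \<open>First variation: q - m g is nonnegative on \<open>V\<close> and vanishes at
    \<open>e\<close>, so its first-order term along e + t w must be zero.\<close>
  have orth: "g (S *v e) w = 0" if w: "w \<in> V" "g e w = 0" for w
  proof -
    define a where "a = g (S *v e) w"
    define b where "b = q w - m * g w w"
    have b: "b \<ge> 0" using min[OF w(1)] by (simp add: b_def)
    have ineq: "0 \<le> 2 * t * a + t\<^sup>2 * b" for t
    proof -
      have "e + t *\<^sub>R w \<in> V" using V(1) eV w by (simp add: subspace_add subspace_scale)
      from min[OF this] have "0 \<le> q (e + t *\<^sub>R w) - m * g (e + t *\<^sub>R w) (e + t *\<^sub>R w)" by simp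
      also have "g (S *v w) e = a" using S[of w e] g_sym[of w "S *v e"] by (simp add: a_def)
      then have "q (e + t *\<^sub>R w) = m + 2 * t * a + t\<^sup>2 * q w"
        by (simp add: q_def g_simps matrix_vector_mult_scaleR matrix_vector_right_distrib a_def m_def
            algebra_simps power2_eq_square)
      also have "g (e + t *\<^sub>R w) (e + t *\<^sub>R w) = 1 + t\<^sup>2 * g w w"
        using w(2) g_sym[of w e] by (simp add: g_simps ge algebra_simps power2_eq_square)
      finally show ?thesis by (simp add: b_def algebra_simps)
    qed
    show ?thesis
    proof (rule ccontr)
      assume "\<not> ?thesis"
      then have a: "a \<noteq> 0" by (simp add: a_def)
      \<comment> \<open>At t = - s the quadratic equals - s^2 (b + 2) < 0; the added 1 covers b =
        0.\<close>
      define s where "s = a / (b + 1)"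
      have a_eq: "a = s * (b + 1)" using b by (simp add: s_def)
      have "0 \<le> 2 * (- s) * a + (- s)\<^sup>2 * b" by (rule ineq)
      also have "\<dots> = s\<^sup>2 * (b - 2 * (b + 1))"
        by (simp add: a_eq algebra_simps power2_eq_square)
      also have "\<dots> < 0"
        using a b by (intro mult_pos_neg) (auto simp: a_eq)
      finally show False by simp
    qed
  qed
  \<comment> \<open>This vector lies in \<open>V\<close> and is orthogonal to \<open>e\<close>,
    hence to \<open>S *v e\<close>, hence to itself.\<close>
  define w where "w = S *v e - m *\<^sub>R e"
  have w: "w \<in> V" using V eV by (simp add: w_def subspace_diff subspace_scale)
  have ew: "g e w = 0" using S[of e e] by (simp add: w_def g_simps ge m_def q_def)
  have "g w w = g (S *v e) w - m * g e w" using g_simps(9)[of "S *v e" "m *\<^sub>R e" w] g_simps(3)[of m e w]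
    unfolding w_def[symmetric] by simp
  then have "w = 0" using orth[OF w ew] ew by (simp add: g_eq_0_iff)
  then have "S *v e = m *\<^sub>R e" by (simp add: w_def)
  then show ?thesis using eV ge min by (auto simp: q_def)
qed

text \<open>As \<open>S\<close> anticommutes with \<open>J\<close>, an eigenvector e for m brings J
  e for - m. One such pair is split off at a time, always with the smallest eigenvalue on the
  complement of the earlier pairs.\<close>

lemma ex_unitary_eigenbasis:
  assumes S: "\<And>v w. g (S *v v) w = g v (S *v w)" and anti: "\<And>v. S *v (J *v v) = - (J *v (S *v v))"
  shows "\<exists>(e :: 'n \<Rightarrow> 'n model) lam. \<forall>i. lam i \<ge> 0 \<and> S *v e i = (- lam i) *\<^sub>R e i \<and>
           (\<forall>j. g (e i) (e j) = (if i = j then 1 else 0) \<and> g (e i) (J *v e j) = 0)"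
proof -
  have "\<exists>e lam. \<forall>i\<in>I. lam i \<ge> 0 \<and> S *v e i = (- lam i) *\<^sub>R e i \<and>
           (\<forall>j\<in>I. g (e i) (e j) = (if i = j then 1 else 0) \<and> g (e i) (J *v e j) = 0)"
    if "finite I" for I :: "'n set"
    using that
  proof (induction I rule: finite_induct)
    case (insert k I)
    then obtain e lam where IH: "\<And>i. i \<in> I \<Longrightarrow> lam i \<ge> 0 \<and> S *v e i = (- lam i) *\<^sub>R e i"
      "\<And>i j. i \<in> I \<Longrightarrow> j \<in> I \<Longrightarrow> g (e i) (e j) = (if i = j then 1 else 0) \<and> g (e i) (J *v e j) = 0"
      by blast
    define V where "V = {v. \<forall>i\<in>I. g v (e i) = 0 \<and> g v (J *v e i) = 0}"
    have V: "subspace V" by (auto simp: V_def subspace_def g_simps)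
    have SV: "S *v v \<in> V" if "v \<in> V" for v
      using that IH(1) by (auto simp: V_def S anti g_simps matrix_vector_mult_scaleR matrix_vector_mult_uminus_right)
    have JV: "J *v v \<in> V" if "v \<in> V" for v
      using that by (auto simp: V_def g_J_left g_simps)
    \<comment> \<open>Dimension count: if \<open>V\<close> were zero, the products with all
      \<open>e i\<close> and \<open>J *v e i\<close>, padded by zeros, would map the model space
      injectively and hence onto itself, although the slots of k \<notin> I always contain
      0.\<close>
    have ne: "\<exists>v\<in>V. v \<noteq> 0"
    proof (rule ccontr)
      assume V0: "\<not> ?thesis"
      define T :: "'n model \<Rightarrow> 'n model" where
        "T v = (\<chi> l. case l of Inl i \<Rightarrow> if i \<in> I then g v (e i) else 0
                   | Inr i \<Rightarrow> if i \<in> I then g v (J *v e i) else 0)" for v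
      have lin: "linear T"
        by (rule linearI) (auto simp: T_def vec_eq_iff g_simps split: sum.splits)
      have "v = 0" if "T v = 0" for v
      proof -
        have "g v (e i) = 0" "g v (J *v e i) = 0" if "i \<in> I" for i
          using arg_cong[OF \<open>T v = 0\<close>, of "\<lambda>x. x $ Inl i"]
            arg_cong[OF \<open>T v = 0\<close>, of "\<lambda>x. x $ Inr i"] that by (auto simp: T_def)
        then have "v \<in> V" by (simp add: V_def)
        then show "v = 0" using V0 by blast
      qed
      then have "inj T" using linear_injective_0[OF lin] by blast
      then have "surj T" using linear_injective_imp_surjective[OF lin] by blast
      then obtain v where "T v = axis (Inl k) 1" by (metis surjD)
      then have "T v $ Inl k = 1" by simp
      then show False using insert.hyps by (simp add: T_def)
    qed
    from ex_min_eigenvector[OF V ne SV S] obtain f m where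
      f: "f \<in> V" "g f f = 1" "S *v f = m *\<^sub>R f" "\<And>w. w \<in> V \<Longrightarrow> g (S *v w) w \<ge> m * g w w"
      by blast
    \<comment> \<open>The form takes the value - m at J f, so minimality gives - m \<ge> m.\<close>
    have m: "- m \<ge> 0"
      using f(4)[OF JV[OF f(1)]] f(2,3)
      by (simp add: anti g_simps g_J_J matrix_vector_mult_scaleR)
    define e' where "e' = e(k := f)"
    define lam' where "lam' = lam(k := - m)"
    have fI: "g f (e i) = 0" "g (e i) f = 0" "g f (J *v e i) = 0" "g (e i) (J *v f) = 0" if "i \<in> I" for i
      using f(1) that g_sym[of "e i" f] g_J_right[of "e i" f] g_sym[of "J *v e i" f]
      by (auto simp: V_def)
    have "i \<noteq> k" if "i \<in> I" for i using that insert.hyps by auto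
    then have "\<forall>i\<in>insert k I. lam' i \<ge> 0 \<and> S *v e' i = (- lam' i) *\<^sub>R e' i \<and>
        (\<forall>j\<in>insert k I. g (e' i) (e' j) = (if i = j then 1 else 0) \<and> g (e' i) (J *v e' j) = 0)"
      using IH f(2,3) m fI g_J_self by (auto simp: e'_def lam'_def)
    then show ?case by blast
  qed auto
  from this[OF finite, of UNIV] show ?thesis unfolding ball_UNIV .
qed


text \<open>The index type is that of the coordinates, so the number of vectors is the dimension and
  orthonormality alone forces a basis.\<close>

definition onb :: "('n + 'n \<Rightarrow> 'n model) \<Rightarrow> bool" where
  "onb b \<longleftrightarrow> (\<forall>k l. g (b k) (b l) = (if k = l then 1 else 0))"

text \<open>\<open>E\<close> has the basis as columns and \<open>F\<close> reads off
  \<open>g\<close>-coordinates, so \<open>F ** E\<close> is the Gram matrix, here the identity; for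
  square matrices the other product is then the identity too. Conjugation by this pair changes
  neither trace nor determinant.\<close>

lemma onb_frame:
  assumes "onb b"
  obtains E F :: "'n endo" where "F ** E = mat 1" "E ** F = mat 1"
    "\<And>X k l. (F ** (X ** E)) $ k $ l = g (X *v b l) (b k)"
    "\<And>v. v = (\<Sum>k\<in>UNIV. g v (b k) *\<^sub>R b k)"
proof -
  define E :: "'n endo" where "E = (\<chi> i k. b k $ i)"
  define F :: "'n endo" where "F = (\<chi> k i. g (axis i 1) (b k))"
  have E_vec: "E *v v = (\<Sum>k\<in>UNIV. v $ k *\<^sub>R b k)" for v
    by (simp add: E_def matrix_vector_mult_def vec_eq_iff mult.commute)
  have F_vec: "(F *v v) $ k = g v (b k)" for v k
  proof -
    have "g v (b k) = g (\<Sum>i\<in>UNIV. v $ i *\<^sub>R axis i 1) (b k)"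
      using basis_expansion[of v] by (simp add: scalar_mult_eq_scaleR)
    also have "\<dots> = (F *v v) $ k"
      by (simp add: g_sum_left g_simps F_def matrix_vector_mult_def mult.commute)
    finally show ?thesis ..
  qed
  have entry: "(F ** (X ** E)) $ k $ l = g (X *v b l) (b k)" for X k l
  proof -
    have "(F ** (X ** E)) $ k $ l = (F *v (X *v b l)) $ k"
      by (simp add: matrix_matrix_mult_def matrix_vector_mult_def E_def)
    then show ?thesis by (simp add: F_vec)
  qed
  have FE: "F ** E = mat 1"
  proof -
    have "(F ** E) $ k $ l = g (b l) (b k)" for k l
      using entry[of "mat 1" k l] by simp
    then show ?thesis
      using assms by (simp add: vec_eq_iff onb_def mat_def)
  qed
  then have EF: "E ** F = mat 1" by (simp add: matrix_left_right_inverse)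
  have "v = (\<Sum>k\<in>UNIV. g v (b k) *\<^sub>R b k)" for v
    using E_vec[of "F *v v"] EF by (simp add: F_vec matrix_vector_mul_assoc)
  then show thesis using that FE EF entry by blast
qed

lemma onb_expansion: "onb b \<Longrightarrow> v = (\<Sum>k\<in>UNIV. g v (b k) *\<^sub>R b k)"
  by (erule onb_frame) blast

lemma onb_trace:
  assumes "onb b"
  shows "trace X = (\<Sum>k\<in>UNIV. g (X *v b k) (b k))"
proof -
  obtain E F :: "'n endo" where EF: "E ** F = mat 1"
    and entry: "\<And>k l. (F ** (X ** E)) $ k $ l = g (X *v b l) (b k)"
    using onb_frame[OF assms] by metis
  have "trace (F ** (X ** E)) = trace X"
    by (subst trace_mul_sym) (simp add: matrix_mul_assoc[symmetric] EF)
  then show ?thesis by (simp add: trace_def entry)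
qed

lemma onb_det_eigen:
  assumes b: "onb b" and S: "\<And>k. S *v b k = s k *\<^sub>R b k"
  shows "det (t *\<^sub>R mat 1 - S) = (\<Prod>k\<in>UNIV. t - s k)"
proof -
  define X where "X = t *\<^sub>R mat 1 - S"
  obtain E F :: "'n endo" where FE: "F ** E = mat 1"
    and entry: "\<And>k l. (F ** (X ** E)) $ k $ l = g (X *v b l) (b k)"
    using onb_frame[OF b] by metis
  have Xb: "X *v b k = (t - s k) *\<^sub>R b k" for k
    by (simp add: X_def matrix_vector_mult_diff_rdistrib scaleR_matrix_vector_assoc[symmetric] S algebra_simps)
  have "det X = det F * (det X * det E)"
    using arg_cong[OF FE, of det] by (simp add: det_mul)
  also have "\<dots> = det (F ** (X ** E))" by (simp add: det_mul)
  also have "\<dots> = (\<Prod>k\<in>UNIV. (F ** (X ** E)) $ k $ k)"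
    by (rule det_diagonal) (use b in \<open>simp add: entry Xb g_simps onb_def\<close>)
  also have "\<dots> = (\<Prod>k\<in>UNIV. t - s k)"
    using b by (simp add: entry Xb g_simps onb_def)
  finally show ?thesis by (simp add: X_def)
qed

end

primrec mpow :: "real ^ 'm ^ 'm \<Rightarrow> nat \<Rightarrow> real ^ 'm ^ 'm" where
  "mpow S 0 = mat 1"
| "mpow S (Suc k) = S ** mpow S k"

lemma mpow_eigen: "S *v b = s *\<^sub>R b \<Longrightarrow> mpow S k *v b = s ^ k *\<^sub>R (b :: real ^ 'm::finite)"
  by (induction k) (auto simp: matrix_vector_mul_assoc[symmetric] matrix_vector_mult_scaleR)

lemma sum_UNIV_sum:
  "(\<Sum>k\<in>UNIV. f (k :: 'a::finite + 'b::finite)) = (\<Sum>j\<in>UNIV. f (Inl j)) + (\<Sum>j\<in>UNIV. f (Inr j))"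
  unfolding UNIV_Plus_UNIV[symmetric] by (subst sum.Plus) auto

lemma prod_UNIV_sum:
  "(\<Prod>k\<in>UNIV. f (k :: 'a::finite + 'b::finite)) = (\<Prod>j\<in>UNIV. f (Inl j)) * (\<Prod>j\<in>UNIV. f (Inr j))"
  unfolding UNIV_Plus_UNIV[symmetric] by (subst prod.Plus) auto

text \<open>Equal monic polynomials have the same multiset of roots, and power sums depend only on
  that multiset.\<close>

lemma power_sums_eq_of_prod_eq:
  fixes a b :: "'i::finite \<Rightarrow> real"
  assumes "\<And>t. (\<Prod>i\<in>UNIV. t - a i) = (\<Prod>i\<in>UNIV. t - b i)"
  shows "(\<Sum>i\<in>UNIV. a i ^ k) = (\<Sum>i\<in>UNIV. b i ^ k)"
proof -
  have "(\<Prod>i\<in>UNIV. [:- a i, 1:]) = (\<Prod>i\<in>UNIV. [:- b i, 1:])"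
    using assms by (simp add: poly_eq_poly_eq_iff[symmetric] fun_eq_iff poly_prod)
  then have "proots (\<Prod>i\<in>UNIV. [:- a i, 1:]) = proots (\<Prod>i\<in>UNIV. [:- b i, 1:])" by simp
  then have "(\<Sum>i\<in>UNIV. {#a i#}) = (\<Sum>i\<in>UNIV. {#b i#})"
    by (simp add: proots_prod)
  then have "sum_mset (image_mset (\<lambda>x. x ^ k) (\<Sum>i\<in>UNIV. {#a i#})) =
      sum_mset (image_mset (\<lambda>x. x ^ k) (\<Sum>i\<in>UNIV. {#b i#}))" by simp
  moreover have "sum_mset (image_mset (\<lambda>x. x ^ k) (\<Sum>i\<in>I. {#c i#})) = (\<Sum>i\<in>I. c i ^ k)"
    for c :: "'i \<Rightarrow> real" and I
    by (induction I rule: infinite_finite_induct) auto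
  ultimately show ?thesis by simp
qed

section \<open>Eigenvalues of the skew part and the value of the operator\<close>

context hermitian_space
begin

definition pair_basis :: "('n \<Rightarrow> 'n model) \<Rightarrow> 'n + 'n \<Rightarrow> 'n model" where
  "pair_basis e = case_sum e (\<lambda>j. J *v e j)"

definition pm :: "('n \<Rightarrow> real) \<Rightarrow> 'n + 'n \<Rightarrow> real" where
  "pm l = case_sum (\<lambda>j. - l j) l"

lemma pair_basis_simps [simp]: "pair_basis e (Inl j) = e j" "pair_basis e (Inr j) = J *v e j"
  and pm_simps [simp]: "pm l (Inl j) = - l j" "pm l (Inr j) = l j"
  by (simp_all add: pair_basis_def pm_def)

lemma skew_part_vec:
  "skew_part J A *v v = (1/2) *\<^sub>R (A *v v + J *v (A *v (J *v v)))"
  by (simp add: skew_part_def matrix_vector_mult_add_rdistrib scaleR_matrix_vector_assoc[symmetric]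
      matrix_vector_mul_assoc matrix_mul_assoc)

lemma g_skew_part: "g (skew_part J A *v v) v = (g (A *v v) v - g (A *v (J *v v)) (J *v v)) / 2"
  by (simp add: skew_part_vec g_simps g_J_left)

text \<open>The skew part is the \<open>J\<close>-antilinear part of \<open>A\<close>, so it
  anticommutes with \<open>J\<close>; it inherits symmetry from \<open>A\<close> because
  \<open>J\<close> is skew for \<open>g\<close>.\<close>

lemma ex_skew_eigenbasis:
  assumes A: "A \<in> symmetric_endos g"
  obtains e lam where "onb (pair_basis e)" "\<And>j. lam j \<ge> 0"
    "\<And>k. skew_part J A *v pair_basis e k = pm lam k *\<^sub>R pair_basis e k"
proof -
  define S where "S = skew_part J A"
  have Asym: "g (A *v v) w = g v (A *v w)" for v w
    using A by (simp add: symmetric_endos_def)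
  have S: "g (S *v v) w = g v (S *v w)" for v w
    by (simp add: S_def skew_part_vec g_simps g_J_left Asym)
  have anti: "S *v (J *v v) = - (J *v (S *v v))" for v
    by (simp add: S_def skew_part_vec matrix_vector_mult_scaleR matrix_vector_right_distrib
        matrix_vector_mult_uminus_right algebra_simps)
  from ex_unitary_eigenbasis[OF S anti] obtain e :: "'n \<Rightarrow> 'n model" and lam where
    e: "\<And>i. lam i \<ge> 0" "\<And>i. S *v e i = (- lam i) *\<^sub>R e i"
      "\<And>i j. g (e i) (e j) = (if i = j then 1 else 0)" "\<And>i j. g (e i) (J *v e j) = 0"
    by blast
  have "onb (pair_basis e)"
    unfolding onb_def
  proof (intro allI)
    fix k l
    show "g (pair_basis e k) (pair_basis e l) = (if k = l then 1 else 0)"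
      using e(3,4) g_sym by (cases k; cases l) (auto simp: g_J_J)
  qed
  moreover have "S *v pair_basis e k = pm lam k *\<^sub>R pair_basis e k" for k
    by (cases k) (auto simp: e anti matrix_vector_mult_uminus_right matrix_vector_mult_scaleR)
  ultimately show thesis using that e(1) by (auto simp: S_def)
qed

lemma onb_trace_mpow:
  assumes "onb b" and "\<And>k. S *v b k = s k *\<^sub>R b k"
  shows "trace (mpow S i) = (\<Sum>k\<in>UNIV. s k ^ i)"
proof -
  have "g (mpow S i *v b k) (b k) = s k ^ i" for k
    using assms(1) mpow_eigen[OF assms(2)[of k], of i] by (simp add: g_simps onb_def)
  then show ?thesis by (simp add: onb_trace[OF assms(1)])
qed

lemma sum_pm: "(\<Sum>k\<in>UNIV. pm l k ^ i) = (\<Sum>j\<in>UNIV. l j ^ i + (- l j) ^ i)"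
  by (simp add: sum_UNIV_sum sum.distrib)

lemma prod_pm: "(\<Prod>k\<in>UNIV. t - pm l k) = (\<Prod>j\<in>UNIV. (t - l j) * (t + l j))"
  by (simp add: prod_UNIV_sum prod.distrib mult.commute)

text \<open>An eigenbasis shows that \<open>SOME\<close> has something to choose. The chosen numbers
  then share the characteristic polynomial with the eigenvalues of that basis, and so all power
  sums.\<close>

lemma paired_eigenvalues_chosen:
  assumes A: "A \<in> symmetric_endos g"
  defines "lam \<equiv> SOME lam. paired_eigenvalues (skew_part J A) lam"
  shows "(\<Sum>j\<in>UNIV. lam j ^ i + (- lam j) ^ i) = trace (mpow (skew_part J A) i)"
proof -
  obtain e l where e: "onb (pair_basis e)" "\<And>j. l j \<ge> 0"
    "\<And>k. skew_part J A *v pair_basis e k = pm l k *\<^sub>R pair_basis e k"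
    using ex_skew_eigenbasis[OF A] by blast
  have det: "det (t *\<^sub>R mat 1 - skew_part J A) = (\<Prod>k\<in>UNIV. t - pm l k)" for t
    using onb_det_eigen[OF e(1,3)] .
  have "paired_eigenvalues (skew_part J A) l"
    unfolding paired_eigenvalues_def using e(2) by (simp add: det prod_pm)
  then have "paired_eigenvalues (skew_part J A) lam"
    unfolding lam_def by (rule someI[of "paired_eigenvalues (skew_part J A)"])
  then have "(\<Prod>k\<in>UNIV. t - pm lam k) = (\<Prod>k\<in>UNIV. t - pm l k)" for t
    by (simp add: det[symmetric] paired_eigenvalues_def prod_pm[of _ lam])
  then have "(\<Sum>k\<in>UNIV. pm lam k ^ i) = (\<Sum>k\<in>UNIV. pm l k ^ i)"
    by (rule power_sums_eq_of_prod_eq)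
  then show ?thesis
    using onb_trace_mpow[OF e(1,3)] by (simp add: sum_pm)
qed

end

text \<open>\<open>g\<close> and \<open>J\<close> may vary with the parameter. For the differential
  the parameter is the endomorphism over a fixed tangent space; for continuity it is the point of
  the manifold.\<close>

lemma fun_algebra_M_Lag:
  fixes g :: "'y \<Rightarrow> 'n::finite model \<Rightarrow> 'n model \<Rightarrow> real"
  assumes alg: "fun_algebra Y Q"
    and herm: "\<And>y. y \<in> Y \<Longrightarrow> hermitian_space (g y) (J y)"
    and A: "\<And>y. y \<in> Y \<Longrightarrow> A y \<in> symmetric_endos (g y)"
    and tr: "Q (\<lambda>y. trace (A y))" and tr_pow: "\<And>k. Q (\<lambda>y. trace (mpow (skew_part (J y) (A y)) k))"
  shows "Q (\<lambda>y. M_Lag (J y) (A y))"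
proof -
  define lam where "lam y = (SOME lam. paired_eigenvalues (skew_part (J y) (A y)) lam)" for y
  have "Q (\<lambda>y. \<Prod>\<epsilon>\<in>UNIV. (1/2) * trace (A y) + signed_sum (lam y) \<epsilon>)"
  proof (rule fun_algebra_prod_signed_sums[OF alg])
    show "Q (\<lambda>y. (1/2) * trace (A y))"
      by (intro fun_algebra_mult[OF alg] fun_algebra_const[OF alg] tr)
    show "Q (\<lambda>y. \<Sum>j\<in>UNIV. lam y j ^ k + (- lam y j) ^ k)" for k
      by (rule fun_algebra_cong[OF alg tr_pow[of k]])
        (use hermitian_space.paired_eigenvalues_chosen[OF herm A] in \<open>simp add: lam_def\<close>)
  qed
  moreover have "M_Lag (J y) (A y) = (\<Prod>\<epsilon>\<in>UNIV. (1/2) * trace (A y) + signed_sum (lam y) \<epsilon>)" for y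
    unfolding M_Lag_def Let_def lam_def by simp
  ultimately show ?thesis by simp
qed

context hermitian_space
begin

text \<open>The property transported here is equality of the two values of a function on
  \<open>bool\<close>; it compares the chosen numbers with \<open>l\<close>. The \<open>l j\<close>
  may have any sign, which matters when eigenvalues are moved along a line past 0.\<close>

lemma M_Lag_eq:
  fixes l :: "'n \<Rightarrow> real"
  assumes A: "A \<in> symmetric_endos g"
    and l: "\<And>i. trace (mpow (skew_part J A) i) = (\<Sum>j\<in>UNIV. l j ^ i + (- l j) ^ i)"
  shows "M_Lag J A = (\<Prod>\<epsilon>\<in>UNIV. trace A / 2 + signed_sum l \<epsilon>)"
proof -
  define lam where "lam = (SOME lam. paired_eigenvalues (skew_part J A) lam)"
  define Q where "Q \<phi> \<longleftrightarrow> \<phi> True = (\<phi> False :: real)" for \<phi>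
  define h where "h b = (if b then lam else l)" for b
  have "Q (\<lambda>b. \<Prod>\<epsilon>\<in>UNIV. trace A / 2 + signed_sum (h b) \<epsilon>)"
  proof (rule fun_algebra_prod_signed_sums)
    show "fun_algebra UNIV Q"
      by (rule fun_algebraI) (auto simp: Q_def)
    show "Q (\<lambda>b. \<Sum>j\<in>UNIV. h b j ^ k + (- h b j) ^ k)" for k
      using paired_eigenvalues_chosen[OF A, of k] l[of k] by (simp add: Q_def h_def lam_def)
  qed (simp add: Q_def)
  then show ?thesis
    by (simp only: M_Lag_def Let_def Q_def h_def lam_def[symmetric] if_True if_False)
qed

section \<open>Traces on Lagrangian planes\<close>

lemma trace_pair_basis:
  assumes "onb (pair_basis e)"
  shows "trace A = (\<Sum>j\<in>UNIV. g (A *v e j) (e j)) + (\<Sum>j\<in>UNIV. g (A *v (J *v e j)) (J *v e j))"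
  by (simp add: onb_trace[OF assms] sum_UNIV_sum)

text \<open>An element in the span of the others would be orthogonal to itself. This gives
  independence, and independence gives finiteness, on which sums over \<open>B\<close> rely.\<close>

lemma orthonormal_basis_finite_indep:
  assumes "orthonormal_basis g W B"
  shows "finite B" "independent B"
proof -
  have B: "\<And>b b'. b \<in> B \<Longrightarrow> b' \<in> B \<Longrightarrow> g b b' = (if b = b' then 1 else 0)"
    using assms by (auto simp: orthonormal_basis_def)
  have "b \<notin> span (B - {b})" if b: "b \<in> B" for b
  proof
    assume "b \<in> span (B - {b})"
    moreover have "subspace {v. g v b = 0}"
      by (auto simp: subspace_def g_simps)
    ultimately have "g b b = 0"
      using span_induct[of b "B - {b}" "\<lambda>v. g v b = 0"] B b by auto
    then show False using B b by simp
  qed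
  then show "independent B" by (auto simp: dependent_def)
  then show "finite B" by (rule finiteI_independent)
qed

lemma orthonormal_basis_expansion:
  assumes B: "orthonormal_basis g W B" and w: "w \<in> W"
  shows "w = (\<Sum>b\<in>B. g w b *\<^sub>R b)"
proof -
  have fin: "finite B" using orthonormal_basis_finite_indep[OF B] by simp
  have "w \<in> span B" using B w by (simp add: orthonormal_basis_def)
  then show ?thesis
  proof (induction rule: span_induct)
    case (step x)
    have "(\<Sum>b\<in>B. g x b *\<^sub>R b) = (\<Sum>b\<in>B. if b = x then b else 0)"
      using B step by (intro sum.cong) (auto simp: orthonormal_basis_def)
    then show ?case using step fin by simp
  next
    case base
    show ?case
    proof (rule subspaceI, simp_all only: mem_Collect_eq)
      fix x c assume "x = (\<Sum>b\<in>B. g x b *\<^sub>R b)"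
      then have "c *\<^sub>R x = c *\<^sub>R (\<Sum>b\<in>B. g x b *\<^sub>R b)" by (rule arg_cong)
      also have "\<dots> = (\<Sum>b\<in>B. g (c *\<^sub>R x) b *\<^sub>R b)"
        by (simp add: scaleR_sum_right g_simps)
      finally show "c *\<^sub>R x = (\<Sum>b\<in>B. g (c *\<^sub>R x) b *\<^sub>R b)" .
    qed (auto simp: g_simps scaleR_left_distrib sum.distrib)
  qed
qed

text \<open>Needed because \<open>trace_on\<close> picks its basis by \<open>SOME\<close>. Each
  vector of one basis is expanded in the other; symmetry of \<open>A\<close> then lets the double
  sum be contracted the other way round.\<close>

lemma orthonormal_basis_trace_unique:
  assumes A: "A \<in> symmetric_endos g"
    and B: "orthonormal_basis g W B" and B': "orthonormal_basis g W B'"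
  shows "(\<Sum>b\<in>B. g (A *v b) b) = (\<Sum>b\<in>B'. g (A *v b) b)"
proof -
  have "(\<Sum>b\<in>B. g (A *v b) b) = (\<Sum>b\<in>B. \<Sum>b'\<in>B'. g b b' * g (A *v b) b')"
  proof (rule sum.cong)
    fix b assume "b \<in> B"
    then have "b \<in> W" using B by (auto simp: orthonormal_basis_def)
    from arg_cong[OF orthonormal_basis_expansion[OF B' this], of "g (A *v b)"]
    show "g (A *v b) b = (\<Sum>b'\<in>B'. g b b' * g (A *v b) b')"
      by (simp add: g_sum_right g_simps)
  qed simp
  also have "\<dots> = (\<Sum>b'\<in>B'. \<Sum>b\<in>B. g b b' * g b (A *v b'))"
    using A by (subst sum.swap) (simp add: symmetric_endos_def)
  also have "\<dots> = (\<Sum>b'\<in>B'. g (A *v b') b')"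
  proof (rule sum.cong)
    fix b' assume "b' \<in> B'"
    then have "b' \<in> W" using B' by (auto simp: orthonormal_basis_def)
    from arg_cong[OF orthonormal_basis_expansion[OF B this], of "\<lambda>v. g v (A *v b')"]
    show "(\<Sum>b\<in>B. g b b' * g b (A *v b')) = g (A *v b') b'"
      by (simp add: g_sum_left g_simps g_sym[of b'])
  qed simp
  finally show ?thesis .
qed

lemma trace_on_eq:
  assumes "A \<in> symmetric_endos g" and "orthonormal_basis g W B"
  shows "trace_on g A W = (\<Sum>b\<in>B. g (A *v b) b)"
  unfolding trace_on_def
  by (rule orthonormal_basis_trace_unique[OF assms(1) someI[of "orthonormal_basis g W" B] assms(2)])
    (rule assms(2))

text \<open>The Lagrangian plane on which the trace of \<open>A\<close> is smallest is spanned by eigenvectors of the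
  skew part for the eigenvalues \<open>- \<lambda>\<^sub>j\<close>.\<close>

lemma psh_imp_smallest_factor_nonneg:
  assumes A: "A \<in> symmetric_endos g"
    and e: "onb (pair_basis e)" "\<And>k. skew_part J A *v pair_basis e k = pm lam k *\<^sub>R pair_basis e k"
    and \<omega>: "\<And>v w. \<omega> v w = g v (J *v w)"
    and psh: "\<And>W. lagrangian \<omega> W \<Longrightarrow> trace_on g A W \<ge> 0"
  shows "trace A / 2 - (\<Sum>j\<in>UNIV. lam j) \<ge> 0"
proof -
  have ee: "g (e i) (e j) = (if i = j then 1 else 0)" for i j
    using e(1)[unfolded onb_def, rule_format, of "Inl i" "Inl j"] by simp
  have eJ: "g (e i) (J *v e j) = 0" for i j
    using e(1)[unfolded onb_def, rule_format, of "Inl i" "Inr j"] by simp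
  have inj: "inj e"
    by (rule injI) (metis ee zero_neq_one)
  define W where "W = span (range e)"
  have ob: "orthonormal_basis g W (range e)"
    unfolding orthonormal_basis_def W_def using inj
    by (auto simp: ee span_superset dest: injD)
  have "lagrangian \<omega> W"
    unfolding lagrangian_def
  proof (intro conjI ballI)
    show "subspace W" by (simp add: W_def)
    have "dim W = card (range e)"
      unfolding W_def using orthonormal_basis_finite_indep(2)[OF ob]
      by (rule dim_span_eq_card_independent)
    then show "dim W = CARD('n)" using inj by (simp add: card_image)
    fix v w assume vw: "v \<in> W" "w \<in> W"
    have 1: "g v (J *v e j) = 0" for j
      using vw(1)[unfolded W_def]
    proof (induction rule: span_induct)
      case base
      show ?case by (auto simp: subspace_def g_simps)
    qed (auto simp: eJ)
    have "g v (J *v w) = 0"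
      using vw(2)[unfolded W_def]
    proof (induction rule: span_induct)
      case base
      show ?case
        by (auto simp: subspace_def g_simps matrix_vector_right_distrib matrix_vector_mult_scaleR)
    qed (auto simp: 1)
    then show "\<omega> v w = 0" by (simp add: \<omega>)
  qed
  then have "0 \<le> (\<Sum>b\<in>range e. g (A *v b) b)"
    using psh trace_on_eq[OF A ob] by metis
  also have "\<dots> = (\<Sum>j\<in>UNIV. g (A *v e j) (e j))"
    using inj by (simp add: sum.reindex)
  \<comment> \<open>The trace on \<open>W\<close> is half the sum plus half the difference of the
    traces on W and J W. The first part is half the trace of \<open>A\<close>, the second the trace
    of the skew part on W.\<close>
  also have "\<dots> = trace A / 2 - (\<Sum>j\<in>UNIV. lam j)"
  proof -
    have "(g (A *v e j) (e j) - g (A *v (J *v e j)) (J *v e j)) / 2 = - lam j" for j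
      using e(2)[of "Inl j"] ee[of j j] by (simp add: g_skew_part[symmetric] g_simps)
    then have "(\<Sum>j\<in>UNIV. (g (A *v e j) (e j) - g (A *v (J *v e j)) (J *v e j)) / 2)
        = - (\<Sum>j\<in>UNIV. lam j)"
      by (simp add: sum_negf)
    then show ?thesis
      by (simp add: trace_pair_basis[OF e(1)] sum_divide_distrib[symmetric] sum_subtractf field_simps)
  qed
  finally show ?thesis .
qed

end

section \<open>The differential of the Lagrangian Monge-Ampere operator\<close>

lemma bounded_bilinear_matrix_mult:
  "bounded_bilinear ((**) :: real ^ 'm::finite ^ 'k::finite \<Rightarrow> real ^ 'n::finite ^ 'm \<Rightarrow> real ^ 'n ^ 'k)"
  unfolding bilinear_conv_bounded_bilinear[symmetric] bilinear_def
  by (intro conjI allI linearI)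
    (simp_all add: matrix_matrix_mult_def vec_eq_iff sum.distrib sum_distrib_left algebra_simps)

lemma bounded_linear_trace: "bounded_linear (trace :: real ^ 'm::finite ^ 'm \<Rightarrow> real)"
  unfolding linear_conv_bounded_linear[symmetric]
  by (rule linearI) (simp_all add: trace_def sum.distrib sum_distrib_left)

lemma bounded_linear_skew_part: "bounded_linear (skew_part J)"
  unfolding linear_conv_bounded_linear[symmetric]
proof (rule linearI)
  interpret bounded_bilinear "(**) :: 'a endo \<Rightarrow> 'a endo \<Rightarrow> 'a endo" by (rule bounded_bilinear_matrix_mult)
  show "skew_part J (A + B) = skew_part J A + skew_part J B"
    "skew_part J (c *\<^sub>R A) = c *\<^sub>R skew_part J A" for A B :: "'a endo" and c
    by (simp_all add: skew_part_def add_left add_right scaleR_left scaleR_right algebra_simps)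
qed

lemma subspace_symmetric_endos:
  assumes "bilinear g" shows "subspace (symmetric_endos g)"
  by (auto simp: subspace_def symmetric_endos_def matrix_vector_mult_add_rdistrib
      scaleR_matrix_vector_assoc[symmetric] bilinear_ladd[OF assms] bilinear_radd[OF assms]
      bilinear_lmul[OF assms] bilinear_rmul[OF assms] bilinear_lzero[OF assms] bilinear_rzero[OF assms])

text \<open>A differential within a subspace is determined only in directions of that subspace.
  There it is an ordinary derivative in one variable, whose uniqueness makes different differentials
  comparable.\<close>

lemma has_derivative_within_subspace_line:
  fixes \<phi> :: "'v::real_normed_vector \<Rightarrow> real"
  assumes V: "subspace V" "a \<in> V" "v \<in> V" and \<phi>: "(\<phi> has_derivative \<phi>') (at a within V)"
  shows "((\<lambda>t. \<phi> (a + t *\<^sub>R v)) has_real_derivative \<phi>' v) (at 0)"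
proof -
  let ?h = "\<lambda>t::real. a + t *\<^sub>R v"
  have 1: "(?h has_derivative (\<lambda>t. t *\<^sub>R v)) (at 0)"
    by (auto intro!: derivative_eq_intros)
  have "range ?h \<subseteq> V" using V by (auto intro!: subspace_add subspace_scale)
  then have "(\<phi> has_derivative \<phi>') (at (?h 0) within range ?h)"
    using \<phi> by (auto intro: has_derivative_subset)
  then have "((\<lambda>t. \<phi> (?h t)) has_derivative (\<lambda>t. \<phi>' (t *\<^sub>R v))) (at 0)"
    using has_derivative_in_compose[of ?h _ 0 UNIV \<phi> \<phi>'] 1 by simp
  moreover have "\<phi>' (t *\<^sub>R v) = \<phi>' v * t" for t
    using has_derivative_linear[OF \<phi>] by (simp add: linear_scale)
  ultimately show ?thesis by (simp add: has_field_derivative_def)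
qed

context hermitian_space
begin

text \<open>The differential of \<open>M_Lag\<close> only sees the diagonal part \<open>P'\<close> of \<open>P\<close> in a unitary eigenbasis of
  the skew part of \<open>A\<close>, because this holds for \<open>A \<mapsto> tr ((A\<^sup>s\<^sup>k\<^sup>e\<^sup>w)\<^sup>k)\<close>.\<close>

lemma M_Lag_has_derivative:
  assumes A: "A \<in> symmetric_endos g"
    and e: "onb (pair_basis e)" "\<And>k. skew_part J A *v pair_basis e k = pm lam k *\<^sub>R pair_basis e k"
    and diag: "\<And>k. g (P *v pair_basis e k) (pair_basis e k) = g (P' *v pair_basis e k) (pair_basis e k)"
  shows "\<exists>M'. (M_Lag J has_derivative M') (at A within symmetric_endos g) \<and> M' P = M' P'"
proof -
  define V where "V = symmetric_endos g"
  define b where "b = pair_basis e"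
  define Q where "Q \<phi> \<longleftrightarrow> (\<exists>\<phi>'. (\<phi> has_derivative \<phi>') (at A within V) \<and> \<phi>' P = \<phi>' P')"
    for \<phi> :: "'n endo \<Rightarrow> real"
  \<comment> \<open>The condition \<phi>' P = \<phi>' P' is linear in \<phi>' and survives the
    Leibniz rule, whose coefficients are values at \<open>A\<close>.\<close>
  have alg: "fun_algebra V Q"
  proof (rule fun_algebraI)
    show "Q (\<lambda>_. c)" for c
      unfolding Q_def by (intro exI[of _ "\<lambda>_. 0"]) auto
    fix \<phi> \<psi> assume \<phi>: "Q \<phi>"
    then obtain \<phi>' where 1: "(\<phi> has_derivative \<phi>') (at A within V)" "\<phi>' P = \<phi>' P'"
      by (auto simp: Q_def)
    { assume "Q \<psi>"
      then obtain \<psi>' where 2: "(\<psi> has_derivative \<psi>') (at A within V)" "\<psi>' P = \<psi>' P'"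
        by (auto simp: Q_def)
      show "Q (\<lambda>y. \<phi> y + \<psi> y)"
        unfolding Q_def using has_derivative_add[OF 1(1) 2(1)] 1(2) 2(2)
        by (intro exI[of _ "\<lambda>x. \<phi>' x + \<psi>' x"]) auto
      show "Q (\<lambda>y. \<phi> y * \<psi> y)"
        unfolding Q_def using has_derivative_mult[OF 1(1) 2(1)] 1(2) 2(2)
        by (intro exI[of _ "\<lambda>h. \<phi> A * \<psi>' h + \<phi>' h * \<psi> A"]) auto }
    assume "\<And>y. y \<in> V \<Longrightarrow> \<phi> y = \<psi> y"
    then have "(\<psi> has_derivative \<phi>') (at A within V)"
      using A 1(1) by (intro has_derivative_transform[of A V \<psi> \<phi>]) (auto simp: V_def)
    then show "Q \<psi>" using 1(2) by (auto simp: Q_def)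
  qed
  have Asym: "g (skew_part J A *v v) w = g v (skew_part J A *v w)" for v w
    using A by (simp add: skew_part_vec g_simps g_J_left symmetric_endos_def)
  \<comment> \<open>A diagonal entry of the skew part is half the difference of the entries at
    \<open>b k\<close> and \<open>J *v b k\<close>, and up to sign both vectors belong to the
    basis.\<close>
  have sk: "g (skew_part J P *v b k) (b k) = g (skew_part J P' *v b k) (b k)" for k
    unfolding g_skew_part b_def using diag[of k] diag[of "Inl _"] diag[of "Inr _"]
    by (cases k) (auto simp: matrix_vector_mult_uminus_right g_simps)
  \<comment> \<open>Single diagonal entries, rather than traces, are what the induction can carry:
    as the skew part of \<open>A\<close> is symmetric, \<open>b k\<close> acts as an eigenvector on
    either side of the product.\<close>
  have pow: "\<exists>D. ((\<lambda>A. mpow (skew_part J A) i) has_derivative D) (at A within V) \<and>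
      (\<forall>k. g (D P *v b k) (b k) = g (D P' *v b k) (b k))" for i
  proof (induction i)
    case 0
    show ?case by (intro exI[of _ "\<lambda>_. 0"]) auto
  next
    case (Suc i)
    then obtain D where D: "((\<lambda>A. mpow (skew_part J A) i) has_derivative D) (at A within V)"
      "\<And>k. g (D P *v b k) (b k) = g (D P' *v b k) (b k)" by blast
    have "(skew_part J has_derivative skew_part J) (at A within V)"
      by (intro bounded_linear_imp_has_derivative bounded_linear_skew_part)
    from bounded_bilinear.FDERIV[OF bounded_bilinear_matrix_mult this D(1)]
    have 1: "((\<lambda>A. mpow (skew_part J A) (Suc i)) has_derivative
        (\<lambda>h. skew_part J A ** D h + skew_part J h ** mpow (skew_part J A) i)) (at A within V)"
      by simp
    have 2: "g ((skew_part J A ** D h + skew_part J h ** mpow (skew_part J A) i) *v b k) (b k)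
        = pm lam k * g (D h *v b k) (b k) + pm lam k ^ i * g (skew_part J h *v b k) (b k)" for h k
    proof -
      have "mpow (skew_part J A) i *v b k = pm lam k ^ i *\<^sub>R b k"
        using mpow_eigen[OF e(2)] by (simp add: b_def)
      then show ?thesis
        using e(2)[of k]
        by (simp add: matrix_vector_mult_add_rdistrib matrix_vector_mul_assoc[symmetric] g_simps
            Asym matrix_vector_mult_scaleR b_def)
    qed
    show ?case
      by (rule exI, rule conjI, rule 1) (simp only: 2 D(2) sk, simp)
  qed
  have "Q (M_Lag J)"
  proof (rule fun_algebra_M_Lag[OF alg, where g = "\<lambda>_. g" and J = "\<lambda>_. J" and A = "\<lambda>A. A", simplified])
    show "hermitian_space g J" ..
    show "y \<in> symmetric_endos g" if "y \<in> V" for y using that by (simp add: V_def)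
    have "trace P = trace P'"
      using diag by (simp add: onb_trace[OF e(1)])
    then show "Q trace"
      unfolding Q_def using bounded_linear_imp_has_derivative[OF bounded_linear_trace] by blast
    fix i
    obtain D where D: "((\<lambda>A. mpow (skew_part J A) i) has_derivative D) (at A within V)"
      "\<And>k. g (D P *v b k) (b k) = g (D P' *v b k) (b k)" using pow by blast
    have "trace (D P) = trace (D P')"
      using D(2) by (simp add: onb_trace[OF e(1)] b_def)
    then show "Q (\<lambda>y. trace (mpow (skew_part J y) i))"
      unfolding Q_def using bounded_linear.has_derivative[OF bounded_linear_trace D(1)] by blast
  qed
  then show ?thesis by (simp add: Q_def V_def)
qed

lemma abs_signed_sum_le:
  assumes "\<And>j. l j \<ge> 0"
  shows "\<bar>signed_sum l \<epsilon>\<bar> \<le> (\<Sum>j\<in>UNIV. l j)"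
  by (rule order_trans[OF sum_abs]) (use assms in \<open>auto intro!: sum_mono\<close>)

lemma dM_Lag_lower_bound:
  assumes A: "A \<in> symmetric_endos g"
    and \<omega>: "\<And>v w. \<omega> v w = g v (J *v w)"
    and psh: "\<And>W. lagrangian \<omega> W \<Longrightarrow> trace_on g A W \<ge> 0"
    and M_pos: "M_Lag J A > 0"
  shows "trace A > 0"
    and "P \<in> symmetric_endos g \<Longrightarrow> (\<And>v. g (P *v v) v \<ge> 0) \<Longrightarrow>
      dM_Lag g J A P \<ge> M_Lag J A / trace A * trace P"
proof -
  obtain e lam where e: "onb (pair_basis e)" "\<And>j. lam j \<ge> 0"
    "\<And>k. skew_part J A *v pair_basis e k = pm lam k *\<^sub>R pair_basis e k"
    using ex_skew_eigenbasis[OF A] by blast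
  define a where "a \<epsilon> = trace A / 2 + signed_sum lam \<epsilon>" for \<epsilon>
  have M_eq: "M_Lag J A = (\<Prod>\<epsilon>\<in>UNIV. a \<epsilon>)"
    unfolding a_def by (rule M_Lag_eq[OF A]) (simp add: onb_trace_mpow[OF e(1,3)] sum_pm)
  have lam_le: "trace A / 2 - (\<Sum>j\<in>UNIV. lam j) \<ge> 0"
    by (rule psh_imp_smallest_factor_nonneg[OF A e(1,3) \<omega> psh])
  have a_nonneg: "a \<epsilon> \<ge> 0" for \<epsilon>
    using abs_signed_sum_le[of lam \<epsilon>] e(2) lam_le by (simp add: a_def)
  have a_pos: "a \<epsilon> > 0" for \<epsilon>
    using a_nonneg[of \<epsilon>] M_pos[unfolded M_eq] by (force simp: less_le)
  \<comment> \<open>A nonnegative smallest factor means that the \<open>lam j\<close> add up to at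
    most half the trace of \<open>A\<close>; the largest factor is then at most the whole
    trace.\<close>
  have a_le: "a \<epsilon> \<le> trace A" for \<epsilon>
    using abs_signed_sum_le[of lam \<epsilon>] e(2) lam_le by (simp add: a_def)
  show tr_pos: "trace A > 0" using a_pos a_le by (rule less_le_trans)

  assume P: "P \<in> symmetric_endos g" and P_nonneg: "\<And>v. g (P *v v) v \<ge> 0"
  define b where "b = pair_basis e"
  have bb: "g (b k) (b l) = (if k = l then 1 else 0)" for k l
    using e(1) by (simp add: onb_def b_def)
  define p where "p k = g (P *v b k) (b k)" for k
  \<comment> \<open>The part of \<open>P\<close> that is diagonal in the eigenbasis for
    \<open>A\<close>. The differential takes the same value on it, and moving \<open>A\<close> along
    it keeps the eigenbasis fixed.\<close>
  define P' where "P' = matrix (\<lambda>v. \<Sum>k\<in>UNIV. (p k * g v (b k)) *\<^sub>R b k)"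
  have P'_vec: "P' *v v = (\<Sum>k\<in>UNIV. (p k * g v (b k)) *\<^sub>R b k)" for v
    unfolding P'_def
    by (subst matrix_works)
      (auto intro!: linearI simp: linear_matrix_vector_mul_eq g_simps sum.distrib scaleR_sum_right algebra_simps)
  have P'_b: "P' *v b k = p k *\<^sub>R b k" for k
    by (simp add: P'_vec bb if_distrib[of "\<lambda>x. _ * x"] if_distrib[of "\<lambda>x. x *\<^sub>R _"] cong: if_cong)
  have P'_sym: "P' \<in> symmetric_endos g"
    by (simp add: symmetric_endos_def P'_vec g_sum_left g_sum_right g_simps g_sym[of _ "b _"] mult_ac)
  define q r where "q j = p (Inl j)" and "r j = p (Inr j)" for j
  have qr: "q j \<ge> 0" "r j \<ge> 0" for j by (simp_all add: q_def r_def p_def P_nonneg)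
  have tr_P: "trace P = (\<Sum>j\<in>UNIV. q j) + (\<Sum>j\<in>UNIV. r j)"
    by (simp add: trace_pair_basis[OF e(1)] q_def r_def p_def b_def)
  have tr_P': "trace P' = trace P"
    by (simp add: onb_trace[OF e(1), folded b_def] P'_b g_simps bb p_def)
  define \<delta> where "\<delta> j = (q j - r j) / 2" for j
  \<comment> \<open>The speed of the factor \<open>a \<epsilon>\<close> along \<open>P'\<close>.
    Unfolding \<delta>, it is the sum of \<open>r j\<close> where \<open>\<epsilon> j\<close> holds
    and of \<open>q j\<close> elsewhere: the trace of \<open>P\<close> on a Lagrangian
    plane.\<close>
  define c where "c \<epsilon> = trace P / 2 - signed_sum \<delta> \<epsilon>" for \<epsilon>

  have V: "subspace (symmetric_endos g)" by (rule subspace_symmetric_endos[OF bilinear_g])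
  have line: "M_Lag J (A + t *\<^sub>R P') = (\<Prod>\<epsilon>\<in>UNIV. a \<epsilon> + t * c \<epsilon>)" for t
  proof -
    let ?l = "\<lambda>j. lam j - t * \<delta> j"
    have sk: "skew_part J P' *v b k = pm (\<lambda>j. - \<delta> j) k *\<^sub>R b k" for k
      using P'_b[of "Inl (case k of Inl j \<Rightarrow> j | Inr j \<Rightarrow> j)"] P'_b[of "Inr (case k of Inl j \<Rightarrow> j | Inr j \<Rightarrow> j)"]
      by (cases k) (simp_all add: b_def skew_part_vec matrix_vector_mult_uminus_right
          matrix_vector_mult_scaleR \<delta>_def q_def r_def algebra_simps diff_divide_distrib)
    have eig: "skew_part J (A + t *\<^sub>R P') *v pair_basis e k = pm ?l k *\<^sub>R pair_basis e k" for k
    proof -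
      have "skew_part J (A + t *\<^sub>R P') = skew_part J A + t *\<^sub>R skew_part J P'"
        using bounded_linear_skew_part[of J]
        by (simp add: linear_add linear_scale bounded_linear.linear)
      then show ?thesis
        using sk[of k] e(3)[of k]
        by (cases k) (simp_all add: b_def matrix_vector_mult_add_rdistrib
            scaleR_matrix_vector_assoc[symmetric] algebra_simps)
    qed
    have "M_Lag J (A + t *\<^sub>R P') = (\<Prod>\<epsilon>\<in>UNIV. trace (A + t *\<^sub>R P') / 2 + signed_sum ?l \<epsilon>)"
      by (intro M_Lag_eq subspace_add[OF V] subspace_scale[OF V] A P'_sym)
        (simp only: onb_trace_mpow[OF e(1) eig] sum_pm)
    moreover have "trace (A + t *\<^sub>R P') / 2 + signed_sum ?l \<epsilon> = a \<epsilon> + t * c \<epsilon>" for \<epsilon>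
    proof -
      have "trace (A + t *\<^sub>R P') = trace A + t * trace P"
        by (simp add: tr_P'[symmetric]) (simp add: trace_def sum.distrib sum_distrib_left)
      moreover have "signed_sum ?l \<epsilon> = signed_sum lam \<epsilon> - t * signed_sum \<delta> \<epsilon>"
        unfolding sum_distrib_left sum_subtractf[symmetric] by (intro sum.cong) auto
      ultimately show ?thesis by (simp add: a_def c_def algebra_simps add_divide_distrib)
    qed
    ultimately show ?thesis by simp
  qed
  obtain M' where M': "(M_Lag J has_derivative M') (at A within symmetric_endos g)" "M' P = M' P'"
    using M_Lag_has_derivative[OF A e(1,3), of P P'] P'_b bb by (auto simp: p_def b_def g_simps)
  then have "(M_Lag J has_derivative dM_Lag g J A) (at A within symmetric_endos g)"
    unfolding dM_Lag_def by (metis frechet_derivative_works differentiableI)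
  \<comment> \<open>\<open>M'\<close> was obtained for this particular pair \<open>P\<close>,
    \<open>P'\<close>; on the line through \<open>A\<close> in direction \<open>P\<close> it has to
    agree with \<open>dM_Lag\<close>.\<close>
  from has_derivative_within_subspace_line[OF V A P this]
    has_derivative_within_subspace_line[OF V A P M'(1)]
  have "dM_Lag g J A P = M' P'" using DERIV_unique M'(2) by metis
  moreover have "M' P' = (\<Sum>\<epsilon>\<in>UNIV. c \<epsilon> * (\<Prod>\<epsilon>'\<in>UNIV - {\<epsilon>}. a \<epsilon>'))"
  proof (rule DERIV_unique)
    show "((\<lambda>t. M_Lag J (A + t *\<^sub>R P')) has_real_derivative M' P') (at 0)"
      by (rule has_derivative_within_subspace_line[OF V A P'_sym M'(1)])
    have "((\<lambda>t. \<Prod>\<epsilon>\<in>UNIV. a \<epsilon> + t * c \<epsilon>) has_real_derivative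
        (\<Sum>\<epsilon>\<in>UNIV. c \<epsilon> * (\<Prod>\<epsilon>'\<in>UNIV - {\<epsilon>}. a \<epsilon>' + 0 * c \<epsilon>'))) (at 0)"
      by (rule has_field_derivative_prod) (auto intro!: derivative_eq_intros)
    then show "((\<lambda>t. M_Lag J (A + t *\<^sub>R P')) has_real_derivative
        (\<Sum>\<epsilon>\<in>UNIV. c \<epsilon> * (\<Prod>\<epsilon>'\<in>UNIV - {\<epsilon>}. a \<epsilon>'))) (at 0)"
      by (simp add: line)
  qed
  moreover have c_nonneg: "c \<epsilon> \<ge> 0" for \<epsilon>
  proof -
    have "c \<epsilon> = (\<Sum>j\<in>UNIV. (q j + r j) / 2 - (if \<epsilon> j then \<delta> j else - \<delta> j))"
      by (simp add: c_def tr_P sum_subtractf sum_divide_distrib[symmetric] sum.distrib)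
    also have "\<dots> \<ge> 0"
      by (rule sum_nonneg) (use qr in \<open>auto simp: \<delta>_def field_simps\<close>)
    finally show ?thesis .
  qed
  moreover have "(\<Sum>\<epsilon>\<in>UNIV. c \<epsilon> * (\<Prod>\<epsilon>'\<in>UNIV - {\<epsilon>}. a \<epsilon>')) \<ge> (\<Sum>\<epsilon>\<in>UNIV. c \<epsilon> * (M_Lag J A / trace A))"
  proof (rule sum_mono, rule mult_left_mono[OF _ c_nonneg])
    fix \<epsilon>
    have "(\<Prod>\<epsilon>'\<in>UNIV - {\<epsilon>}. a \<epsilon>') = M_Lag J A / a \<epsilon>"
      using a_pos[of \<epsilon>] by (simp add: M_eq prod.remove[of UNIV \<epsilon>])
    then show "M_Lag J A / trace A \<le> (\<Prod>\<epsilon>'\<in>UNIV - {\<epsilon>}. a \<epsilon>')"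
      using M_pos a_pos a_le by (simp add: frac_le)
  qed
  moreover have "(\<Sum>\<epsilon>\<in>UNIV. c \<epsilon> * (M_Lag J A / trace A)) \<ge> M_Lag J A / trace A * trace P"
  proof -
    have ne: "(\<lambda>_. True) \<noteq> (\<lambda>_::'n. False)" by (metis)
    have "trace P = (\<Sum>\<epsilon>\<in>{\<lambda>_. True, \<lambda>_. False}. c \<epsilon>)"
      using ne by (simp add: c_def sum_negf)
    also have "\<dots> \<le> (\<Sum>\<epsilon>\<in>UNIV. c \<epsilon>)"
      by (rule sum_mono2) (auto simp: c_nonneg)
    finally have "M_Lag J A / trace A * trace P \<le> M_Lag J A / trace A * (\<Sum>\<epsilon>\<in>UNIV. c \<epsilon>)"
      using M_pos tr_pos by (intro mult_left_mono) auto
    then show ?thesis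
      by (simp only: sum_distrib_right[symmetric] mult.commute)
  qed
  ultimately show "dM_Lag g J A P \<ge> M_Lag J A / trace A * trace P" by linarith
qed

end

section \<open>Calculus of \<open>C\<^sup>k\<close> maps\<close>

lemma has_derivative_cong_open:
  assumes "open S" "x \<in> S" "\<And>y. y \<in> S \<Longrightarrow> f y = g y"
  shows "(f has_derivative f') (at x) \<longleftrightarrow> (g has_derivative f') (at x)"
  using assms has_derivative_transform_within_open[of f f' x UNIV S g]
    has_derivative_transform_within_open[of g f' x UNIV S f] by fastforce

lemma frechet_derivative_cong_open:
  assumes "open S" "x \<in> S" "\<And>y. y \<in> S \<Longrightarrow> f y = g y"
  shows "frechet_derivative f (at x) = frechet_derivative g (at x)"
  unfolding frechet_derivative_def using has_derivative_cong_open[OF assms] by simp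

lemma differentiable_cong_open:
  assumes "open S" "x \<in> S" "\<And>y. y \<in> S \<Longrightarrow> f y = g y"
  shows "f differentiable (at x) \<longleftrightarrow> g differentiable (at x)"
  unfolding differentiable_def using has_derivative_cong_open[OF assms] by simp

text \<open>The induction goes through because \<open>S\<close> is open: a derivative at a point of
  \<open>S\<close> is determined by the values in \<open>S\<close>.\<close>

lemma Ck_on_cong:
  assumes "open S" "\<And>y. y \<in> S \<Longrightarrow> f y = g y"
  shows "Ck_on k S f \<longleftrightarrow> Ck_on k S g"
  using assms(2)
proof (induction k arbitrary: f g)
  case 0
  then show ?case by (simp cong: continuous_on_cong)
next
  case (Suc k)
  have "Ck_on k S (\<lambda>x. frechet_derivative f (at x) v) \<longleftrightarrow> Ck_on k S (\<lambda>x. frechet_derivative g (at x) v)"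
    for v
    by (rule Suc.IH) (use frechet_derivative_cong_open[OF assms(1) _ Suc.prems] in auto)
  moreover have "f differentiable (at x) \<longleftrightarrow> g differentiable (at x)" if "x \<in> S" for x
    by (rule differentiable_cong_open[OF assms(1) that Suc.prems])
  ultimately show ?case by auto
qed

lemma Ck_on_subset: "Ck_on k S f \<Longrightarrow> T \<subseteq> S \<Longrightarrow> Ck_on k T f"
  by (induction k arbitrary: f) (auto intro: continuous_on_subset)

lemma Ck_on_Suc_imp: "Ck_on (Suc k) S f \<Longrightarrow> Ck_on k S f"
  by (induction k arbitrary: f)
    (auto intro!: continuous_at_imp_continuous_on differentiable_imp_continuous_within)

lemma Ck_on_imp_continuous_on: "Ck_on k S f \<Longrightarrow> continuous_on S f"
  by (induction k) (simp, metis Ck_on_Suc_imp)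

lemma Ck_on_differentiable: "Ck_on (Suc k) S f \<Longrightarrow> x \<in> S \<Longrightarrow> f differentiable (at x)"
  by simp

lemma Ck_on_frechet: "Ck_on (Suc k) S f \<Longrightarrow> Ck_on k S (\<lambda>x. frechet_derivative f (at x) v)"
  by simp

lemma frechet_derivative_at_eq: "(f has_derivative f') (at x) \<Longrightarrow> frechet_derivative f (at x) v = f' v"
  using frechet_derivative_at by metis

lemma Ck_on_const: "Ck_on k S (\<lambda>_. c)"
  by (induction k arbitrary: c) (auto simp: frechet_derivative_const)

lemma Ck_on_bounded_linear:
  assumes L: "bounded_linear L" and S: "open S"
  shows "Ck_on k S f \<Longrightarrow> Ck_on k S (\<lambda>x. L (f x))"
proof (induction k arbitrary: f)
  case 0
  then show ?case by (auto intro: bounded_linear.continuous_on[OF L])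
next
  case (Suc k)
  have *: "((\<lambda>x. L (f x)) has_derivative (\<lambda>v. L (frechet_derivative f (at x) v))) (at x)" if "x \<in> S" for x
    using Suc.prems that
    by (intro bounded_linear.has_derivative[OF L]) (auto simp: frechet_derivative_works)
  have "Ck_on k S (\<lambda>x. frechet_derivative (\<lambda>x. L (f x)) (at x) v)" for v
    by (subst Ck_on_cong[OF S, of _ "\<lambda>x. L (frechet_derivative f (at x) v)"])
      (use Suc.IH Suc.prems frechet_derivative_at_eq[OF *] in auto)
  then show ?case using * by (auto simp: differentiable_def)
qed

lemma Ck_on_add:
  assumes S: "open S"
  shows "Ck_on k S f \<Longrightarrow> Ck_on k S g \<Longrightarrow> Ck_on k S (\<lambda>x. f x + g x)"
proof (induction k arbitrary: f g)
  case 0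
  then show ?case by (auto intro: continuous_on_add)
next
  case (Suc k)
  have *: "((\<lambda>x. f x + g x) has_derivative
      (\<lambda>v. frechet_derivative f (at x) v + frechet_derivative g (at x) v)) (at x)" if "x \<in> S" for x
    using Suc.prems that by (intro has_derivative_add) (auto simp: frechet_derivative_works)
  have "Ck_on k S (\<lambda>x. frechet_derivative (\<lambda>x. f x + g x) (at x) v)" for v
    by (subst Ck_on_cong[OF S, of _ "\<lambda>x. frechet_derivative f (at x) v + frechet_derivative g (at x) v"])
      (use Suc.IH Suc.prems frechet_derivative_at_eq[OF *] in auto)
  then show ?case using * by (auto simp: differentiable_def)
qed

lemma Ck_on_sum:
  assumes "open S" "\<And>i. i \<in> I \<Longrightarrow> Ck_on k S (f i)"
  shows "Ck_on k S (\<lambda>x. \<Sum>i\<in>I. f i x)"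
  using assms(2) by (induction I rule: infinite_finite_induct) (auto intro: Ck_on_const Ck_on_add[OF assms(1)])

lemma Ck_on_scaleR:
  assumes S: "open S"
  shows "Ck_on k S f \<Longrightarrow> Ck_on k S g \<Longrightarrow> Ck_on k S (\<lambda>x. f x *\<^sub>R g x)"
proof (induction k arbitrary: f g)
  case 0
  then show ?case by (auto intro: continuous_on_scaleR)
next
  case (Suc k)
  have *: "((\<lambda>x. f x *\<^sub>R g x) has_derivative
      (\<lambda>v. f x *\<^sub>R frechet_derivative g (at x) v + frechet_derivative f (at x) v *\<^sub>R g x)) (at x)"
    if "x \<in> S" for x
    using Suc.prems that by (intro has_derivative_scaleR) (auto simp: frechet_derivative_works)
  have "Ck_on k S (\<lambda>x. f x *\<^sub>R frechet_derivative g (at x) v + frechet_derivative f (at x) v *\<^sub>R g x)" for v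
    by (intro Ck_on_add[OF S] Suc.IH Suc.prems[THEN Ck_on_Suc_imp] Suc.prems[THEN Ck_on_frechet])
  then have "Ck_on k S (\<lambda>x. frechet_derivative (\<lambda>x. f x *\<^sub>R g x) (at x) v)" for v
    by (subst Ck_on_cong[OF S, of _ "\<lambda>x. f x *\<^sub>R frechet_derivative g (at x) v + frechet_derivative f (at x) v *\<^sub>R g x"])
      (use frechet_derivative_at_eq[OF *] in auto)
  then show ?case using * by (auto simp: differentiable_def)
qed

text \<open>The chain rule applies a varying derivative to a varying vector. Expanding that vector
  in \<open>Basis\<close> leaves products of scalars with partial derivatives of \<open>f\<close>
  composed with \<open>g\<close>, to which the induction hypothesis for arbitrary \<open>f\<close>
  applies.\<close>

lemma Ck_on_compose:
  fixes f :: "'f::euclidean_space \<Rightarrow> 'g::real_normed_vector" and g :: "'e::euclidean_space \<Rightarrow> 'f"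
  assumes S: "open S" and T: "open T" and gST: "g ` S \<subseteq> T"
  shows "Ck_on k T f \<Longrightarrow> Ck_on k S g \<Longrightarrow> Ck_on k S (\<lambda>x. f (g x))"
proof (induction k arbitrary: f)
  case 0
  then show ?case using gST by (auto intro: continuous_on_compose2)
next
  case (Suc k)
  have *: "((\<lambda>x. f (g x)) has_derivative
      (\<lambda>v. frechet_derivative f (at (g x)) (frechet_derivative g (at x) v))) (at x)" if "x \<in> S" for x
    using Suc.prems that gST
    by (intro has_derivative_compose[of g _ x UNIV f, simplified]) (auto simp: frechet_derivative_works)
  have eq: "frechet_derivative (\<lambda>x. f (g x)) (at x) v =
      (\<Sum>b\<in>Basis. (frechet_derivative g (at x) v \<bullet> b) *\<^sub>R frechet_derivative f (at (g x)) b)"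
    if "x \<in> S" for x v
  proof -
    let ?L = "frechet_derivative f (at (g x))" and ?w = "frechet_derivative g (at x) v"
    have L: "linear ?L"
      using Suc.prems(1) gST that by (intro linear_frechet_derivative) auto
    have "?L ?w = ?L (\<Sum>b\<in>Basis. (?w \<bullet> b) *\<^sub>R b)"
      by (simp only: euclidean_representation)
    also have "\<dots> = (\<Sum>b\<in>Basis. (?w \<bullet> b) *\<^sub>R ?L b)"
      by (simp only: linear_sum[OF L] linear_scale[OF L])
    finally show ?thesis
      unfolding frechet_derivative_at_eq[OF *[OF that]] .
  qed
  have "Ck_on k S (\<lambda>x. \<Sum>b\<in>Basis. (frechet_derivative g (at x) v \<bullet> b) *\<^sub>R frechet_derivative f (at (g x)) b)" for v
    by (intro Ck_on_sum[OF S] Ck_on_scaleR[OF S] Suc.IH Suc.prems(2)[THEN Ck_on_Suc_imp]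
        Suc.prems[THEN Ck_on_frechet] Ck_on_bounded_linear[OF bounded_linear_inner_left S])
  then have "Ck_on k S (\<lambda>x. frechet_derivative (\<lambda>x. f (g x)) (at x) v)" for v
    by (subst Ck_on_cong[OF S eq])
  then show ?case using * by (auto simp: differentiable_def)
qed

lemma Ck_on_id: "Ck_on k S (\<lambda>x. x)"
  by (cases k) (auto simp: frechet_derivative_ident Ck_on_const)

lemma Cinf_onD: "Cinf_on S f \<Longrightarrow> Ck_on k S f"
  by (simp add: Cinf_on_def)

lemma Cinf_on_differentiable: "Cinf_on S f \<Longrightarrow> x \<in> S \<Longrightarrow> f differentiable (at x)"
  using Cinf_onD[of S f 1] by simp

lemma Cinf_on_continuous_on: "Cinf_on S f \<Longrightarrow> continuous_on S f"
  using Cinf_onD[of S f 0] by simp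

lemma Cinf_on_cong: "open S \<Longrightarrow> (\<And>y. y \<in> S \<Longrightarrow> f y = g y) \<Longrightarrow> Cinf_on S f \<longleftrightarrow> Cinf_on S g"
  using Ck_on_cong unfolding Cinf_on_def by blast

lemma Cinf_on_subset: "Cinf_on S f \<Longrightarrow> T \<subseteq> S \<Longrightarrow> Cinf_on T f"
  by (auto simp: Cinf_on_def intro: Ck_on_subset)

lemma Cinf_on_frechet: "Cinf_on S f \<Longrightarrow> Cinf_on S (\<lambda>x. frechet_derivative f (at x) v)"
  unfolding Cinf_on_def using Ck_on_frechet by blast

lemma Cinf_on_const: "Cinf_on S (\<lambda>_. c)"
  by (simp add: Cinf_on_def Ck_on_const)

lemma Cinf_on_sum: "open S \<Longrightarrow> (\<And>i. i \<in> I \<Longrightarrow> Cinf_on S (f i)) \<Longrightarrow> Cinf_on S (\<lambda>x. \<Sum>i\<in>I. f i x)"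
  by (simp add: Cinf_on_def Ck_on_sum)

lemma Cinf_on_scaleR:
  "open S \<Longrightarrow> Cinf_on S f \<Longrightarrow> Cinf_on S g \<Longrightarrow> Cinf_on S (\<lambda>x. f x *\<^sub>R g x)"
  by (simp add: Cinf_on_def Ck_on_scaleR)

lemma Cinf_on_nth: "open S \<Longrightarrow> Cinf_on S f \<Longrightarrow> Cinf_on S (\<lambda>x. f x $ i)"
  by (simp add: Cinf_on_def Ck_on_bounded_linear[OF bounded_linear_vec_nth])

lemma Cinf_on_compose:
  "open S \<Longrightarrow> open T \<Longrightarrow> g ` S \<subseteq> T \<Longrightarrow> Cinf_on T f \<Longrightarrow> Cinf_on S g \<Longrightarrow> Cinf_on S (\<lambda>x. f (g x))"
  unfolding Cinf_on_def using Ck_on_compose by blast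

text \<open>Schwarz: both mixed derivatives are limits of the second difference quotient
  \<open>(f (x + t v + t w) - f (x + t v) - f (x + t w) + f x) / t\<^sup>2\<close>.\<close>

lemma Ck_on_2_symmetric:
  fixes f :: "'e::euclidean_space \<Rightarrow> real"
  assumes S: "open S" "x \<in> S" and f: "Ck_on 2 S f"
  defines "F \<equiv> \<lambda>v w. frechet_derivative (\<lambda>y. frechet_derivative f (at y) w) (at x) v"
  shows "F v w = F w v"
proof -
  define H where "H v w y = frechet_derivative (\<lambda>y. frechet_derivative f (at y) w) (at y) v" for v w y
  have cont_H: "continuous_on S (H v w)" for v w
    using f by (simp add: H_def[abs_def] numeral_2_eq_2)
  have D1: "(f has_derivative frechet_derivative f (at y)) (at y)" if "y \<in> S" for y
    using f that by (simp add: numeral_2_eq_2 frechet_derivative_works)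
  have D2: "((\<lambda>y. frechet_derivative f (at y) w) has_derivative (\<lambda>v. H v w y)) (at y)" if "y \<in> S" for y w
    using f that by (simp add: numeral_2_eq_2 frechet_derivative_works H_def)
  define \<Delta> where "\<Delta> v w t = f (x + t *\<^sub>R v + t *\<^sub>R w) - f (x + t *\<^sub>R v) - f (x + t *\<^sub>R w) + f x" for v w t
  obtain r where r: "r > 0" "ball x r \<subseteq> S" using S openE by blast
  have key: "\<exists>d>0. \<forall>t. 0 < t \<longrightarrow> t < d \<longrightarrow> \<bar>\<Delta> v w t / t\<^sup>2 - H v w x\<bar> < \<epsilon>" if "\<epsilon> > 0" for v w \<epsilon>
  proof -
    have "continuous (at x) (H v w)"
      using cont_H S continuous_on_eq_continuous_at by blast
    then obtain d0 where d0: "d0 > 0" "\<And>y. dist y x < d0 \<Longrightarrow> \<bar>H v w y - H v w x\<bar> < \<epsilon>"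
      using \<open>\<epsilon> > 0\<close> unfolding continuous_at_eps_delta dist_real_def by blast
    define m where "m = min d0 r"
    \<comment> \<open>Steps shorter than \<open>d\<close> keep the whole parallelogram within
      distance \<open>m\<close> of \<open>x\<close>, hence inside \<open>S\<close> and where
      \<open>H v w\<close> is close to its value at \<open>x\<close>. The 1 prevents division by
      zero.\<close>
    define d where "d = m / (norm v + norm w + 1)"
    have pos: "norm v + norm w + 1 > 0" by (simp add: add_nonneg_pos)
    have m: "m > 0" using d0 r by (simp add: m_def)
    have d: "d > 0" using m pos by (simp add: d_def)
    have near: "dist (x + a *\<^sub>R v + b *\<^sub>R w) x < m" if "0 \<le> a" "a < d" "0 \<le> b" "b < d" for a b
    proof -
      have "norm (a *\<^sub>R v + b *\<^sub>R w) \<le> a * norm v + b * norm w"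
        using norm_triangle_ineq[of "a *\<^sub>R v" "b *\<^sub>R w"] that by simp
      also have "\<dots> \<le> d * norm v + d * norm w"
        using that by (intro add_mono mult_right_mono) auto
      also have "\<dots> < d * (norm v + norm w + 1)" using d by (simp add: algebra_simps)
      also have "\<dots> = m" using pos by (simp add: d_def)
      finally show ?thesis by (simp add: dist_norm add.assoc)
    qed
    have inS: "x + a *\<^sub>R v + b *\<^sub>R w \<in> S" if "0 \<le> a" "a < d" "0 \<le> b" "b < d" for a b
      using near[OF that] r by (auto simp: m_def dist_commute)
    have "\<bar>\<Delta> v w t / t\<^sup>2 - H v w x\<bar> < \<epsilon>" if t: "0 < t" "t < d" for t
    proof -
      \<comment> \<open>The second difference is \<phi> t - \<phi> 0. The mean value theorem, first
        in direction \<open>w\<close> and then in direction \<open>v\<close>, makes it t^2 times a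
        value of \<open>H v w\<close> near \<open>x\<close>.\<close>
      define \<phi> where "\<phi> s = f (x + t *\<^sub>R v + s *\<^sub>R w) - f (x + s *\<^sub>R w)" for s
      define \<phi>' where "\<phi>' s = frechet_derivative f (at (x + t *\<^sub>R v + s *\<^sub>R w)) w -
          frechet_derivative f (at (x + s *\<^sub>R w)) w" for s
      have "(\<phi> has_real_derivative \<phi>' s) (at s)" if "0 \<le> s" "s \<le> t" for s
      proof -
        have P: "((\<lambda>s. f (z + s *\<^sub>R w)) has_real_derivative frechet_derivative f (at (z + s *\<^sub>R w)) w) (at s)"
          if "z + s *\<^sub>R w \<in> S" for z
        proof -
          have "((\<lambda>s. z + s *\<^sub>R w) has_derivative (\<lambda>h. h *\<^sub>R w)) (at s)"
            by (auto intro!: derivative_eq_intros)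
          from has_derivative_compose[OF this D1[OF that]]
          show ?thesis
            using has_derivative_linear[OF D1[OF that]]
            by (simp add: has_field_derivative_def linear_scale mult.commute[of _ "frechet_derivative f _ _"] cong: if_cong)
        qed
        show ?thesis
          unfolding \<phi>_def \<phi>'_def using that t inS[of t s] inS[of 0 s] by (intro DERIV_diff P) auto
      qed
      from MVT2[OF t(1) this] obtain s where s: "0 < s" "s < t" "\<phi> t - \<phi> 0 = t * \<phi>' s" by auto
      define \<psi> where "\<psi> a = frechet_derivative f (at (x + a *\<^sub>R v + s *\<^sub>R w)) w" for a
      have "(\<psi> has_real_derivative H v w (x + a *\<^sub>R v + s *\<^sub>R w)) (at a)" if "0 \<le> a" "a \<le> t" for a
      proof -
        have 1: "((\<lambda>a. x + a *\<^sub>R v + s *\<^sub>R w) has_derivative (\<lambda>h. h *\<^sub>R v)) (at a)"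
          by (auto intro!: derivative_eq_intros)
        have 2: "x + a *\<^sub>R v + s *\<^sub>R w \<in> S" using that t s by (intro inS) auto
        have "H (h *\<^sub>R v) w (x + a *\<^sub>R v + s *\<^sub>R w) = H v w (x + a *\<^sub>R v + s *\<^sub>R w) * h" for h
          using linear_scale[OF has_derivative_linear[OF D2[OF 2, of w]], of h v] by simp
        then show ?thesis
          using has_derivative_compose[OF 1 D2[OF 2, of w]]
          by (simp add: has_field_derivative_def \<psi>_def[abs_def])
      qed
      from MVT2[OF t(1) this] obtain a where a: "0 < a" "a < t"
        "\<psi> t - \<psi> 0 = t * H v w (x + a *\<^sub>R v + s *\<^sub>R w)" by auto
      have "\<Delta> v w t = \<phi> t - \<phi> 0" by (simp add: \<Delta>_def \<phi>_def)
      also have "\<dots> = t * (\<psi> t - \<psi> 0)" using s(3) by (simp add: \<phi>'_def \<psi>_def)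
      also have "\<dots> = t\<^sup>2 * H v w (x + a *\<^sub>R v + s *\<^sub>R w)" by (simp add: a(3) power2_eq_square)
      finally have "\<Delta> v w t / t\<^sup>2 = H v w (x + a *\<^sub>R v + s *\<^sub>R w)" using t by simp
      moreover have "dist (x + a *\<^sub>R v + s *\<^sub>R w) x < d0"
        using near[of a s] a s t by (simp add: m_def)
      ultimately show ?thesis using d0(2) by simp
    qed
    then show ?thesis using d by blast
  qed
  have "\<bar>H v w x - H w v x\<bar> < \<epsilon>" if "\<epsilon> > 0" for \<epsilon>
  proof -
    have half: "\<epsilon> / 2 > 0" using that by simp
    obtain d1 where d1: "d1 > 0" "\<And>t. 0 < t \<Longrightarrow> t < d1 \<Longrightarrow> \<bar>\<Delta> v w t / t\<^sup>2 - H v w x\<bar> < \<epsilon> / 2"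
      using key[OF half, of v w] by blast
    obtain d2 where d2: "d2 > 0" "\<And>t. 0 < t \<Longrightarrow> t < d2 \<Longrightarrow> \<bar>\<Delta> w v t / t\<^sup>2 - H w v x\<bar> < \<epsilon> / 2"
      using key[OF half, of w v] by blast
    define t where "t = min d1 d2 / 2"
    have t: "0 < t" "t < d1" "t < d2" using d1 d2 by (auto simp: t_def)
    have "\<Delta> v w t = \<Delta> w v t" by (simp add: \<Delta>_def add_ac)
    then have "\<bar>\<Delta> v w t / t\<^sup>2 - H v w x\<bar> < \<epsilon> / 2" "\<bar>\<Delta> v w t / t\<^sup>2 - H w v x\<bar> < \<epsilon> / 2"
      using d1(2)[OF t(1,2)] d2(2)[OF t(1,3)] by simp_all
    then show ?thesis by linarith
  qed
  then have "H v w x = H w v x"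
    by (metis less_irrefl right_minus_eq zero_less_abs_iff)
  then show ?thesis by (simp add: H_def F_def)
qed

section \<open>Charts and coordinate fields\<close>

lemma linear_model_expansion:
  fixes L :: "real ^ 'm::finite \<Rightarrow> 'b::real_vector"
  assumes "linear L" shows "L v = (\<Sum>i\<in>UNIV. v $ i *\<^sub>R L (axis i 1))"
proof -
  have "L v = L (\<Sum>i\<in>UNIV. v $ i *\<^sub>R axis i 1)"
    using basis_expansion[of v] by (simp add: scalar_mult_eq_scaleR)
  then show ?thesis by (simp only: linear_sum[OF assms] linear_scale[OF assms])
qed

locale smooth_manifold =
  fixes \<A> :: "('a::topological_space, 'n::finite) chart set"
  assumes atlas: "smooth_atlas \<A>"
begin

lemma chart_at_in [simp, intro]: "chart_at \<A> p \<in> \<A>" "p \<in> dom_of (chart_at \<A> p)"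
proof -
  have "p \<in> (\<Union>c\<in>\<A>. dom_of c)" using atlas unfolding smooth_atlas_def by simp
  then have "\<exists>c. c \<in> \<A> \<and> p \<in> dom_of c" by blast
  from someI_ex[OF this] show "chart_at \<A> p \<in> \<A>" "p \<in> dom_of (chart_at \<A> p)"
    by (auto simp: chart_at_def)
qed

context
  fixes c assumes c: "c \<in> \<A>"
begin

lemma chart: "is_chart c"
  using c atlas by (auto simp: smooth_atlas_def)

lemma open_dom: "open (dom_of c)"
  using chart by (simp add: is_chart_def)

lemma param_coord: "q \<in> dom_of c \<Longrightarrow> param c (coord c q) = q"
  using chart by (auto simp: is_chart_def homeomorphism_def)

lemma coord_param: "y \<in> coord c ` (dom_of c \<inter> U) \<Longrightarrow> coord c (param c y) = y \<and> param c y \<in> dom_of c \<inter> U"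
  using param_coord by auto

lemma continuous_coord: "continuous_on (dom_of c) (coord c)"
  using chart by (auto simp: is_chart_def homeomorphism_def)

lemma continuous_param: "continuous_on (coord c ` dom_of c) (param c)"
  using chart by (auto simp: is_chart_def homeomorphism_def)

lemma open_coord_image:
  assumes "open U" shows "open (coord c ` (dom_of c \<inter> U))"
proof -
  have "coord c ` (dom_of c \<inter> U) = coord c ` dom_of c \<inter> param c -` U"
    using param_coord by force
  moreover have "open (coord c ` dom_of c)" using chart by (simp add: is_chart_def)
  ultimately show ?thesis
    using continuous_on_open_vimage continuous_param assms by (metis Int_commute)
qed

lemma continuous_on_from_chart:
  assumes "continuous_on (coord c ` (dom_of c \<inter> U)) f"
  shows "continuous_on (dom_of c \<inter> U) (\<lambda>q. f (coord c q))"
  by (rule continuous_on_compose2[OF assms continuous_on_subset[OF continuous_coord]]) auto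

end

text \<open>The tangent map of the change from chart \<open>c\<close> to chart \<open>d\<close>.
  \<open>coord_field\<close> and \<open>components\<close> are the cases where one of the two is the
  preferred chart, so their calculus reduces to the cocycle rule \<open>tmap_chain\<close>.\<close>

definition tmap :: "('a, 'n) chart \<Rightarrow> ('a, 'n) chart \<Rightarrow> 'a \<Rightarrow> 'n model \<Rightarrow> 'n model" where
  "tmap c d q v = frechet_derivative (coord d \<circ> param c) (at (coord c q)) v"

lemma coord_field_tmap: "coord_field \<A> c v q = tmap c (chart_at \<A> q) q v"
  by (simp add: coord_field_def tmap_def)

lemma components_tmap: "components \<A> c q \<xi> = tmap (chart_at \<A> q) c q \<xi>"
  by (simp add: components_def tmap_def)

lemma trans_Cinf:
  "c \<in> \<A> \<Longrightarrow> d \<in> \<A> \<Longrightarrow> Cinf_on (coord c ` (dom_of c \<inter> dom_of d)) (coord d \<circ> param c)"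
  using atlas by (auto simp: smooth_atlas_def)

lemma tmap_has_derivative:
  assumes "c \<in> \<A>" "d \<in> \<A>" "q \<in> dom_of c" "q \<in> dom_of d"
  shows "((coord d \<circ> param c) has_derivative tmap c d q) (at (coord c q))"
  using Cinf_on_differentiable[OF trans_Cinf, of c d "coord c q"] assms
  unfolding tmap_def[abs_def] by (simp add: frechet_derivative_works)

lemma tmap_linear:
  "c \<in> \<A> \<Longrightarrow> d \<in> \<A> \<Longrightarrow> q \<in> dom_of c \<Longrightarrow> q \<in> dom_of d \<Longrightarrow> linear (tmap c d q)"
  using tmap_has_derivative has_derivative_linear by blast

lemma has_derivative_change_chart:
  assumes c: "c \<in> \<A>" "q \<in> dom_of c" and d: "d \<in> \<A>" "q \<in> dom_of d"
    and f: "((f \<circ> param d) has_derivative f') (at (coord d q))"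
  shows "((f \<circ> param c) has_derivative (\<lambda>v. f' (tmap c d q v))) (at (coord c q))"
proof -
  have "((\<lambda>y. (f \<circ> param d) ((coord d \<circ> param c) y)) has_derivative (\<lambda>v. f' (tmap c d q v)))
      (at (coord c q))"
    by (rule has_derivative_compose[OF tmap_has_derivative[OF c(1) d(1) c(2) d(2)]])
      (use f c in \<open>simp add: param_coord o_def\<close>)
  then show ?thesis
    by (rule has_derivative_transform_within_open[of _ _ _ _ "coord c ` (dom_of c \<inter> dom_of d)"])
      (use c d in \<open>auto simp: open_coord_image open_dom param_coord\<close>)
qed

lemma tmap_chain:
  assumes "c \<in> \<A>" "d \<in> \<A>" "e \<in> \<A>" "q \<in> dom_of c" "q \<in> dom_of d" "q \<in> dom_of e"
  shows "tmap d e q (tmap c d q v) = tmap c e q v"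
proof -
  have "((coord e \<circ> param c) has_derivative (\<lambda>v. tmap d e q (tmap c d q v))) (at (coord c q))"
    using assms by (intro has_derivative_change_chart[of c q d] tmap_has_derivative)
  from has_derivative_unique[OF this tmap_has_derivative[of c e q]] assms show ?thesis
    by (simp add: fun_eq_iff)
qed

lemma tmap_id:
  assumes c: "c \<in> \<A>" "q \<in> dom_of c"
  shows "tmap c c q v = v"
proof -
  have "((\<lambda>y. y) has_derivative (\<lambda>v. v)) (at (coord c q))" by (rule has_derivative_ident)
  then have "((coord c \<circ> param c) has_derivative (\<lambda>v. v)) (at (coord c q))"
    by (rule has_derivative_transform_within_open[of _ _ _ _ "coord c ` (dom_of c \<inter> UNIV)"])
      (use c in \<open>auto simp: param_coord open_coord_image[of c UNIV, simplified]\<close>)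
  then show ?thesis
    using has_derivative_unique[OF tmap_has_derivative[OF c(1) c(1) c(2) c(2)]] by metis
qed

lemma components_coord_field:
  "c \<in> \<A> \<Longrightarrow> d \<in> \<A> \<Longrightarrow> q \<in> dom_of c \<Longrightarrow> q \<in> dom_of d \<Longrightarrow>
    components \<A> d q (coord_field \<A> c v q) = tmap c d q v"
  by (simp add: components_tmap coord_field_tmap tmap_chain)

lemma components_coord_field_same [simp]:
  "c \<in> \<A> \<Longrightarrow> q \<in> dom_of c \<Longrightarrow> components \<A> c q (coord_field \<A> c v q) = v"
  by (simp add: components_coord_field tmap_id)

lemma coord_field_components [simp]:
  "c \<in> \<A> \<Longrightarrow> q \<in> dom_of c \<Longrightarrow> coord_field \<A> c (components \<A> c q \<xi>) q = \<xi>"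
  by (simp add: components_tmap coord_field_tmap tmap_chain tmap_id)

lemma coord_field_chart_at [simp]: "coord_field \<A> (chart_at \<A> q) v q = v"
  by (simp add: coord_field_tmap tmap_id)

lemma components_chart_at [simp]: "components \<A> (chart_at \<A> q) q v = v"
  by (simp add: components_tmap tmap_id)

lemma tmap_components:
  "c \<in> \<A> \<Longrightarrow> d \<in> \<A> \<Longrightarrow> q \<in> dom_of c \<Longrightarrow> q \<in> dom_of d \<Longrightarrow>
    tmap c d q (components \<A> c q \<xi>) = components \<A> d q \<xi>"
  by (simp add: components_tmap tmap_chain)

lemma coord_field_change:
  "c \<in> \<A> \<Longrightarrow> d \<in> \<A> \<Longrightarrow> q \<in> dom_of c \<Longrightarrow> q \<in> dom_of d \<Longrightarrow>
    coord_field \<A> d (tmap c d q v) q = coord_field \<A> c v q"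
  by (simp add: coord_field_tmap tmap_chain)

lemma linear_coord_field: "c \<in> \<A> \<Longrightarrow> q \<in> dom_of c \<Longrightarrow> linear (\<lambda>v. coord_field \<A> c v q)"
  by (simp add: coord_field_tmap[abs_def] tmap_linear)

lemma linear_components: "c \<in> \<A> \<Longrightarrow> q \<in> dom_of c \<Longrightarrow> linear (components \<A> c q)"
  using tmap_linear[of "chart_at \<A> q" c q] by (simp add: components_tmap[abs_def])

lemma coord_field_expansion:
  "c \<in> \<A> \<Longrightarrow> q \<in> dom_of c \<Longrightarrow> coord_field \<A> c v q = (\<Sum>i\<in>UNIV. v $ i *\<^sub>R coord_field \<A> c (axis i 1) q)"
  using linear_model_expansion[OF linear_coord_field] .

text \<open>\<open>dir_deriv\<close> differentiates in the preferred chart, so differentiability is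
  asked there; \<open>has_derivative_chart\<close> carries it to every chart around
  \<open>q\<close>.\<close>

definition diff_at :: "('a \<Rightarrow> real) \<Rightarrow> 'a \<Rightarrow> bool" where
  "diff_at f q \<longleftrightarrow> (f \<circ> param (chart_at \<A> q)) differentiable (at (coord (chart_at \<A> q) q))"

lemma has_derivative_chart_at:
  "diff_at f q \<Longrightarrow> ((f \<circ> param (chart_at \<A> q)) has_derivative dir_deriv \<A> f q) (at (coord (chart_at \<A> q) q))"
  by (simp add: diff_at_def frechet_derivative_works dir_deriv_def[abs_def])

lemma has_derivative_chart:
  assumes "c \<in> \<A>" "q \<in> dom_of c" "diff_at f q"
  shows "((f \<circ> param c) has_derivative (\<lambda>v. dir_deriv \<A> f q (coord_field \<A> c v q))) (at (coord c q))"
  using has_derivative_change_chart[OF assms(1,2) _ _ has_derivative_chart_at[OF assms(3)]]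
  by (simp add: coord_field_tmap)

lemma dir_deriv_eq:
  assumes "((f \<circ> param (chart_at \<A> q)) has_derivative f') (at (coord (chart_at \<A> q) q))"
  shows "dir_deriv \<A> f q \<xi> = f' \<xi>"
  using assms unfolding dir_deriv_def by (rule frechet_derivative_at_eq)

lemma dir_deriv_coord_field:
  "c \<in> \<A> \<Longrightarrow> q \<in> dom_of c \<Longrightarrow> diff_at f q \<Longrightarrow>
    dir_deriv \<A> f q (coord_field \<A> c v q) = frechet_derivative (f \<circ> param c) (at (coord c q)) v"
  by (rule frechet_derivative_at_eq[OF has_derivative_chart, symmetric])

lemma linear_dir_deriv: "diff_at f q \<Longrightarrow> linear (dir_deriv \<A> f q)"
  using has_derivative_chart_at has_derivative_linear by blast

lemma dir_deriv_const: "dir_deriv \<A> (\<lambda>_. k) q \<xi> = 0"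
  by (rule dir_deriv_eq) (simp add: o_def)

lemma dir_deriv_sum:
  assumes "\<And>i. i \<in> I \<Longrightarrow> diff_at (f i) q"
  shows "diff_at (\<lambda>q. \<Sum>i\<in>I. f i q) q"
    and "dir_deriv \<A> (\<lambda>q. \<Sum>i\<in>I. f i q) q \<xi> = (\<Sum>i\<in>I. dir_deriv \<A> (f i) q \<xi>)"
proof -
  have *: "(((\<lambda>q. \<Sum>i\<in>I. f i q) \<circ> param (chart_at \<A> q)) has_derivative
      (\<lambda>\<xi>. \<Sum>i\<in>I. dir_deriv \<A> (f i) q \<xi>)) (at (coord (chart_at \<A> q) q))"
    using has_derivative_sum[OF has_derivative_chart_at[OF assms]] by (simp add: o_def)
  then show "diff_at (\<lambda>q. \<Sum>i\<in>I. f i q) q" by (auto simp: diff_at_def differentiable_def)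
  show "dir_deriv \<A> (\<lambda>q. \<Sum>i\<in>I. f i q) q \<xi> = (\<Sum>i\<in>I. dir_deriv \<A> (f i) q \<xi>)"
    by (rule dir_deriv_eq[OF *])
qed

lemma dir_deriv_mult:
  assumes "diff_at f q" "diff_at h q"
  shows "diff_at (\<lambda>q. f q * h q) q"
    and "dir_deriv \<A> (\<lambda>q. f q * h q) q \<xi> = f q * dir_deriv \<A> h q \<xi> + dir_deriv \<A> f q \<xi> * h q"
proof -
  have *: "(((\<lambda>q. f q * h q) \<circ> param (chart_at \<A> q)) has_derivative
      (\<lambda>\<xi>. f q * dir_deriv \<A> h q \<xi> + dir_deriv \<A> f q \<xi> * h q)) (at (coord (chart_at \<A> q) q))"
    using has_derivative_mult[OF has_derivative_chart_at[OF assms(1)] has_derivative_chart_at[OF assms(2)]]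
    by (simp add: o_def param_coord)
  then show "diff_at (\<lambda>q. f q * h q) q" by (auto simp: diff_at_def differentiable_def)
  show "dir_deriv \<A> (\<lambda>q. f q * h q) q \<xi> = f q * dir_deriv \<A> h q \<xi> + dir_deriv \<A> f q \<xi> * h q"
    by (rule dir_deriv_eq[OF *])
qed

lemma dir_deriv_germ:
  assumes "open U" "q \<in> U" "\<And>r. r \<in> U \<Longrightarrow> f r = h r"
  shows "dir_deriv \<A> f q \<xi> = dir_deriv \<A> h q \<xi>"
  unfolding dir_deriv_def
  by (subst frechet_derivative_cong_open[of "coord (chart_at \<A> q) ` (dom_of (chart_at \<A> q) \<inter> U)" _ _ "h \<circ> param (chart_at \<A> q)"])
    (use assms in \<open>auto simp: open_coord_image param_coord\<close>)

lemma Ck_fun_on_diff_at: "Ck_fun_on \<A> (Suc k) U f \<Longrightarrow> q \<in> U \<Longrightarrow> diff_at f q"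
proof -
  assume f: "Ck_fun_on \<A> (Suc k) U f" and q: "q \<in> U"
  let ?c = "chart_at \<A> q"
  have "Ck_on (Suc k) (coord ?c ` (dom_of ?c \<inter> U)) (f \<circ> param ?c)"
    using f chart_at_in(1) unfolding Ck_fun_on_def by (rule bspec)
  then show ?thesis
    unfolding diff_at_def by (rule Ck_on_differentiable) (simp add: q)
qed

lemma smooth_fun_near_diff_at:
  assumes "smooth_fun_near \<A> q f" shows "diff_at f q"
proof -
  obtain U where "q \<in> U" "\<forall>k. Ck_fun_on \<A> k U f"
    using assms unfolding smooth_fun_near_def smooth_fun_on_def by metis
  then show ?thesis using Ck_fun_on_diff_at[of 0 U f q] by simp
qed

text \<open>One chart suffices, since every other local expression arises by composition with a
  smooth transition map.\<close>

lemma Ck_fun_on_from_chart: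
  assumes c: "c \<in> \<A>" and U: "open U" "U \<subseteq> dom_of c" and f: "Ck_on k (coord c ` U) (f \<circ> param c)"
  shows "Ck_fun_on \<A> k U f"
  unfolding Ck_fun_on_def
proof
  fix d assume d: "d \<in> \<A>"
  let ?S = "coord d ` (dom_of d \<inter> U)"
  have S: "open ?S" by (rule open_coord_image[OF d U(1)])
  have U_eq: "coord c ` U = coord c ` (dom_of c \<inter> U)" using U(2) by (simp add: Int_absorb1)
  have "Ck_on k ?S (\<lambda>y. (f \<circ> param c) ((coord c \<circ> param d) y))"
  proof (rule Ck_on_compose[OF S _ _ f])
    show "open (coord c ` U)" unfolding U_eq by (rule open_coord_image[OF c U(1)])
    show "(coord c \<circ> param d) ` ?S \<subseteq> coord c ` U" using param_coord[OF d] by (auto simp: image_iff)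
    show "Ck_on k ?S (coord c \<circ> param d)"
      by (rule Ck_on_subset[OF Cinf_onD[OF trans_Cinf[OF d c]]]) (use U in auto)
  qed
  then show "Ck_on k ?S (f \<circ> param d)"
    by (subst Ck_on_cong[OF S, of _ "\<lambda>y. (f \<circ> param c) ((coord c \<circ> param d) y)"])
      (use U param_coord[OF d] param_coord[OF c] in auto)
qed

lemma smooth_fun_on_from_chart:
  "c \<in> \<A> \<Longrightarrow> open U \<Longrightarrow> U \<subseteq> dom_of c \<Longrightarrow> Cinf_on (coord c ` U) (f \<circ> param c) \<Longrightarrow> smooth_fun_on \<A> U f"
  unfolding smooth_fun_on_def Cinf_on_def by (intro allI Ck_fun_on_from_chart) auto

lemma tmap_Cinf:
  assumes "c \<in> \<A>" "d \<in> \<A>"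
  shows "Cinf_on (coord c ` (dom_of c \<inter> dom_of d)) (\<lambda>y. tmap c d (param c y) v)"
proof -
  have "tmap c d (param c y) v = frechet_derivative (coord d \<circ> param c) (at y) v"
    if "y \<in> coord c ` (dom_of c \<inter> dom_of d)" for y
    using coord_param[OF assms(1) that] by (simp add: tmap_def)
  from Cinf_on_cong[OF open_coord_image[OF assms(1) open_dom[OF assms(2)]] this]
  show ?thesis
    using Cinf_on_frechet[OF trans_Cinf[OF assms]] by simp
qed

lemma smooth_fun_tmap:
  assumes c: "c \<in> \<A>" and d: "d \<in> \<A>"
  shows "smooth_fun_on \<A> (dom_of c \<inter> dom_of d) (\<lambda>q. tmap c d q v $ i)"
proof (rule smooth_fun_on_from_chart[OF c])
  show "open (dom_of c \<inter> dom_of d)" using c d by (simp add: open_dom open_Int)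
  show "Cinf_on (coord c ` (dom_of c \<inter> dom_of d)) ((\<lambda>q. tmap c d q v $ i) \<circ> param c)"
    unfolding o_def by (rule Cinf_on_nth[OF open_coord_image[OF c open_dom[OF d]] tmap_Cinf[OF c d]])
qed simp

text \<open>In another chart the components get multiplied by the Jacobian of the transition;
  \<open>R\<close> writes this out over the axes, leaving only sums and products of smooth
  functions.\<close>

lemma smooth_field_on_from_chart:
  assumes c: "c \<in> \<A>" and U: "open U" "U \<subseteq> dom_of c"
    and V: "Cinf_on (coord c ` U) (\<lambda>y. components \<A> c (param c y) (V (param c y)))"
  shows "smooth_field_on \<A> U V"
  unfolding smooth_field_on_def
proof
  fix d assume d: "d \<in> \<A>"
  let ?S = "coord d ` (dom_of d \<inter> U)"
  have S: "open ?S" by (rule open_coord_image[OF d U(1)])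
  have U_eq: "coord c ` U = coord c ` (dom_of c \<inter> U)" using U(2) by (simp add: Int_absorb1)
  have oc: "open (coord c ` U)" unfolding U_eq by (rule open_coord_image[OF c U(1)])
  have img: "(coord c \<circ> param d) ` ?S \<subseteq> coord c ` U" using param_coord[OF d] by auto
  have tr: "Cinf_on ?S (coord c \<circ> param d)"
    by (rule Cinf_on_subset[OF trans_Cinf[OF d c]]) (use U in auto)
  define R where "R y = (\<Sum>i\<in>UNIV.
      (\<lambda>z. components \<A> c (param c z) (V (param c z)) $ i) ((coord c \<circ> param d) y) *\<^sub>R
      (\<lambda>z. tmap c d (param c z) (axis i 1)) ((coord c \<circ> param d) y))" for y
  have "Cinf_on ?S R"
    unfolding R_def
  proof (intro Cinf_on_sum[OF S] Cinf_on_scaleR[OF S])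
    fix i
    show "Cinf_on ?S (\<lambda>y. (\<lambda>z. components \<A> c (param c z) (V (param c z)) $ i) ((coord c \<circ> param d) y))"
      by (rule Cinf_on_compose[OF S oc img Cinf_on_nth[OF oc V] tr])
    show "Cinf_on ?S (\<lambda>y. (\<lambda>z. tmap c d (param c z) (axis i 1)) ((coord c \<circ> param d) y))"
    proof (rule Cinf_on_compose[OF S _ _ tmap_Cinf[OF c d] tr])
      show "open (coord c ` (dom_of c \<inter> dom_of d))" by (rule open_coord_image[OF c open_dom[OF d]])
      show "(coord c \<circ> param d) ` ?S \<subseteq> coord c ` (dom_of c \<inter> dom_of d)"
        using param_coord[OF d] U by auto
    qed
  qed
  moreover have eq: "components \<A> d (param d y) (V (param d y)) = R y" if "y \<in> ?S" for y
  proof -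
    have q: "param d y \<in> dom_of d" "param d y \<in> dom_of c" using coord_param[OF d that] U by auto
    show ?thesis
      using linear_model_expansion[OF tmap_linear[OF c d q(2,1)],
          of "components \<A> c (param d y) (V (param d y))"]
      by (simp add: R_def param_coord[OF c q(2)] tmap_components[OF c d q(2,1)])
  qed
  ultimately show "Cinf_on ?S (\<lambda>y. components \<A> d (param d y) (V (param d y)))"
    using Cinf_on_cong[OF S eq] by simp
qed

lemma smooth_field_coord_field: "c \<in> \<A> \<Longrightarrow> smooth_field_on \<A> (dom_of c) (coord_field \<A> c v)"
proof (rule smooth_field_on_from_chart)
  assume c: "c \<in> \<A>"
  have "open (coord c ` dom_of c)" using chart[OF c] by (simp add: is_chart_def)
  moreover have "components \<A> c (param c y) (coord_field \<A> c v (param c y)) = v"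
    if "y \<in> coord c ` dom_of c" for y
    using that c by (auto simp: param_coord)
  from Cinf_on_cong[OF calculation this]
  show "Cinf_on (coord c ` dom_of c) (\<lambda>y. components \<A> c (param c y) (coord_field \<A> c v (param c y)))"
    by (simp add: Cinf_on_const)
qed (auto simp: open_dom)

lemma smooth_field_near_coord_field:
  "c \<in> \<A> \<Longrightarrow> q \<in> dom_of c \<Longrightarrow> smooth_field_near \<A> q (coord_field \<A> c v)"
  unfolding smooth_field_near_def using smooth_field_coord_field open_dom by blast

lemma smooth_field_on_continuous:
  assumes c: "c \<in> \<A>" and V: "smooth_field_on \<A> U V"
  shows "continuous_on (dom_of c \<inter> U) (\<lambda>q. components \<A> c q (V q))"
proof -
  have "continuous_on (coord c ` (dom_of c \<inter> U)) (\<lambda>y. components \<A> c (param c y) (V (param c y)))"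
    using V c unfolding smooth_field_on_def by (intro Cinf_on_continuous_on) auto
  from continuous_on_from_chart[OF c this] show ?thesis
    by (rule continuous_on_eq) (simp add: param_coord[OF c])
qed

lemma Ck_fun_on_continuous:
  assumes c: "c \<in> \<A>" and f: "Ck_fun_on \<A> k U f"
  shows "continuous_on (dom_of c \<inter> U) f"
proof -
  have "continuous_on (coord c ` (dom_of c \<inter> U)) (f \<circ> param c)"
    using f c unfolding Ck_fun_on_def by (intro Ck_on_imp_continuous_on) auto
  from continuous_on_from_chart[OF c this] show ?thesis
    by (rule continuous_on_eq) (simp add: param_coord[OF c])
qed

lemma Ck_fun_on_dir_deriv:
  assumes c: "c \<in> \<A>" and U: "open U" and f: "Ck_fun_on \<A> (Suc k) U f"
  shows "Ck_fun_on \<A> k (dom_of c \<inter> U) (\<lambda>q. dir_deriv \<A> f q (coord_field \<A> c v q))"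
proof (rule Ck_fun_on_from_chart[OF c])
  show "open (dom_of c \<inter> U)" using c U by (simp add: open_dom open_Int)
  have S: "open (coord c ` (dom_of c \<inter> U))" by (rule open_coord_image[OF c U])
  have "Ck_on (Suc k) (coord c ` (dom_of c \<inter> U)) (f \<circ> param c)"
    using f c by (simp only: Ck_fun_on_def)
  from Ck_on_frechet[OF this]
  show "Ck_on k (coord c ` (dom_of c \<inter> U)) ((\<lambda>q. dir_deriv \<A> f q (coord_field \<A> c v q)) \<circ> param c)"
    by (subst Ck_on_cong[OF S, of _ "\<lambda>y. frechet_derivative (f \<circ> param c) (at y) v"])
      (auto simp: param_coord[OF c] dir_deriv_coord_field[OF c _ Ck_fun_on_diff_at[OF f]])
qed simp

end

section \<open>The Hessian up to the boundary\<close>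

lemma boundary_nontrivial: "x \<in> closure S \<Longrightarrow> x \<notin> S \<Longrightarrow> at x within S \<noteq> bot"
  by (simp add: at_within_eq_bot_iff)

text \<open>A point of the closure outside \<open>S\<close> is reached through \<open>S\<close>: a
  strict bound for \<open>h\<close> near x survives the limit as a weak one, hence the margin
  \<epsilon> / 2.\<close>

lemma continuous_on_limit_extension:
  fixes e h :: "'a::topological_space \<Rightarrow> real"
  assumes lim: "\<And>x. x \<in> closure S \<Longrightarrow> x \<in> U \<Longrightarrow> (h \<longlongrightarrow> e x) (at x within S)"
    and eq: "\<And>x. x \<in> S \<Longrightarrow> x \<in> U \<Longrightarrow> h x = e x"
  shows "continuous_on (closure S \<inter> U) e"
  unfolding continuous_on_def
proof (intro ballI tendstoI)
  fix x \<epsilon> assume x: "x \<in> closure S \<inter> U" and \<epsilon>: "(\<epsilon>::real) > 0"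
  have "eventually (\<lambda>y. dist (h y) (e x) < \<epsilon> / 2) (at x within S)"
    using lim x \<epsilon> by (intro tendstoD) auto
  then obtain V where V: "open V" "x \<in> V"
    "\<And>y. y \<in> V \<Longrightarrow> y \<noteq> x \<Longrightarrow> y \<in> S \<Longrightarrow> dist (h y) (e x) < \<epsilon> / 2"
    unfolding eventually_at_topological by blast
  \<comment> \<open>The filter leaves out the point \<open>x\<close> itself, which is covered by
    \<open>eq\<close>.\<close>
  have hV: "dist (h y) (e x) < \<epsilon> / 2" if "y \<in> V" "y \<in> S" for y
  proof (cases "y = x")
    case True
    then have "h y = e x" using that x eq[of x] by simp
    then show ?thesis using \<epsilon> by simp
  qed (use V(3) that in blast)
  have "dist (e z) (e x) < \<epsilon>" if z: "z \<in> V" "z \<in> closure S \<inter> U" for z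
  proof (cases "z \<in> S")
    case True
    then have "dist (h z) (e x) < \<epsilon> / 2" "h z = e z" using hV[of z] eq[of z] z by simp_all
    then show ?thesis using \<epsilon> by simp
  next
    case False
    have "((\<lambda>y. dist (h y) (e x)) \<longlongrightarrow> dist (e z) (e x)) (at z within S)"
      using lim[of z] z by (intro tendsto_dist tendsto_const) simp
    moreover have "eventually (\<lambda>y. dist (h y) (e x) \<le> \<epsilon> / 2) (at z within S)"
      unfolding eventually_at_topological using V(1) z(1) less_imp_le[OF hV] by blast
    ultimately have "dist (e z) (e x) \<le> \<epsilon> / 2"
      using tendsto_upperbound boundary_nontrivial[of z S] False z(2) by (metis IntD1)
    then show ?thesis using \<epsilon> by simp
  qed
  then show "eventually (\<lambda>z. dist (e z) (e x) < \<epsilon>) (at x within closure S \<inter> U)"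
    unfolding eventually_at_topological using V(1,2) by blast
qed

lemma continuous_on_imp_tendsto_within:
  assumes "continuous_on U f" "open U" "x \<in> U" shows "(f \<longlongrightarrow> f x) (at x within S)"
proof -
  have "(f \<longlongrightarrow> f x) (at x)"
    using assms at_within_open[of x U] by (metis continuous_on_def)
  then show ?thesis by (rule tendsto_mono[OF at_le[OF subset_UNIV]])
qed

section \<open>Germs of smooth functions and fields\<close>

context smooth_manifold
begin

lemma smooth_fun_on_subset:
  assumes "smooth_fun_on \<A> U f" "V \<subseteq> U" shows "smooth_fun_on \<A> V f"
  unfolding smooth_fun_on_def Ck_fun_on_def
proof (intro allI ballI)
  fix k c assume "c \<in> \<A>"
  then have "Ck_on k (coord c ` (dom_of c \<inter> U)) (f \<circ> param c)"
    using assms(1) unfolding smooth_fun_on_def Ck_fun_on_def by blast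
  then show "Ck_on k (coord c ` (dom_of c \<inter> V)) (f \<circ> param c)"
    by (rule Ck_on_subset) (use assms(2) in auto)
qed

text \<open>Used for indicator functions, which make the connection local, and for the derivatives
  of coordinate functions along coordinate fields.\<close>

lemma smooth_fun_near_const_germ:
  assumes U: "open U" "p \<in> U" and f: "\<And>q. q \<in> U \<Longrightarrow> f q = k"
  shows "smooth_fun_near \<A> p f" and "dir_deriv \<A> f p v = 0"
proof -
  show "dir_deriv \<A> f p v = 0"
    using dir_deriv_germ[OF U f] dir_deriv_const by simp
  have "Ck_on m (coord c ` (dom_of c \<inter> U)) (f \<circ> param c)" if c: "c \<in> \<A>" for c m
  proof -
    have "(f \<circ> param c) y = k" if "y \<in> coord c ` (dom_of c \<inter> U)" for y
      using coord_param[OF c that] f by simp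
    then show ?thesis
      using Ck_on_cong[OF open_coord_image[OF c U(1)], of "f \<circ> param c" "\<lambda>_. k"]
      by (simp add: Ck_on_const)
  qed
  then show "smooth_fun_near \<A> p f"
    unfolding smooth_fun_near_def smooth_fun_on_def Ck_fun_on_def using U by blast
qed

lemma smooth_field_near_zero: "smooth_field_near \<A> p (\<lambda>_. 0)"
proof -
  have "Cinf_on (coord c ` (dom_of c \<inter> UNIV)) (\<lambda>y. components \<A> c (param c y) 0)" if c: "c \<in> \<A>" for c
  proof -
    have "components \<A> c (param c y) 0 = 0" if "y \<in> coord c ` (dom_of c \<inter> UNIV)" for y
      using coord_param[OF c that] linear_0[OF linear_components[OF c]] by simp
    then show ?thesis
      using Cinf_on_cong[OF open_coord_image[OF c open_UNIV],
          of "\<lambda>y. components \<A> c (param c y) 0" "\<lambda>_. 0"]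
      by (simp only: Cinf_on_const)
  qed
  then show ?thesis
    unfolding smooth_field_near_def smooth_field_on_def by blast
qed

lemma smooth_field_near_add_scaleR:
  assumes V: "smooth_field_near \<A> p V" and f: "smooth_fun_near \<A> p f" and W: "smooth_field_near \<A> p W"
  shows "smooth_field_near \<A> p (\<lambda>q. V q + f q *\<^sub>R W q)"
proof -
  obtain U1 where 1: "open U1" "p \<in> U1" "smooth_field_on \<A> U1 V"
    using V unfolding smooth_field_near_def by blast
  obtain U2 where 2: "open U2" "p \<in> U2" "smooth_fun_on \<A> U2 f"
    using f unfolding smooth_fun_near_def by blast
  obtain U3 where 3: "open U3" "p \<in> U3" "smooth_field_on \<A> U3 W"
    using W unfolding smooth_field_near_def by blast
  define U where "U = U1 \<inter> U2 \<inter> U3"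
  have U: "open U" "p \<in> U" "U \<subseteq> U1" "U \<subseteq> U2" "U \<subseteq> U3" using 1 2 3 by (auto simp: U_def)
  have "Cinf_on (coord c ` (dom_of c \<inter> U)) (\<lambda>y. components \<A> c (param c y) (V (param c y) + f (param c y) *\<^sub>R W (param c y)))"
    if c: "c \<in> \<A>" for c
  proof -
    let ?S = "coord c ` (dom_of c \<inter> U)"
    have S: "open ?S" by (rule open_coord_image[OF c U(1)])
    have a: "Cinf_on ?S (\<lambda>y. components \<A> c (param c y) (V (param c y)))"
      using bspec[OF 1(3)[unfolded smooth_field_on_def] c] by (rule Cinf_on_subset) (use U in auto)
    have b: "Cinf_on ?S (f \<circ> param c)"
      unfolding Cinf_on_def
      using smooth_fun_on_subset[OF 2(3) U(4)] c unfolding smooth_fun_on_def Ck_fun_on_def by blast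
    have d: "Cinf_on ?S (\<lambda>y. components \<A> c (param c y) (W (param c y)))"
      using bspec[OF 3(3)[unfolded smooth_field_on_def] c] by (rule Cinf_on_subset) (use U in auto)
    have sum: "Cinf_on ?S (\<lambda>y. components \<A> c (param c y) (V (param c y)) +
        (f \<circ> param c) y *\<^sub>R components \<A> c (param c y) (W (param c y)))"
      using a Cinf_on_scaleR[OF S b d] Ck_on_add[OF S] unfolding Cinf_on_def by blast
    have eq: "components \<A> c (param c y) (V (param c y) + f (param c y) *\<^sub>R W (param c y)) =
        components \<A> c (param c y) (V (param c y)) +
        (f \<circ> param c) y *\<^sub>R components \<A> c (param c y) (W (param c y))" if "y \<in> ?S" for y
      using linear_components[OF c, of "param c y"] coord_param[OF c that]
      by (simp add: linear_add linear_scale)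
    show ?thesis using Cinf_on_cong[OF S eq] sum by simp
  qed
  then have "smooth_field_on \<A> U (\<lambda>q. V q + f q *\<^sub>R W q)" unfolding smooth_field_on_def by blast
  then show ?thesis unfolding smooth_field_near_def using U(1,2) by blast
qed

lemma smooth_field_near_scaleR:
  "smooth_fun_near \<A> p f \<Longrightarrow> smooth_field_near \<A> p W \<Longrightarrow> smooth_field_near \<A> p (\<lambda>q. f q *\<^sub>R W q)"
  using smooth_field_near_add_scaleR[OF smooth_field_near_zero] by simp

lemma smooth_field_near_sum:
  assumes "\<And>i. i \<in> I \<Longrightarrow> smooth_fun_near \<A> p (f i)" "\<And>i. i \<in> I \<Longrightarrow> smooth_field_near \<A> p (W i)"
  shows "smooth_field_near \<A> p (\<lambda>q. \<Sum>i\<in>I. f i q *\<^sub>R W i q)"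
  using assms
proof (induction I rule: infinite_finite_induct)
  case (insert i I)
  have "smooth_field_near \<A> p (\<lambda>q. (\<Sum>i\<in>I. f i q *\<^sub>R W i q) + f i q *\<^sub>R W i q)"
    by (rule smooth_field_near_add_scaleR) (use insert in auto)
  then show ?case using insert.hyps by (simp add: add.commute)
qed (auto simp: smooth_field_near_zero)

lemma smooth_fun_near_tmap:
  "c \<in> \<A> \<Longrightarrow> d \<in> \<A> \<Longrightarrow> p \<in> dom_of c \<Longrightarrow> p \<in> dom_of d \<Longrightarrow> smooth_fun_near \<A> p (\<lambda>q. tmap c d q v $ i)"
  unfolding smooth_fun_near_def
  by (rule exI[of _ "dom_of c \<inter> dom_of d"]) (auto simp: open_dom open_Int smooth_fun_tmap)

lemma coord_field_expansion_change:
  assumes "c \<in> \<A>" "d \<in> \<A>" "q \<in> dom_of c" "q \<in> dom_of d"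
  shows "coord_field \<A> c w q = (\<Sum>i\<in>UNIV. tmap c d q w $ i *\<^sub>R coord_field \<A> d (axis i 1) q)"
  using coord_field_change[OF assms, of w] coord_field_expansion[OF assms(2,4), of "tmap c d q w"] by simp

lemma smooth_fun_coord:
  assumes c: "c \<in> \<A>" shows "smooth_fun_on \<A> (dom_of c) (\<lambda>q. coord c q $ i)"
proof (rule smooth_fun_on_from_chart[OF c open_dom[OF c]])
  have o: "open (coord c ` dom_of c)" using open_coord_image[OF c open_UNIV] by simp
  have "Cinf_on (coord c ` dom_of c) (\<lambda>y. y $ i)"
    by (intro Cinf_on_nth o) (simp add: Cinf_on_def Ck_on_id)
  moreover have "((\<lambda>q. coord c q $ i) \<circ> param c) y = y $ i" if "y \<in> coord c ` dom_of c" for y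
    using coord_param[OF c, of y UNIV] that by simp
  ultimately show "Cinf_on (coord c ` dom_of c) ((\<lambda>q. coord c q $ i) \<circ> param c)"
    using Cinf_on_cong[OF o, of "(\<lambda>q. coord c q $ i) \<circ> param c" "\<lambda>y. y $ i"] by simp
qed simp

lemma smooth_fun_near_coord:
  "c \<in> \<A> \<Longrightarrow> p \<in> dom_of c \<Longrightarrow> smooth_fun_near \<A> p (\<lambda>q. coord c q $ i)"
  unfolding smooth_fun_near_def using smooth_fun_coord open_dom by blast

text \<open>Coordinate functions are the test functions that recover a vector known only through its
  action on functions.\<close>

lemma dir_deriv_coord:
  assumes c: "c \<in> \<A>" "q \<in> dom_of c"
  shows "dir_deriv \<A> (\<lambda>q. coord c q $ i) q (coord_field \<A> c w q) = w $ i"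
proof -
  have "diff_at (\<lambda>q. coord c q $ i) q"
    by (rule smooth_fun_near_diff_at[OF smooth_fun_near_coord[OF c]])
  then have "dir_deriv \<A> (\<lambda>q. coord c q $ i) q (coord_field \<A> c w q) =
      frechet_derivative ((\<lambda>q. coord c q $ i) \<circ> param c) (at (coord c q)) w"
    by (rule dir_deriv_coord_field[OF c])
  also have "\<dots> = frechet_derivative (\<lambda>y. y $ i) (at (coord c q)) w"
    by (subst frechet_derivative_cong_open[of "coord c ` (dom_of c \<inter> UNIV)" _ _ "\<lambda>y. y $ i"])
      (use c in \<open>auto simp: param_coord open_coord_image[OF c(1) open_UNIV, simplified]\<close>)
  also have "\<dots> = w $ i"
    by (rule frechet_derivative_at_eq) (intro bounded_linear_imp_has_derivative bounded_linear_vec_nth)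
  finally show ?thesis .
qed

end

section \<open>Locality and symmetry of the connection\<close>

locale gromov_levi_civita =
  fixes X :: "('a::topological_space, 'n::finite) gromov"
    and D :: "'a \<Rightarrow> 'n model \<Rightarrow> ('a \<Rightarrow> 'n model) \<Rightarrow> 'n model"
  assumes gromov: "gromov_manifold X" and levi_civita: "levi_civita X D"
begin

sublocale smooth_manifold "atlas X"
  by standard (use gromov in \<open>simp add: gromov_manifold_def\<close>)

abbreviation cf :: "('a, 'n) chart \<Rightarrow> 'n model \<Rightarrow> 'a \<Rightarrow> 'n model" where
  "cf \<equiv> coord_field (atlas X)"

lemma conn: "affine_connection (atlas X) D"
  using levi_civita by (simp add: levi_civita_def)

lemma linear_D: "smooth_field_near (atlas X) p W \<Longrightarrow> linear (\<lambda>v. D p v W)"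
  using conn[unfolded affine_connection_def, THEN conjunct1] by simp

lemma D_add: "smooth_field_near (atlas X) p V \<Longrightarrow> smooth_field_near (atlas X) p W \<Longrightarrow>
    D p v (\<lambda>q. V q + W q) = D p v V + D p v W"
  using conn[unfolded affine_connection_def, THEN conjunct2, THEN conjunct1] by simp

lemma D_leibniz: "smooth_fun_near (atlas X) p f \<Longrightarrow> smooth_field_near (atlas X) p W \<Longrightarrow>
    D p v (\<lambda>q. f q *\<^sub>R W q) = dir_deriv (atlas X) f p v *\<^sub>R W p + f p *\<^sub>R D p v W"
  using conn[unfolded affine_connection_def, THEN conjunct2, THEN conjunct2, THEN conjunct1] by simp

lemma D_smooth: "open U \<Longrightarrow> smooth_field_on (atlas X) U V \<Longrightarrow> smooth_field_on (atlas X) U W \<Longrightarrow>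
    smooth_field_on (atlas X) U (\<lambda>q. D q (V q) W)"
  using conn[unfolded affine_connection_def, THEN conjunct2, THEN conjunct2, THEN conjunct2] by simp

text \<open>Locality: the indicator function of a neighbourhood of \<open>p\<close> is smooth near \<open>p\<close>.\<close>

lemma D_germ:
  assumes V: "smooth_field_near (atlas X) p V" and W: "smooth_field_near (atlas X) p W"
    and U: "open U" "p \<in> U" "\<And>q. q \<in> U \<Longrightarrow> V q = W q"
  shows "D p v V = D p v W"
proof -
  define f where "f q = (if q \<in> U then 1 else 0 :: real)" for q
  have f: "smooth_fun_near (atlas X) p f" "dir_deriv (atlas X) f p v = 0" "f p = 1"
    using smooth_fun_near_const_germ[OF U(1,2), of f 1] U by (auto simp: f_def)
  have "(\<lambda>q. f q *\<^sub>R V q) = (\<lambda>q. f q *\<^sub>R W q)" using U(3) by (auto simp: f_def)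
  then show ?thesis
    using D_leibniz[OF f(1) V, of v] D_leibniz[OF f(1) W, of v] f(2,3) by simp
qed

lemma D_zero: "D p v (\<lambda>_. 0) = 0"
  using D_leibniz[OF smooth_fun_near_const_germ(1)[of UNIV p "\<lambda>_. 0" 0] smooth_field_near_zero, of v]
    dir_deriv_const[of 0] by simp

lemma D_sum:
  assumes "\<And>i. i \<in> I \<Longrightarrow> smooth_fun_near (atlas X) p (f i)"
    "\<And>i. i \<in> I \<Longrightarrow> smooth_field_near (atlas X) p (W i)"
  shows "D p v (\<lambda>q. \<Sum>i\<in>I. f i q *\<^sub>R W i q) =
    (\<Sum>i\<in>I. dir_deriv (atlas X) (f i) p v *\<^sub>R W i p + f i p *\<^sub>R D p v (W i))"
  using assms
proof (induction I rule: infinite_finite_induct)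
  case (insert i I)
  have "D p v (\<lambda>q. f i q *\<^sub>R W i q + (\<Sum>i\<in>I. f i q *\<^sub>R W i q)) =
      D p v (\<lambda>q. f i q *\<^sub>R W i q) + D p v (\<lambda>q. \<Sum>i\<in>I. f i q *\<^sub>R W i q)"
    by (rule D_add) (use insert.prems in \<open>auto intro: smooth_field_near_scaleR smooth_field_near_sum\<close>)
  then show ?case using insert by (simp add: D_leibniz)
qed (auto simp: D_zero)

text \<open>Symmetry of the Christoffel symbols. Torsion-freeness is tested on coordinate functions;
  their derivatives along coordinate fields are constant, so the second derivatives on its
  right-hand side vanish.\<close>

lemma D_coord_field_symmetric:
  assumes c: "c \<in> atlas X" and p: "p \<in> dom_of c"
  shows "D p (cf c v p) (cf c w) = D p (cf c w p) (cf c v)"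
proof -
  let ?\<xi> = "D p (cf c v p) (cf c w) - D p (cf c w p) (cf c v)"
  have "components (atlas X) c p ?\<xi> $ i = 0" for i
  proof -
    let ?f = "\<lambda>q. coord c q $ i"
    have d0: "dir_deriv (atlas X) (\<lambda>q. dir_deriv (atlas X) ?f q (cf c w q)) p \<eta> = 0" for w \<eta>
      by (rule smooth_fun_near_const_germ(2)[OF open_dom[OF c] p]) (rule dir_deriv_coord[OF c])
    have "torsion_free (atlas X) D" using levi_civita by (simp add: levi_civita_def)
    then have "dir_deriv (atlas X) ?f p ?\<xi> =
        dir_deriv (atlas X) (\<lambda>q. dir_deriv (atlas X) ?f q (cf c w q)) p (cf c v p) -
        dir_deriv (atlas X) (\<lambda>q. dir_deriv (atlas X) ?f q (cf c v q)) p (cf c w p)"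
      unfolding torsion_free_def
      by (elim allE impE) (rule smooth_field_near_coord_field[OF c p] smooth_fun_near_coord[OF c p] | assumption)+
    then have "dir_deriv (atlas X) ?f p ?\<xi> = 0" by (simp only: d0)
    then show ?thesis
      using dir_deriv_coord[OF c p, of i "components (atlas X) c p ?\<xi>"] by (simp add: c p)
  qed
  then have "components (atlas X) c p ?\<xi> = 0" by (simp add: vec_eq_iff)
  then have "?\<xi> = cf c 0 p" using coord_field_components[OF c p, of ?\<xi>] by simp
  then show ?thesis using linear_0[OF linear_coord_field[OF c p]] by simp
qed

end

section \<open>The Hessian at interior points\<close>

context gromov_levi_civita
begin

abbreviation dderiv :: "('a \<Rightarrow> real) \<Rightarrow> 'a \<Rightarrow> 'n model \<Rightarrow> real" where
  "dderiv \<equiv> dir_deriv (atlas X)"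

lemma hess_form_alt:
  "hess_form X D u p \<xi> \<eta> = dderiv (\<lambda>q. dderiv u q (cf (chart_at (atlas X) p) \<eta> q)) p \<xi>
     - dderiv u p (D p \<xi> (cf (chart_at (atlas X) p) \<eta>))"
  by (simp add: hess_form_def Let_def)

lemma continuous_components_D:
  assumes c: "c \<in> atlas X"
  shows "continuous_on (dom_of c) (\<lambda>q. components (atlas X) c q (D q (cf c v q) (cf c w)))"
proof -
  have "smooth_field_on (atlas X) (dom_of c) (\<lambda>q. D q (cf c v q) (cf c w))"
    by (intro D_smooth open_dom smooth_field_coord_field c)
  from smooth_field_on_continuous[OF c this] show ?thesis by simp
qed

context
  fixes \<Omega> u
  assumes \<Omega>: "open \<Omega>" and u: "Ck_fun_on (atlas X) 2 \<Omega> u"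
begin

lemma diff_at_u: "p \<in> \<Omega> \<Longrightarrow> diff_at u p"
  using Ck_fun_on_diff_at[of 1 \<Omega> u p] u by (simp only: numeral_2_eq_2 One_nat_def)

lemma Ck_fun_first_derivative:
  "c \<in> atlas X \<Longrightarrow> Ck_fun_on (atlas X) (Suc 0) (dom_of c \<inter> \<Omega>) (\<lambda>q. dderiv u q (cf c v q))"
  using Ck_fun_on_dir_deriv[OF _ \<Omega>, of c "Suc 0" u v] u by (simp only: numeral_2_eq_2)

lemma diff_at_first_derivative:
  "c \<in> atlas X \<Longrightarrow> p \<in> dom_of c \<Longrightarrow> p \<in> \<Omega> \<Longrightarrow> diff_at (\<lambda>q. dderiv u q (cf c v q)) p"
  using Ck_fun_on_diff_at[OF Ck_fun_first_derivative, of c p v] by simp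

text \<open>Expanding one coordinate field in another chart creates derivatives of the coefficients
  in both terms. They cancel, which makes the Hessian tensorial in its second slot.\<close>

lemma hess_expansion:
  assumes c: "c \<in> atlas X" "p \<in> dom_of c" and d: "d \<in> atlas X" "p \<in> dom_of d" and p: "p \<in> \<Omega>"
  shows "dderiv (\<lambda>q. dderiv u q (cf c w q)) p \<xi> - dderiv u p (D p \<xi> (cf c w)) =
    (\<Sum>i\<in>UNIV. tmap c d p w $ i *
      (dderiv (\<lambda>q. dderiv u q (cf d (axis i 1) q)) p \<xi> - dderiv u p (D p \<xi> (cf d (axis i 1)))))"
proof -
  define a where "a i q = tmap c d q w $ i" for i q
  define E where "E i = cf d (axis i 1)" for i :: "'n + 'n"
  have a_smooth: "smooth_fun_near (atlas X) p (a i)" for i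
    unfolding a_def[abs_def] by (rule smooth_fun_near_tmap[OF c(1) d(1) c(2) d(2)])
  have a_diff: "diff_at (a i) p" for i by (rule smooth_fun_near_diff_at[OF a_smooth])
  have E_smooth: "smooth_field_near (atlas X) p (E i)" for i
    unfolding E_def by (rule smooth_field_near_coord_field[OF d])
  have E_diff: "diff_at (\<lambda>q. dderiv u q (E i q)) p" for i
    unfolding E_def by (rule diff_at_first_derivative[OF d p])
  have lin: "linear (dderiv u q)" if "q \<in> \<Omega>" for q by (rule linear_dir_deriv[OF diff_at_u[OF that]])
  let ?U = "dom_of c \<inter> dom_of d \<inter> \<Omega>"
  have U: "open ?U" "p \<in> ?U" using c d p \<Omega> by (auto simp: open_dom open_Int)
  have cw: "cf c w q = (\<Sum>i\<in>UNIV. a i q *\<^sub>R E i q)" if "q \<in> ?U" for q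
    unfolding a_def E_def using that c d by (intro coord_field_expansion_change) auto
  have "dderiv u q (cf c w q) = (\<Sum>i\<in>UNIV. a i q * dderiv u q (E i q))" if "q \<in> ?U" for q
    using lin[of q] that by (simp add: cw[OF that] linear_sum linear_scale)
  then have "dderiv (\<lambda>q. dderiv u q (cf c w q)) p \<xi> = dderiv (\<lambda>q. \<Sum>i\<in>UNIV. a i q * dderiv u q (E i q)) p \<xi>"
    by (rule dir_deriv_germ[OF U])
  also have "\<dots> = (\<Sum>i\<in>UNIV. a i p * dderiv (\<lambda>q. dderiv u q (E i q)) p \<xi> + dderiv (a i) p \<xi> * dderiv u p (E i p))"
    using dir_deriv_sum(2)[of UNIV "\<lambda>i q. a i q * dderiv u q (E i q)" p \<xi>]
      dir_deriv_mult[OF a_diff E_diff] by simp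
  finally have 1: "dderiv (\<lambda>q. dderiv u q (cf c w q)) p \<xi> =
      (\<Sum>i\<in>UNIV. a i p * dderiv (\<lambda>q. dderiv u q (E i q)) p \<xi> + dderiv (a i) p \<xi> * dderiv u p (E i p))" .
  have "D p \<xi> (cf c w) = D p \<xi> (\<lambda>q. \<Sum>i\<in>UNIV. a i q *\<^sub>R E i q)"
    by (rule D_germ[OF smooth_field_near_coord_field[OF c] smooth_field_near_sum[OF a_smooth E_smooth] U cw])
  also have "\<dots> = (\<Sum>i\<in>UNIV. dderiv (a i) p \<xi> *\<^sub>R E i p + a i p *\<^sub>R D p \<xi> (E i))"
    by (rule D_sum[OF a_smooth E_smooth])
  finally have "dderiv u p (D p \<xi> (cf c w)) =
      (\<Sum>i\<in>UNIV. dderiv (a i) p \<xi> * dderiv u p (E i p) + a i p * dderiv u p (D p \<xi> (E i)))"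
    using lin[OF p] by (simp add: linear_sum linear_add linear_scale)
  then show ?thesis
    unfolding 1 a_def[symmetric] E_def[symmetric] by (simp add: sum_subtractf[symmetric] algebra_simps)
qed

text \<open>The definition extends the second vector by means of the preferred chart at
  \<open>p\<close>. Expanding that extension and the one from \<open>c\<close> in the same frame
  shows that they agree, so that one fixed chart can be used at all nearby points.\<close>

lemma hess_form_chart:
  assumes c: "c \<in> atlas X" "p \<in> dom_of c" and p: "p \<in> \<Omega>"
  shows "hess_form X D u p \<xi> (cf c w p) =
    dderiv (\<lambda>q. dderiv u q (cf c w q)) p \<xi> - dderiv u p (D p \<xi> (cf c w))"
proof -
  let ?c = "chart_at (atlas X) p"
  have eq: "tmap ?c ?c p (cf c w p) = tmap c ?c p w"
    by (simp add: tmap_id coord_field_tmap)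
  show ?thesis
    unfolding hess_form_alt
    by (rule trans[OF hess_expansion[OF chart_at_in chart_at_in p, of "cf c w p", unfolded eq]
          hess_expansion[OF c chart_at_in p, symmetric]])
qed

lemma hess_form_linear_left:
  assumes p: "p \<in> \<Omega>"
  shows "linear (\<lambda>\<xi>. hess_form X D u p \<xi> \<eta>)"
proof -
  let ?c = "chart_at (atlas X) p"
  have 1: "linear (dderiv (\<lambda>q. dderiv u q (cf ?c \<eta> q)) p)"
    by (intro linear_dir_deriv diff_at_first_derivative chart_at_in p)
  have "linear (\<lambda>\<xi>. D p \<xi> (cf ?c \<eta>))"
    by (intro linear_D smooth_field_near_coord_field chart_at_in)
  from linear_compose[OF this linear_dir_deriv[OF diff_at_u[OF p]]]
  have 2: "linear (\<lambda>\<xi>. dderiv u p (D p \<xi> (cf ?c \<eta>)))" by (simp add: o_def)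
  show ?thesis
    unfolding hess_form_alt using linear_compose_sub[OF 1 2] by simp
qed

text \<open>Schwarz settles the second derivatives, symmetry of the Christoffel symbols the
  correction term.\<close>

lemma hess_form_sym:
  assumes p: "p \<in> \<Omega>"
  shows "hess_form X D u p \<xi> \<eta> = hess_form X D u p \<eta> \<xi>"
proof -
  let ?c = "chart_at (atlas X) p"
  let ?f = "u \<circ> param ?c"
  have S: "open (coord ?c ` (dom_of ?c \<inter> \<Omega>))" "coord ?c p \<in> coord ?c ` (dom_of ?c \<inter> \<Omega>)"
    using p by (auto simp: open_coord_image \<Omega>)
  have f: "Ck_on 2 (coord ?c ` (dom_of ?c \<inter> \<Omega>)) ?f"
    using u chart_at_in(1) unfolding Ck_fun_on_def by (rule bspec)
  have second: "dderiv (\<lambda>q. dderiv u q (cf ?c w q)) p v =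
      frechet_derivative (\<lambda>y. frechet_derivative ?f (at y) w) (at (coord ?c p)) v" for v w
  proof -
    have "dderiv (\<lambda>q. dderiv u q (cf ?c w q)) p (cf ?c v p) =
        frechet_derivative ((\<lambda>q. dderiv u q (cf ?c w q)) \<circ> param ?c) (at (coord ?c p)) v"
      by (intro dir_deriv_coord_field diff_at_first_derivative chart_at_in p)
    also have "frechet_derivative ((\<lambda>q. dderiv u q (cf ?c w q)) \<circ> param ?c) (at (coord ?c p)) =
        frechet_derivative (\<lambda>y. frechet_derivative ?f (at y) w) (at (coord ?c p))"
      by (rule frechet_derivative_cong_open[OF S])
        (auto simp: param_coord dir_deriv_coord_field diff_at_u)
    finally show ?thesis by simp
  qed
  have "D p \<xi> (cf ?c \<eta>) = D p \<eta> (cf ?c \<xi>)"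
    using D_coord_field_symmetric[OF chart_at_in, of p \<xi> \<eta>] by simp
  then show ?thesis
    unfolding hess_form_alt second Ck_on_2_symmetric[OF S f, of \<xi> \<eta>] by (simp only:)
qed

lemma hess_form_linear_right:
  assumes p: "p \<in> \<Omega>"
  shows "linear (\<lambda>\<eta>. hess_form X D u p \<xi> \<eta>)"
proof -
  have "(\<lambda>\<eta>. hess_form X D u p \<xi> \<eta>) = (\<lambda>\<eta>. hess_form X D u p \<eta> \<xi>)"
    by (rule ext) (rule hess_form_sym[OF p])
  then show ?thesis using hess_form_linear_left[OF p, of \<xi>] by (simp only:)
qed

lemma hess_form_expansion:
  assumes c: "c \<in> atlas X" "p \<in> dom_of c" and d: "d \<in> atlas X" "p \<in> dom_of d" and p: "p \<in> \<Omega>"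
  shows "hess_form X D u p (cf c v p) (cf c w p) =
    (\<Sum>i\<in>UNIV. \<Sum>j\<in>UNIV. tmap c d p v $ i * (tmap c d p w $ j *
      hess_form X D u p (cf d (axis i 1) p) (cf d (axis j 1) p)))"
proof -
  have L: "hess_form X D u p (\<Sum>i\<in>UNIV. a i *\<^sub>R x i) \<eta> = (\<Sum>i\<in>UNIV. a i * hess_form X D u p (x i) \<eta>)"
    for a and x :: "'n + 'n \<Rightarrow> 'n model" and \<eta>
    by (simp add: linear_sum[OF hess_form_linear_left[OF p]] linear_scale[OF hess_form_linear_left[OF p]])
  have R: "hess_form X D u p \<xi> (\<Sum>i\<in>UNIV. a i *\<^sub>R x i) = (\<Sum>i\<in>UNIV. a i * hess_form X D u p \<xi> (x i))"
    for a and x :: "'n + 'n \<Rightarrow> 'n model" and \<xi>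
    by (simp add: linear_sum[OF hess_form_linear_right[OF p]] linear_scale[OF hess_form_linear_right[OF p]])
  show ?thesis
    unfolding coord_field_expansion_change[OF c(1) d(1) c(2) d(2)] L R
    by (simp add: sum_distrib_left, subst sum.swap, simp add: mult.left_commute)
qed

text \<open>Splits the correction term into components of the connection and first derivatives of
  \<open>u\<close> along fixed coordinate fields, the form in which limits at the boundary are
  given.\<close>

lemma hess_form_chart_components:
  assumes c: "c \<in> atlas X" "q \<in> dom_of c" and q: "q \<in> \<Omega>"
  shows "hess_form X D u q (cf c v q) (cf c w q) =
    dderiv (\<lambda>r. dderiv u r (cf c w r)) q (cf c v q) -
    (\<Sum>i\<in>UNIV. components (atlas X) c q (D q (cf c v q) (cf c w)) $ i * dderiv u q (cf c (axis i 1) q))"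
proof -
  have "D q (cf c v q) (cf c w) = (\<Sum>i\<in>UNIV.
      components (atlas X) c q (D q (cf c v q) (cf c w)) $ i *\<^sub>R cf c (axis i 1) q)"
    using coord_field_expansion[OF c, of "components (atlas X) c q (D q (cf c v q) (cf c w))"]
    unfolding coord_field_components[OF c] .
  then have "dderiv u q (D q (cf c v q) (cf c w)) = dderiv u q (\<Sum>i\<in>UNIV.
      components (atlas X) c q (D q (cf c v q) (cf c w)) $ i *\<^sub>R cf c (axis i 1) q)"
    by (rule arg_cong)
  also have "\<dots> = (\<Sum>i\<in>UNIV. components (atlas X) c q (D q (cf c v q) (cf c w)) $ i * dderiv u q (cf c (axis i 1) q))"
    using linear_dir_deriv[OF diff_at_u[OF q]] by (simp add: linear_sum linear_scale)
  finally show ?thesis by (simp add: hess_form_chart[OF c q])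
qed

lemma hess_form_continuous:
  assumes c: "c \<in> atlas X"
  shows "continuous_on (dom_of c \<inter> \<Omega>) (\<lambda>q. hess_form X D u q (cf c v q) (cf c w q))"
proof -
  have o: "open (dom_of c \<inter> \<Omega>)" using c \<Omega> by (simp add: open_dom open_Int)
  have 1: "continuous_on (dom_of c \<inter> \<Omega>) (\<lambda>q. dderiv u q (cf c v q))" for v
    using Ck_fun_on_continuous[OF c Ck_fun_first_derivative[OF c]] by (simp add: Int_assoc[symmetric])
  have 2: "continuous_on (dom_of c \<inter> \<Omega>) (\<lambda>q. dderiv (\<lambda>r. dderiv u r (cf c w r)) q (cf c v q))"
    using Ck_fun_on_continuous[OF c Ck_fun_on_dir_deriv[OF c o Ck_fun_first_derivative[OF c]]]
    by (simp add: Int_assoc[symmetric])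
  have 3: "continuous_on (dom_of c \<inter> \<Omega>) (\<lambda>q. components (atlas X) c q (D q (cf c v q) (cf c w)) $ i)" for i
    by (intro continuous_intros continuous_on_subset[OF continuous_components_D[OF c]]) auto
  have "continuous_on (dom_of c \<inter> \<Omega>) (\<lambda>q. dderiv (\<lambda>r. dderiv u r (cf c w r)) q (cf c v q) -
      (\<Sum>i\<in>UNIV. components (atlas X) c q (D q (cf c v q) (cf c w)) $ i * dderiv u q (cf c (axis i 1) q)))"
    by (intro continuous_intros 1 2 3)
  then show ?thesis
    by (rule continuous_on_eq) (simp add: hess_form_chart_components[OF c])
qed

end

end

section \<open>Limits of the Hessian at the boundary\<close>

context gromov_levi_civita
begin

context
  fixes \<Omega> u
  assumes \<Omega>: "open \<Omega>" and u: "C2_on_closure (atlas X) \<Omega> u"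
begin

lemma u_C2: "Ck_fun_on (atlas X) 2 \<Omega> u"
  using u unfolding C2_on_closure_def by (elim conjE)

lemma eventually_in_domain:
  "c \<in> atlas X \<Longrightarrow> x \<in> dom_of c \<Longrightarrow> eventually (\<lambda>q. q \<in> dom_of c \<and> q \<in> \<Omega>) (at x within \<Omega>)"
  unfolding eventually_at_topological by (rule exI[of _ "dom_of c"]) (simp add: open_dom)

text \<open>The connection is smooth across the boundary, so its components converge by continuity;
  the derivatives of \<open>u\<close> converge by \<open>C2_on_closure\<close>.\<close>

lemma hess_form_limit_exists:
  assumes c: "c \<in> atlas X" "x \<in> dom_of c" and x: "x \<in> closure \<Omega>"
  shows "\<exists>l. ((\<lambda>q. hess_form X D u q (cf c v q) (cf c w q)) \<longlongrightarrow> l) (at x within \<Omega>)"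
proof -
  have C: "\<forall>c\<in>atlas X. \<forall>x\<in>closure \<Omega> \<inter> dom_of c. \<forall>v w.
      (\<exists>l. ((\<lambda>q. dderiv u q (cf c v q)) \<longlongrightarrow> l) (at x within \<Omega>)) \<and>
      (\<exists>l. ((\<lambda>q. dderiv (\<lambda>r. dderiv u r (cf c w r)) q (cf c v q)) \<longlongrightarrow> l) (at x within \<Omega>))"
    using u unfolding C2_on_closure_def by (elim conjE)
  have "x \<in> closure \<Omega> \<inter> dom_of c" using x c by simp
  note C' = bspec[OF bspec[OF C c(1)] this, rule_format]
  have lims: "\<exists>l. ((\<lambda>q. dderiv u q (cf c v q)) \<longlongrightarrow> l) (at x within \<Omega>)"
    "\<exists>l. ((\<lambda>q. dderiv (\<lambda>r. dderiv u r (cf c w r)) q (cf c v q)) \<longlongrightarrow> l) (at x within \<Omega>)" for v w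
    by (rule C'[THEN conjunct1], rule C'[THEN conjunct2])
  have "\<forall>v. \<exists>l. ((\<lambda>q. dderiv u q (cf c v q)) \<longlongrightarrow> l) (at x within \<Omega>)"
    using lims(1) by (rule allI)
  from choice[OF this] obtain m where
    m: "\<And>v. ((\<lambda>q. dderiv u q (cf c v q)) \<longlongrightarrow> m v) (at x within \<Omega>)" by blast
  obtain l where l: "((\<lambda>q. dderiv (\<lambda>r. dderiv u r (cf c w r)) q (cf c v q)) \<longlongrightarrow> l) (at x within \<Omega>)"
    using lims(2) by blast
  have b: "((\<lambda>q. components (atlas X) c q (D q (cf c v q) (cf c w)) $ i) \<longlongrightarrow>
      components (atlas X) c x (D x (cf c v x) (cf c w)) $ i) (at x within \<Omega>)" for i
    by (intro tendsto_vec_nth continuous_on_imp_tendsto_within[OF continuous_components_D[OF c(1)] open_dom[OF c(1)] c(2)])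
  have "((\<lambda>q. dderiv (\<lambda>r. dderiv u r (cf c w r)) q (cf c v q) -
      (\<Sum>i\<in>UNIV. components (atlas X) c q (D q (cf c v q) (cf c w)) $ i * dderiv u q (cf c (axis i 1) q)))
    \<longlongrightarrow> l - (\<Sum>i\<in>UNIV. components (atlas X) c x (D x (cf c v x) (cf c w)) $ i * m (axis i 1))) (at x within \<Omega>)"
    by (intro tendsto_intros l b m)
  moreover have "eventually (\<lambda>q. dderiv (\<lambda>r. dderiv u r (cf c w r)) q (cf c v q) -
      (\<Sum>i\<in>UNIV. components (atlas X) c q (D q (cf c v q) (cf c w)) $ i * dderiv u q (cf c (axis i 1) q)) =
      hess_form X D u q (cf c v q) (cf c w q)) (at x within \<Omega>)"
    using eventually_in_domain[OF c]
    by eventually_elim (simp add: hess_form_chart_components[OF \<Omega> u_C2 c(1)])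
  ultimately show ?thesis by (intro exI) (rule Lim_transform_eventually)
qed

text \<open>\<open>hess_form_closure\<close> takes its limit in the preferred chart at
  \<open>x\<close> only. The coefficients of a change of chart are continuous, so limits in any
  other chart exist and transform by the coefficients at \<open>x\<close>. The matrix
  \<open>L\<close> is symmetric as a limit of symmetric ones.\<close>

lemma hess_form_boundary_limit:
  assumes x: "x \<in> closure \<Omega>" and False: "x \<notin> \<Omega>"
  obtains L where "\<And>i j. L i j = L j i"
    "\<And>v w. hess_form_closure X D \<Omega> u x v w = (\<Sum>i\<in>UNIV. \<Sum>j\<in>UNIV. v $ i * (w $ j * L i j))"
    "\<And>c v w. c \<in> atlas X \<Longrightarrow> x \<in> dom_of c \<Longrightarrow>
      ((\<lambda>q. hess_form X D u q (cf c v q) (cf c w q)) \<longlongrightarrow>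
        hess_form_closure X D \<Omega> u x (cf c v x) (cf c w x)) (at x within \<Omega>)"
proof -
  let ?F = "at x within \<Omega>"
  let ?d = "chart_at (atlas X) x"
  have F: "?F \<noteq> bot" by (rule boundary_nontrivial[OF x False])
  have "\<forall>i j. \<exists>l. ((\<lambda>q. hess_form X D u q (cf ?d (axis i 1) q) (cf ?d (axis j 1) q)) \<longlongrightarrow> l) ?F"
    by (intro allI hess_form_limit_exists x chart_at_in)
  then obtain L where L: "\<And>i j. ((\<lambda>q. hess_form X D u q (cf ?d (axis i 1) q) (cf ?d (axis j 1) q)) \<longlongrightarrow> L i j) ?F"
    by metis
  have L_sym: "L i j = L j i" for i j
  proof (rule tendsto_unique[OF F L])
    show "((\<lambda>q. hess_form X D u q (cf ?d (axis i 1) q) (cf ?d (axis j 1) q)) \<longlongrightarrow> L j i) ?F"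
      by (rule Lim_transform_eventually[OF L[of j i]],
          rule eventually_mono[OF eventually_in_domain[OF chart_at_in]])
        (rule hess_form_sym[OF \<Omega> u_C2], simp)
  qed
  have lim: "((\<lambda>q. hess_form X D u q (cf c v q) (cf c w q)) \<longlongrightarrow>
      (\<Sum>i\<in>UNIV. \<Sum>j\<in>UNIV. tmap c ?d x v $ i * (tmap c ?d x w $ j * L i j))) ?F"
    if c: "c \<in> atlas X" "x \<in> dom_of c" for c v w
  proof -
    have t: "((\<lambda>q. tmap c ?d q v $ i) \<longlongrightarrow> tmap c ?d x v $ i) ?F" for v i
    proof -
      have "continuous_on (dom_of c \<inter> dom_of ?d) (\<lambda>q. tmap c ?d q v $ i)"
        using Ck_fun_on_continuous[OF c(1), of 0 "dom_of c \<inter> dom_of ?d"]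
          smooth_fun_tmap[OF c(1) chart_at_in(1)] unfolding smooth_fun_on_def
        by (simp add: Int_assoc[symmetric])
      then show ?thesis
        by (rule continuous_on_imp_tendsto_within) (use c in \<open>auto simp: open_dom open_Int\<close>)
    qed
    have "((\<lambda>q. \<Sum>i\<in>UNIV. \<Sum>j\<in>UNIV. tmap c ?d q v $ i * (tmap c ?d q w $ j *
        hess_form X D u q (cf ?d (axis i 1) q) (cf ?d (axis j 1) q))) \<longlongrightarrow>
      (\<Sum>i\<in>UNIV. \<Sum>j\<in>UNIV. tmap c ?d x v $ i * (tmap c ?d x w $ j * L i j))) ?F"
      by (intro tendsto_sum tendsto_mult t L)
    moreover have "eventually (\<lambda>q. (\<Sum>i\<in>UNIV. \<Sum>j\<in>UNIV. tmap c ?d q v $ i * (tmap c ?d q w $ j *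
        hess_form X D u q (cf ?d (axis i 1) q) (cf ?d (axis j 1) q))) =
      hess_form X D u q (cf c v q) (cf c w q)) ?F"
      using eventually_in_domain[OF c] eventually_in_domain[OF chart_at_in]
    proof eventually_elim
      case (elim q)
      then show ?case
        using hess_form_expansion[OF \<Omega> u_C2 c(1) _ chart_at_in(1), of q x v w] by simp
    qed
    ultimately show ?thesis by (rule Lim_transform_eventually)
  qed
  \<comment> \<open>\<open>Lim\<close> denotes the actual limit because the filter is nontrivial; in
    the preferred chart the change of chart at \<open>x\<close> is the identity.\<close>
  have val: "hess_form_closure X D \<Omega> u x v w = (\<Sum>i\<in>UNIV. \<Sum>j\<in>UNIV. v $ i * (w $ j * L i j))" for v w
    using tendsto_Lim[OF F lim[OF chart_at_in, of v w]] False
    by (simp add: hess_form_closure_def Let_def tmap_id)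
  show thesis
  proof (rule that[of L])
    show "L i j = L j i" for i j by (rule L_sym)
    show "hess_form_closure X D \<Omega> u x v w = (\<Sum>i\<in>UNIV. \<Sum>j\<in>UNIV. v $ i * (w $ j * L i j))" for v w
      by (rule val)
    show "((\<lambda>q. hess_form X D u q (cf c v q) (cf c w q)) \<longlongrightarrow>
        hess_form_closure X D \<Omega> u x (cf c v x) (cf c w x)) ?F"
      if c: "c \<in> atlas X" "x \<in> dom_of c" for c v w
      using lim[OF c, of v w] unfolding val coord_field_tmap .
  qed
qed

lemma hess_form_closure_interior: "x \<in> \<Omega> \<Longrightarrow> hess_form_closure X D \<Omega> u x = hess_form X D u x"
  by (simp add: hess_form_closure_def fun_eq_iff)

lemma hess_form_closure_sym:
  assumes x: "x \<in> closure \<Omega>"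
  shows "hess_form_closure X D \<Omega> u x v w = hess_form_closure X D \<Omega> u x w v"
proof (cases "x \<in> \<Omega>")
  case True
  show ?thesis unfolding hess_form_closure_interior[OF True] by (rule hess_form_sym[OF \<Omega> u_C2 True])
next
  case False
  obtain L where L: "\<And>i j. L i j = L j i"
    "\<And>v w. hess_form_closure X D \<Omega> u x v w = (\<Sum>i\<in>UNIV. \<Sum>j\<in>UNIV. v $ i * (w $ j * L i j))"
    by (rule hess_form_boundary_limit[OF x False]) blast
  have "(\<Sum>i\<in>UNIV. \<Sum>j\<in>UNIV. v $ i * (w $ j * L i j)) = (\<Sum>j\<in>UNIV. \<Sum>i\<in>UNIV. w $ j * (v $ i * L j i))"
    by (subst sum.swap) (simp add: L(1) mult.left_commute)
  then show ?thesis unfolding L(2) .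
qed

lemma hess_form_closure_linear_left:
  assumes x: "x \<in> closure \<Omega>"
  shows "linear (\<lambda>v. hess_form_closure X D \<Omega> u x v w)"
proof (cases "x \<in> \<Omega>")
  case True
  show ?thesis unfolding hess_form_closure_interior[OF True] by (rule hess_form_linear_left[OF \<Omega> u_C2 True])
next
  case False
  obtain L where L: "\<And>v w. hess_form_closure X D \<Omega> u x v w = (\<Sum>i\<in>UNIV. \<Sum>j\<in>UNIV. v $ i * (w $ j * L i j))"
    by (rule hess_form_boundary_limit[OF x False]) blast
  show ?thesis
    unfolding L by (rule linearI) (simp_all add: sum.distrib sum_distrib_left algebra_simps)
qed

lemma hess_form_closure_continuous:
  assumes c: "c \<in> atlas X"
  shows "continuous_on (closure \<Omega> \<inter> dom_of c) (\<lambda>x. hess_form_closure X D \<Omega> u x (cf c v x) (cf c w x))"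
proof (rule continuous_on_limit_extension)
  fix x assume x: "x \<in> dom_of c"
  show "hess_form X D u x (cf c v x) (cf c w x) = hess_form_closure X D \<Omega> u x (cf c v x) (cf c w x)"
    if "x \<in> \<Omega>" by (simp add: hess_form_closure_interior[OF that])
  assume cl: "x \<in> closure \<Omega>"
  show "((\<lambda>q. hess_form X D u q (cf c v q) (cf c w q)) \<longlongrightarrow>
      hess_form_closure X D \<Omega> u x (cf c v x) (cf c w x)) (at x within \<Omega>)"
  proof (cases "x \<in> \<Omega>")
    case True
    show ?thesis
      unfolding hess_form_closure_interior[OF True]
      by (rule continuous_on_imp_tendsto_within[OF hess_form_continuous[OF \<Omega> u_C2 c]])
        (use True x c \<Omega> in \<open>auto simp: open_dom open_Int\<close>)
  next
    case False
    show ?thesis by (rule hess_form_boundary_limit[OF cl False]) (use c x in blast)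
  qed
qed

end

end

section \<open>Uniform ellipticity\<close>

lemma continuous_on_det:
  fixes G :: "'x::topological_space \<Rightarrow> real ^ 'm::finite ^ 'm"
  assumes "\<And>i j. continuous_on K (\<lambda>x. G x $ i $ j)"
  shows "continuous_on K (\<lambda>x. det (G x))"
  unfolding det_def by (intro continuous_intros assms)

text \<open>By Cramer's rule the solution is a quotient of determinants with continuous
  entries.\<close>

lemma continuous_on_solve:
  fixes G :: "'x::topological_space \<Rightarrow> real ^ 'm::finite ^ 'm"
  assumes G: "\<And>i j. continuous_on K (\<lambda>x. G x $ i $ j)" and b: "\<And>i. continuous_on K (\<lambda>x. b x $ i)"
    and det: "\<And>x. x \<in> K \<Longrightarrow> det (G x) \<noteq> 0" and a: "\<And>x. x \<in> K \<Longrightarrow> G x *v a x = b x"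
  shows "continuous_on K a"
proof -
  have "continuous_on K (\<lambda>x. det (\<chi> i j. if j = k then b x $ i else G x $ i $ j) / det (G x))" for k
  proof (intro continuous_on_divide continuous_on_det G)
    show "continuous_on K (\<lambda>x. (\<chi> i j. if j = k then b x $ i else G x $ i $ j) $ i $ j)" for i j
      by (cases "j = k") (simp_all add: G b)
  qed (simp add: det)
  then have "continuous_on K (\<lambda>x. \<chi> k. det (\<chi> i j. if j = k then b x $ i else G x $ i $ j) / det (G x))"
    by (rule continuous_on_vec_lambda)
  moreover have "(\<chi> k. det (\<chi> i j. if j = k then b x $ i else G x $ i $ j) / det (G x)) = a x"
    if "x \<in> K" for x
    using iffD1[OF cramer[OF det[OF that]] a[OF that]] by (rule sym)
  ultimately show ?thesis by (rule continuous_on_eq)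
qed

context hermitian_space
begin

text \<open>Justifies the \<open>THE\<close> in \<open>endo_of_form\<close>: existence by a sum over
  an orthonormal basis, uniqueness by definiteness of \<open>g\<close>.\<close>

lemma g_endo_of_form:
  assumes lin: "\<And>w. linear (\<lambda>v. H v w)" and sym: "\<And>v w. H v w = H w v"
  shows "g (endo_of_form g H *v v) w = H v w"
proof -
  \<comment> \<open>The zero endomorphism merely provides some orthonormal basis.\<close>
  have "(0 :: 'n endo) \<in> symmetric_endos g"
    by (simp add: symmetric_endos_def g_simps)
  then obtain e lam where "onb (pair_basis e)" by (rule ex_skew_eigenbasis)
  then obtain b where b: "onb b" by blast
  define A where "A = matrix (\<lambda>v. \<Sum>k\<in>UNIV. H v (b k) *\<^sub>R b k)"
  have A_vec: "A *v v = (\<Sum>k\<in>UNIV. H v (b k) *\<^sub>R b k)" for v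
    unfolding A_def
    by (subst matrix_works)
      (auto intro!: linearI simp: linear_matrix_vector_mul_eq linear_add[OF lin] linear_scale[OF lin]
        sum.distrib scaleR_sum_right algebra_simps)
  have H_right: "H v (\<Sum>k\<in>UNIV. x k *\<^sub>R b k) = (\<Sum>k\<in>UNIV. x k * H v (b k))" for v x
  proof -
    have "H v (\<Sum>k\<in>UNIV. x k *\<^sub>R b k) = H (\<Sum>k\<in>UNIV. x k *\<^sub>R b k) v" by (rule sym)
    also have "\<dots> = (\<Sum>k\<in>UNIV. x k * H (b k) v)"
      by (simp add: linear_sum[OF lin] linear_scale[OF lin])
    finally show ?thesis by (simp only: sym[of v])
  qed
  have A: "g (A *v v) w = H v w" for v w
  proof -
    have "g (A *v v) w = (\<Sum>k\<in>UNIV. g w (b k) * H v (b k))"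
      by (subst g_sym) (simp add: A_vec g_sum_right g_simps mult.commute)
    also have "\<dots> = H v (\<Sum>k\<in>UNIV. g w (b k) *\<^sub>R b k)" by (simp add: H_right)
    finally show ?thesis using onb_expansion[OF b, of w] by simp
  qed
  have "A' = A" if A': "\<forall>v w. g (A' *v v) w = H v w" for A'
  proof -
    have "A' *v v - A *v v = 0" for v
    proof -
      have "g (A' *v v - A *v v) (A' *v v - A *v v) = 0"
        using A' by (simp only: g_simps A)
      then show ?thesis by (simp add: g_eq_0_iff)
    qed
    then show ?thesis by (simp add: matrix_eq)
  qed
  then have "endo_of_form g H = A"
    unfolding endo_of_form_def using A by (intro the_equality) auto
  then show ?thesis by (simp add: A)
qed

end

section \<open>Continuous endomorphism fields\<close>

context smooth_manifold
begin

text \<open>The matrix \<open>B x\<close> refers to the preferred chart at \<open>x\<close>, which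
  jumps; continuity is therefore asked of the components in a fixed chart.\<close>

definition continuous_endo :: "'a set \<Rightarrow> ('a \<Rightarrow> 'n endo) \<Rightarrow> bool" where
  "continuous_endo K B \<longleftrightarrow>
     (\<forall>c\<in>\<A>. \<forall>v. continuous_on (K \<inter> dom_of c) (\<lambda>x. components \<A> c x (B x *v coord_field \<A> c v x)))"

lemma continuous_endoD:
  "continuous_endo K B \<Longrightarrow> c \<in> \<A> \<Longrightarrow>
    continuous_on (K \<inter> dom_of c) (\<lambda>x. components \<A> c x (B x *v coord_field \<A> c v x))"
  by (simp add: continuous_endo_def)

lemma continuous_endo_id: "continuous_endo K (\<lambda>_. mat 1)"
  unfolding continuous_endo_def
proof (intro ballI allI)
  fix c and v :: "'n model" assume c: "c \<in> \<A>"
  have "continuous_on (K \<inter> dom_of c) (\<lambda>_. v)" by (rule continuous_on_const)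
  then show "continuous_on (K \<inter> dom_of c) (\<lambda>x. components \<A> c x (mat 1 *v coord_field \<A> c v x))"
    by (rule continuous_on_eq) (simp add: c)
qed

lemma continuous_endo_add:
  assumes "continuous_endo K A" "continuous_endo K B"
  shows "continuous_endo K (\<lambda>x. A x + B x)"
  unfolding continuous_endo_def
proof (intro ballI allI)
  fix c v assume c: "c \<in> \<A>"
  have "continuous_on (K \<inter> dom_of c) (\<lambda>x. components \<A> c x (A x *v coord_field \<A> c v x) +
      components \<A> c x (B x *v coord_field \<A> c v x))"
    by (intro continuous_on_add continuous_endoD assms c)
  then show "continuous_on (K \<inter> dom_of c) (\<lambda>x. components \<A> c x ((A x + B x) *v coord_field \<A> c v x))"
    by (rule continuous_on_eq)
      (simp add: matrix_vector_mult_add_rdistrib linear_add[OF linear_components[OF c]])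
qed

lemma continuous_endo_scaleR:
  assumes "continuous_endo K A"
  shows "continuous_endo K (\<lambda>x. r *\<^sub>R A x)"
  unfolding continuous_endo_def
proof (intro ballI allI)
  fix c v assume c: "c \<in> \<A>"
  have "continuous_on (K \<inter> dom_of c) (\<lambda>x. r *\<^sub>R components \<A> c x (A x *v coord_field \<A> c v x))"
    by (intro continuous_on_scaleR continuous_on_const continuous_endoD assms c)
  then show "continuous_on (K \<inter> dom_of c) (\<lambda>x. components \<A> c x ((r *\<^sub>R A x) *v coord_field \<A> c v x))"
    by (rule continuous_on_eq)
      (simp add: scaleR_matrix_vector_assoc[symmetric] linear_scale[OF linear_components[OF c]])
qed

text \<open>Continuity of \<open>A\<close> is known on coordinate fields only, so the inner vector
  is first expanded in the coordinate frame.\<close>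

lemma continuous_endo_mult:
  assumes A: "continuous_endo K A" and B: "continuous_endo K B"
  shows "continuous_endo K (\<lambda>x. A x ** B x)"
  unfolding continuous_endo_def
proof (intro ballI allI)
  fix c v assume c: "c \<in> \<A>"
  let ?C = "components \<A> c" and ?E = "coord_field \<A> c"
  have "continuous_on (K \<inter> dom_of c)
      (\<lambda>x. \<Sum>i\<in>UNIV. ?C x (B x *v ?E v x) $ i *\<^sub>R ?C x (A x *v ?E (axis i 1) x))"
    by (intro continuous_on_sum continuous_on_scaleR continuous_on_component continuous_endoD A B c)
  then show "continuous_on (K \<inter> dom_of c) (\<lambda>x. ?C x ((A x ** B x) *v ?E v x))"
  proof (rule continuous_on_eq)
    fix x assume "x \<in> K \<inter> dom_of c"
    then have x: "x \<in> dom_of c" by simp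
    have "linear (\<lambda>z. ?C x (A x *v ?E z x))"
      using linear_compose[OF linear_compose[OF linear_coord_field[OF c x] matrix_vector_mul_linear]
          linear_components[OF c x]] by (simp add: o_def)
    from linear_model_expansion[OF this, of "?C x (B x *v ?E v x)"]
    show "(\<Sum>i\<in>UNIV. ?C x (B x *v ?E v x) $ i *\<^sub>R ?C x (A x *v ?E (axis i 1) x)) =
        ?C x ((A x ** B x) *v ?E v x)"
      by (simp add: c x matrix_vector_mul_assoc)
  qed
qed

lemma continuous_endo_trace:
  assumes A: "continuous_endo K A"
  shows "continuous_on K (\<lambda>x. trace (A x))"
proof -
  have tr: "trace (A x) = (\<Sum>i\<in>UNIV. components \<A> c x (A x *v coord_field \<A> c (axis i 1) x) $ i)"
    if c: "c \<in> \<A>" "x \<in> dom_of c" for c x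
  proof -
    \<comment> \<open>\<open>E\<close> and \<open>C\<close> are inverse to each other, so
      \<open>C ** (A x ** E)\<close> is the matrix of \<open>A x\<close> in the chart
      \<open>c\<close> and has the same trace.\<close>
    define E where "E = matrix (\<lambda>v. coord_field \<A> c v x)"
    define C where "C = matrix (components \<A> c x)"
    have E: "E *v v = coord_field \<A> c v x" for v
      unfolding E_def using linear_coord_field[OF c]
      by (intro matrix_works) (simp add: linear_matrix_vector_mul_eq)
    have C: "C *v v = components \<A> c x v" for v
      unfolding C_def using linear_components[OF c]
      by (intro matrix_works) (simp add: linear_matrix_vector_mul_eq)
    have "E ** C = mat 1"
      by (simp add: matrix_eq matrix_vector_mul_assoc[symmetric] E C c)
    then have "trace (A x) = trace ((A x ** E) ** C)"
      by (simp add: matrix_mul_assoc[symmetric])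
    also have "\<dots> = trace (C ** (A x ** E))" by (rule trace_mul_sym)
    also have "\<dots> = (\<Sum>i\<in>UNIV. ((C ** (A x ** E)) *v axis i 1) $ i)"
      by (simp add: trace_def matrix_vector_mult_basis column_def)
    also have "\<dots> = (\<Sum>i\<in>UNIV. components \<A> c x (A x *v coord_field \<A> c (axis i 1) x) $ i)"
      by (simp add: matrix_vector_mul_assoc[symmetric] E C)
    finally show ?thesis .
  qed
  show ?thesis
    unfolding continuous_on_def
  proof
    fix x assume x: "x \<in> K"
    let ?c = "chart_at \<A> x"
    have "continuous_on (K \<inter> dom_of ?c)
        (\<lambda>x. \<Sum>i\<in>UNIV. components \<A> ?c x (A x *v coord_field \<A> ?c (axis i 1) x) $ i)"
      by (intro continuous_on_sum continuous_on_component continuous_endoD A chart_at_in)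
    then have "continuous_on (K \<inter> dom_of ?c) (\<lambda>x. trace (A x))"
      by (rule continuous_on_eq) (simp add: tr[of ?c])
    then have "((\<lambda>x. trace (A x)) \<longlongrightarrow> trace (A x)) (at x within K \<inter> dom_of ?c)"
      unfolding continuous_on_def by (rule bspec) (simp add: x)
    moreover have "at x within K \<inter> dom_of ?c = at x within K"
      by (rule at_within_nhd[of x "dom_of ?c"]) (auto simp: open_dom)
    ultimately show "((\<lambda>x. trace (A x)) \<longlongrightarrow> trace (A x)) (at x within K)" by simp
  qed
qed

end

section \<open>Continuity of the Hessian endomorphism and of the operator\<close>

context gromov_levi_civita
begin

lemmas gromov_unfolded = gromov[unfolded gromov_manifold_def, THEN conjunct2]
lemmas symplectic = gromov_unfolded[THEN conjunct1, unfolded symplectic_form_def]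
lemmas almost_complex = gromov_unfolded[THEN conjunct2, THEN conjunct1, unfolded almost_complex_structure_def]
lemmas compatible = gromov_unfolded[THEN conjunct2, THEN conjunct2]

lemma bilinear_symp: "bilinear (symp X p)" and symp_skew: "symp X p v w = - symp X p w v"
  and symp_J: "symp X p v w = symp X p (cplx X p *v v) (cplx X p *v w)"
  and symp_pos: "v \<noteq> 0 \<Longrightarrow> symp X p (cplx X p *v v) v > 0"
  and J_J: "cplx X p ** cplx X p = - mat 1"
proof -
  note symp = spec[OF symplectic[THEN conjunct1], of p]
  show "bilinear (symp X p)" by (rule symp[THEN conjunct1])
  show "symp X p v w = - symp X p w v" by (rule symp[THEN conjunct2, THEN conjunct1, rule_format])
  show "symp X p v w = symp X p (cplx X p *v v) (cplx X p *v w)"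
    by (rule compatible[THEN conjunct1, rule_format])
  show "symp X p (cplx X p *v v) v > 0" if "v \<noteq> 0"
    by (rule compatible[THEN conjunct2, rule_format]) (rule that)
  show "cplx X p ** cplx X p = - mat 1" by (rule almost_complex[THEN conjunct1, rule_format])
qed

lemma J_J_vec: "cplx X p *v (cplx X p *v v) = - v"
  by (simp add: matrix_vector_mul_assoc J_J matrix_vector_mult_uminus_left)

lemma hermitian: "hermitian_space (metric X p) (cplx X p)"
proof
  show "bilinear (metric X p)"
    unfolding bilinear_def metric_def
    by (intro conjI allI linearI)
      (simp_all add: matrix_vector_right_distrib matrix_vector_mult_scaleR
        bilinear_ladd[OF bilinear_symp] bilinear_radd[OF bilinear_symp]
        bilinear_lmul[OF bilinear_symp] bilinear_rmul[OF bilinear_symp])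
  \<comment> \<open>\<omega>(Jv, w) = \<omega>(JJv, Jw) = - \<omega>(v, Jw) = \<omega>(Jw,
    v).\<close>
  show "metric X p v w = metric X p w v" for v w
    unfolding metric_def
    using symp_J[of p "cplx X p *v v" w] symp_skew[of p v "cplx X p *v w"]
    by (simp add: J_J_vec bilinear_lneg[OF bilinear_symp])
  show "metric X p v v > 0" if "v \<noteq> 0" for v
    using symp_pos[OF that] by (simp add: metric_def)
  show "metric X p (cplx X p *v v) (cplx X p *v w) = metric X p v w" for v w
    unfolding metric_def by (rule symp_J[symmetric])
  show "cplx X p ** cplx X p = - mat 1" by (rule J_J)
qed

lemma symp_metric: "symp X p v w = metric X p v (cplx X p *v w)"
  unfolding metric_def by (rule symp_J)

lemma continuous_endo_cplx: "continuous_endo K (cplx X)"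
  unfolding continuous_endo_def
proof (intro ballI allI)
  fix c v assume c: "c \<in> atlas X"
  have "smooth_field_on (atlas X) (dom_of c) (\<lambda>q. cplx X q *v cf c v q)"
    by (rule almost_complex[THEN conjunct2, rule_format]) (rule c)
  from smooth_field_on_continuous[OF c this]
  show "continuous_on (K \<inter> dom_of c) (\<lambda>x. components (atlas X) c x (cplx X x *v cf c v x))"
    by (rule continuous_on_subset) auto
qed

lemma metric_continuous:
  assumes c: "c \<in> atlas X"
  shows "continuous_on (K \<inter> dom_of c) (\<lambda>x. metric X x (cf c v x) (cf c w x))"
proof -
  let ?J = "\<lambda>x. components (atlas X) c x (cplx X x *v cf c v x)"
  have "smooth_fun_on (atlas X) (dom_of c) (\<lambda>q. symp X q (cf c v q) (cf c w q))" for v w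
    by (rule symplectic[THEN conjunct2, THEN conjunct1, rule_format]) (rule c)
  then have "Ck_fun_on (atlas X) 0 (dom_of c) (\<lambda>q. symp X q (cf c v q) (cf c w q))" for v w
    unfolding smooth_fun_on_def by blast
  from Ck_fun_on_continuous[OF c this]
  have \<omega>: "continuous_on (K \<inter> dom_of c) (\<lambda>q. symp X q (cf c v q) (cf c w q))" for v w
    by (rule continuous_on_subset) auto
  have "continuous_on (K \<inter> dom_of c) (\<lambda>x. \<Sum>i\<in>UNIV. ?J x $ i * symp X x (cf c (axis i 1) x) (cf c w x))"
    by (intro continuous_on_sum continuous_on_mult \<omega> continuous_on_component
        continuous_endoD continuous_endo_cplx c)
  then show ?thesis
  proof (rule continuous_on_eq)
    fix x assume "x \<in> K \<inter> dom_of c"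
    then have x: "x \<in> dom_of c" by simp
    have "linear (\<lambda>z. symp X x z (cf c w x))"
      using bilinear_symp by (simp add: bilinear_def)
    from linear_compose[OF linear_coord_field[OF c x] this]
    have "linear (\<lambda>z. symp X x (cf c z x) (cf c w x))" by (simp add: o_def)
    from linear_model_expansion[OF this, of "?J x"]
    show "(\<Sum>i\<in>UNIV. ?J x $ i * symp X x (cf c (axis i 1) x) (cf c w x)) = metric X x (cf c v x) (cf c w x)"
      by (simp add: metric_def c x)
  qed
qed

context
  fixes \<Omega> u
  assumes \<Omega>: "open \<Omega>" and u: "C2_on_closure (atlas X) \<Omega> u"
begin

lemma metric_Hess:
  assumes x: "x \<in> closure \<Omega>"
  shows "metric X x (Hess X D \<Omega> u x *v v) w = hess_form_closure X D \<Omega> u x v w"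
  unfolding Hess_def
  by (rule hermitian_space.g_endo_of_form[OF hermitian])
    (rule hess_form_closure_linear_left[OF \<Omega> u x] hess_form_closure_sym[OF \<Omega> u x])+

lemma Hess_symmetric: "x \<in> closure \<Omega> \<Longrightarrow> Hess X D \<Omega> u x \<in> symmetric_endos (metric X x)"
  unfolding symmetric_endos_def mem_Collect_eq
  by (intro allI, subst (2) hermitian_space.g_sym[OF hermitian])
    (simp only: metric_Hess, rule hess_form_closure_sym[OF \<Omega> u])

text \<open>Only the bilinear form is given explicitly. The components of the endomorphism solve a
  linear system whose matrix is the Gram matrix of the coordinate frame.\<close>

lemma continuous_endo_Hess: "continuous_endo (closure \<Omega>) (Hess X D \<Omega> u)"
  unfolding continuous_endo_def
proof (intro ballI allI)
  fix c v assume c: "c \<in> atlas X"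
  let ?K = "closure \<Omega> \<inter> dom_of c"
  define G :: "'a \<Rightarrow> 'n endo" where
    "G x = (\<chi> j i. metric X x (cf c (axis i 1) x) (cf c (axis j 1) x))" for x
  define b :: "'a \<Rightarrow> 'n model" where
    "b x = (\<chi> j. hess_form_closure X D \<Omega> u x (cf c v x) (cf c (axis j 1) x))" for x
  have G_vec: "(G x *v z) $ j = metric X x (cf c z x) (cf c (axis j 1) x)" if x: "x \<in> dom_of c" for x z j
  proof -
    interpret H: hermitian_space "metric X x" "cplx X x" by (rule hermitian)
    from linear_compose[OF linear_coord_field[OF c x] H.linear_g_left]
    have "linear (\<lambda>z. metric X x (cf c z x) (cf c (axis j 1) x))" by (simp add: o_def)
    from linear_model_expansion[OF this, of z] show ?thesis
      by (simp add: G_def matrix_vector_mult_def mult.commute)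
  qed
  show "continuous_on ?K (\<lambda>x. components (atlas X) c x (Hess X D \<Omega> u x *v cf c v x))"
  proof (rule continuous_on_solve[where G = G and b = b])
    show "continuous_on ?K (\<lambda>x. G x $ i $ j)" for i j
      using metric_continuous[OF c, of "closure \<Omega>"] by (simp add: G_def)
    show "continuous_on ?K (\<lambda>x. b x $ i)" for i
      using hess_form_closure_continuous[OF \<Omega> u c] by (simp add: b_def)
    fix x assume "x \<in> ?K"
    then have x: "x \<in> closure \<Omega>" "x \<in> dom_of c" by auto
    show "G x *v components (atlas X) c x (Hess X D \<Omega> u x *v cf c v x) = b x"
      by (simp add: vec_eq_iff G_vec[OF x(2)] c x metric_Hess b_def)
    interpret H: hermitian_space "metric X x" "cplx X x" by (rule hermitian)
    \<comment> \<open>A kernel vector yields a tangent vector orthogonal to the whole coordinate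
      frame, hence to itself.\<close>
    have "z = 0" if "G x *v z = 0" for z
    proof -
      have 0: "metric X x (cf c z x) (cf c (axis j 1) x) = 0" for j
        using G_vec[OF x(2), of z j] that by simp
      have "metric X x (cf c z x) (cf c z x) =
          metric X x (cf c z x) (\<Sum>j\<in>UNIV. z $ j *\<^sub>R cf c (axis j 1) x)"
        using coord_field_expansion[OF c x(2), of z] by simp
      also have "\<dots> = 0" by (simp add: H.g_sum_right H.g_simps 0)
      finally have "cf c z x = 0" by (simp add: H.g_eq_0_iff)
      then have "components (atlas X) c x (cf c z x) = 0"
        using linear_0[OF linear_components[OF c x(2)]] by simp
      then show ?thesis by (simp add: c x)
    qed
    then have "\<exists>B. B ** G x = mat 1" using matrix_left_invertible_ker by blast
    then show "det (G x) \<noteq> 0"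
      using invertible_left_inverse invertible_det_nz by blast
  qed
qed

lemma continuous_trace_Hess: "continuous_on (closure \<Omega>) (\<lambda>x. trace (Hess X D \<Omega> u x))"
  by (rule continuous_endo_trace[OF continuous_endo_Hess])

lemma continuous_M_Lag_Hess: "continuous_on (closure \<Omega>) (\<lambda>x. M_Lag (cplx X x) (Hess X D \<Omega> u x))"
proof (rule fun_algebra_M_Lag[where Y = "closure \<Omega>" and g = "metric X" and J = "cplx X"
      and A = "Hess X D \<Omega> u" and Q = "continuous_on (closure \<Omega>)"])
  show "fun_algebra (closure \<Omega>) (continuous_on (closure \<Omega>) :: ('a \<Rightarrow> real) \<Rightarrow> bool)"
    by (rule fun_algebraI)
      (auto intro: continuous_on_const continuous_on_add continuous_on_mult continuous_on_eq)
  have S: "continuous_endo (closure \<Omega>) (\<lambda>x. skew_part (cplx X x) (Hess X D \<Omega> u x))"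
    unfolding skew_part_def
    by (intro continuous_endo_scaleR continuous_endo_add continuous_endo_mult
        continuous_endo_cplx continuous_endo_Hess)
  have "continuous_endo (closure \<Omega>) (\<lambda>x. mpow (skew_part (cplx X x) (Hess X D \<Omega> u x)) k)" for k
    by (induction k) (simp_all add: continuous_endo_id continuous_endo_mult S)
  then show "continuous_on (closure \<Omega>) (\<lambda>x. trace (mpow (skew_part (cplx X x) (Hess X D \<Omega> u x)) k))" for k
    by (rule continuous_endo_trace)
qed (rule hermitian Hess_symmetric continuous_trace_Hess | assumption)+

end

end

theorem proposition12p2:
  fixes X :: "('a::{second_countable_topology, t2_space}, 'n::finite) gromov"
    and D :: "'a \<Rightarrow> 'n model \<Rightarrow> ('a \<Rightarrow> 'n model) \<Rightarrow> 'n model"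
    and \<Omega> :: "'a set"
    and u f :: "'a \<Rightarrow> real"
  assumes "gromov_manifold X"
    and "levi_civita X D"
    and "open \<Omega>" and "connected \<Omega>" and "compact (closure \<Omega>)"
    and "C2_on_closure (atlas X) \<Omega> u"
    and "lagrangian_psh_on_closure X D \<Omega> u"
    and "\<forall>x\<in>closure \<Omega>. M_Lag (cplx X x) (Hess X D \<Omega> u x) = f x \<and> f x > 0"
  shows "uniformly_elliptic_on X (closure \<Omega>) (linearization X D \<Omega> u)"
proof -
  interpret gromov_levi_civita X D by (rule gromov_levi_civita.intro[OF assms(1,2)])
  let ?K = "closure \<Omega>"
  let ?A = "Hess X D \<Omega> u"
  let ?r = "\<lambda>x. M_Lag (cplx X x) (?A x) / trace (?A x)"
  have M: "M_Lag (cplx X x) (?A x) > 0" if "x \<in> ?K" for x using assms(8) that by auto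
  have psh: "trace_on (metric X x) (?A x) W \<ge> 0" if "x \<in> ?K" "lagrangian (symp X x) W" for x W
    using assms(7) that by (simp add: lagrangian_psh_on_closure_def)
  note sym = Hess_symmetric[OF assms(3,6)]
  note bound = hermitian_space.dM_Lag_lower_bound[OF hermitian sym symp_metric psh M]
  have tr: "trace (?A x) > 0" if "x \<in> ?K" for x
    by (rule bound(1)) (use that in auto)
  have dM: "linearization X D \<Omega> u x P \<ge> ?r x * trace P"
    if "x \<in> ?K" "P \<in> symmetric_endos (metric X x)" "\<And>v. metric X x (P *v v) v \<ge> 0" for x P
    unfolding linearization_def by (rule bound(2)) (use that in auto)
  \<comment> \<open>Replacing the pointwise ratio by a smaller uniform constant preserves the bound
    only if the trace of \<open>P\<close> is nonnegative.\<close>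
  have tr_P: "trace P \<ge> 0" if "\<And>v. metric X x (P *v v) v \<ge> 0" for x P
  proof -
    interpret H: hermitian_space "metric X x" "cplx X x" by (rule hermitian)
    have "(0 :: 'n endo) \<in> symmetric_endos (metric X x)"
      by (simp add: symmetric_endos_def H.g_simps)
    then obtain e lam where "H.onb (H.pair_basis e)" by (rule H.ex_skew_eigenbasis)
    then show ?thesis by (simp add: H.onb_trace sum_nonneg that)
  qed
  \<comment> \<open>The minimum of the ratio is attained and hence positive; on an empty closure any
    constant serves.\<close>
  obtain c where c: "c > 0" "\<And>x. x \<in> ?K \<Longrightarrow> c \<le> ?r x"
  proof (cases "?K = {}")
    case True
    then show thesis using that[of 1] by simp
  next
    case False
    have "continuous_on ?K ?r"
      by (intro continuous_on_divide continuous_M_Lag_Hess continuous_trace_Hess assms)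
        (use tr in fastforce)
    from continuous_attains_inf[OF assms(5) False this]
    obtain x0 where x0: "x0 \<in> ?K" "\<And>x. x \<in> ?K \<Longrightarrow> ?r x0 \<le> ?r x" by blast
    then show thesis using that[of "?r x0"] M[OF x0(1)] tr[OF x0(1)] by simp
  qed
  show ?thesis
    unfolding uniformly_elliptic_on_def
  proof (intro exI[of _ c] conjI ballI impI c(1))
    fix x P assume x: "x \<in> ?K" and P: "P \<in> symmetric_endos (metric X x)" "\<forall>v. metric X x (P *v v) v \<ge> 0"
    have "c * trace P \<le> ?r x * trace P"
      using c(2)[OF x] tr_P P(2) by (intro mult_right_mono) auto
    also have "\<dots> \<le> linearization X D \<Omega> u x P" using P by (intro dM x) auto
    finally show "c * trace P \<le> linearization X D \<Omega> u x P" .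
  qed
qed

end
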